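(* Let $n=p+q\ge2$ with $0<p<n$. Let $D$ be the Dirac operator of the pseudo-Riemannian manifold $(\mathbb R^n,\langle\cdot,\cdot\rangle_{p,q})$, endowed with the canonical spin structure, acting as an unbounded operator in $L^2(\mathbb R^n,\Delta_{p,q})$ (the Hilbert space $L^2_{\xi_e}(S)$ belonging to the maximal time-like subbundle $\xi_e=\mathrm{span}(e_1,\dots,e_p)$) with domain $C_0^\infty(\mathbb R^n,\Delta_{p,q})$, and let $\bar D$ be its closure. Then the spectrum of $D$ is the whole complex plane: $$\sigma(D)=\sigma(\bar D)=\sigma_c(\bar D)=\mathbb C.$$ In particular, $\sigma_p(\bar D)=\sigma_r(\bar D)=\emptyset$.
   Context: $\langle x,y\rangle_{p,q}=-\sum_{i\le p}x_iy_i+\sum_{i>p}x_iy_i$ on $\mathbb R^n$; Clifford relation $x\cdot y+y\cdot x=-2\langle x,y\rangle_{p,q}$. Let $m=[n/2]$ and $\Delta_{p,q}=\mathbb C^{2^m}$ with its standard Hermitian inner product $(\cdot,\cdot)_{\Delta_{p,q}}$. Clifford multiplication of $x\in\mathbb R^n$ on $\Delta_{p,q}$ is the linear extension of $e_j\mapsto\kappa_{p,q}(e_j)$, given by $m$-fold Kronecker products: for $j\le2m$, $\kappa_{p,q}(e_j)=\tau(j)\,E\otimes\dots\otimes E\otimes U_{\sigma(j)}\otimes T\otimes\dots\otimes T$ with $[(j-1)/2]$ factors $T$, and if $n=2m+1$, $\kappa_{p,q}(e_{2m+1})=\tau(2m+1)\,\mathbf i\,T^{\otimes m}$. Here $E$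 is the $2\times2$ identity, $U_1=\mathrm{diag}(\mathbf i,-\mathbf i)$, $U_2=\begin{pmatrix}0&\mathbf i\\ \mathbf i&0\end{pmatrix}$, $T=\begin{pmatrix}0&-\mathbf i\\ \mathbf i&0\end{pmatrix}$, $\tau(j)=\mathbf i$ if $j\le p$ and $1$ if $j>p$, $\sigma(j)=1$ for $j$ odd, $2$ for $j$ even. The canonical (unique) spin structure is $\mathbb R^n\times\mathrm{Spin}_0(p,q)$, spinor fields are functions $\psi\in C^\infty(\mathbb R^n,\Delta_{p,q})$, and $$D\psi=\sum_{j=1}^n\kappa_j\,e_j\cdot\frac{\partial\psi}{\partial x^j},\qquad \kappa_j=\langle e_j,e_j\rangle_{p,q}.$$ The inner product in $L^2(\mathbb R^n,\Delta_{p,q})$ is $\int_{\mathbb R^n}(\psi_1(x),\psi_2(x))_{\Delta_{p,q}}dx$. $D$ is closable. For an operator $A$ in a Hilbert space $H$ and $A_\lambda=\lambda \mathrm I-A$: $\lambda\in\sigma_p(A)$ iff $\ker A_\lambda\ne\{0\}$; $\lambda\in\sigma_r(A)$ iff $\ker A_\lambda=\{0\}$ and $\overline{\mathrm{ran} A_\lambda}\neq H$; $\lambda\in\sigma_c(A)$ iff $\ker A_\lambda=\{0\}$, $\overline{\mathrm{ran} A_\lambda}=H$ and $A_\lambda^{-1}$ (on $\mathrm{ran}A_\lambda$) is unbounded; $\lambda\in\rho(A)$ iff $\ker A_\lambda=\{0\}$, $\overline{\mathrm{ran} A_\lambda}=H$ and $A_\lambda^{-1}$ is bounded. $\sigma(A)=\mathbb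 C\setminus\rho(A)$. *)

theory Defs
  imports "HOL-Analysis.Analysis"
begin

section \<open>Complex Hilbert spaces and spectra of unbounded operators\<close>

class complex_hilbert_space = real_inner + complete_space +
  fixes scaleC :: "complex \<Rightarrow> 'a \<Rightarrow> 'a"  (infixr \<open>*\<^sub>C\<close> 75)
    and cinner :: "'a \<Rightarrow> 'a \<Rightarrow> complex"
  assumes scaleC_add_right: "c *\<^sub>C (x + y) = c *\<^sub>C x + c *\<^sub>C y"
    and scaleC_add_left: "(c + d) *\<^sub>C x = c *\<^sub>C x + d *\<^sub>C x"
    and scaleC_scaleC: "c *\<^sub>C d *\<^sub>C x = (c * d) *\<^sub>C x"
    and scaleC_of_real: "complex_of_real r *\<^sub>C x = r *\<^sub>R x"
    and cinner_commute: "cinner x y = cnj (cinner y x)"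
    and cinner_add_left: "cinner (x + y) z = cinner x z + cinner y z"
    and cinner_scaleC_left: "cinner (c *\<^sub>C x) y = c * cinner x y"
    and inner_eq_Re_cinner: "inner x y = Re (cinner x y)"

text \<open>An operator is given by its graph, so its domain is \<^term>\<open>Domain A\<close>, its range
  \<^term>\<open>Range A\<close>, its inverse (if injective) \<^term>\<open>converse A\<close>, and the closure of a
  closable operator is \<^term>\<open>closure A\<close>, taken in the product topology.\<close>

type_synonym 'h operator = "('h \<times> 'h) set"

definition shifted :: "complex \<Rightarrow> 'h::complex_hilbert_space operator \<Rightarrow> 'h operator" where
  "shifted l A = {(x, l *\<^sub>C x - y) | x y. (x, y) \<in> A}"

definition op_ker :: "'h::complex_hilbert_space operator \<Rightarrow> 'h set" where
  "op_ker A = {x. (x, 0) \<in> A}"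

definition op_bounded :: "'h::complex_hilbert_space operator \<Rightarrow> bool" where
  "op_bounded A \<longleftrightarrow> (\<exists>C. \<forall>(x, y) \<in> A. norm y \<le> C * norm x)"

definition point_spectrum :: "'h::complex_hilbert_space operator \<Rightarrow> complex set" where
  "point_spectrum A = {l. op_ker (shifted l A) \<noteq> {0}}"

definition residual_spectrum :: "'h::complex_hilbert_space operator \<Rightarrow> complex set" where
  "residual_spectrum A =
     {l. op_ker (shifted l A) = {0} \<and> closure (Range (shifted l A)) \<noteq> UNIV}"

definition continuous_spectrum :: "'h::complex_hilbert_space operator \<Rightarrow> complex set" where
  "continuous_spectrum A =
     {l. op_ker (shifted l A) = {0} \<and> closure (Range (shifted l A)) = UNIV
        \<and> \<not> op_bounded (converse (shifted l A))}"

definition resolvent_set :: "'h::complex_hilbert_space operator \<Rightarrow> complex set" where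
  "resolvent_set A =
     {l. op_ker (shifted l A) = {0} \<and> closure (Range (shifted l A)) = UNIV
        \<and> op_bounded (converse (shifted l A))}"

definition spectrum :: "'h::complex_hilbert_space operator \<Rightarrow> complex set" where
  "spectrum A = UNIV - resolvent_set A"


section \<open>The Hilbert space of square-integrable \<open>\<complex>\<^sup>s\<close>-valued functions\<close>

definition herm :: "complex^'s \<Rightarrow> complex^'s \<Rightarrow> complex" where
  "herm u v = (\<Sum>a\<in>UNIV. u $ a * cnj (v $ a))"

definition square_integrable :: "('a::euclidean_space \<Rightarrow> complex^'s) \<Rightarrow> bool" where
  "square_integrable f \<longleftrightarrow>
     f \<in> borel_measurable lborel \<and> integrable lborel (\<lambda>x. (norm (f x))\<^sup>2)"

lemma norm_scalar_mult: "norm (c *s v) = cmod c * norm (v :: complex^'s)"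
proof -
  have "(norm (c *s v))\<^sup>2 = (cmod c * norm v)\<^sup>2"
    by (simp add: norm_vec_def L2_set_def sum_nonneg power_mult_distrib norm_mult sum_distrib_left)
  then show ?thesis
    by simp
qed

lemma herm_commute: "herm u v = cnj (herm v u)"
  by (simp add: herm_def mult.commute)

lemma herm_add_left: "herm (u + v) w = herm u w + herm v w"
  by (simp add: herm_def algebra_simps sum.distrib)

lemma herm_scale_left: "herm (c *s u) v = c * herm u v"
  by (simp add: herm_def algebra_simps sum_distrib_left)

lemma herm_self: "herm u u = of_real ((norm u)\<^sup>2)"
proof -
  have "herm u u = (\<Sum>a\<in>UNIV. of_real ((cmod (u $ a))\<^sup>2))"
    unfolding herm_def by (intro sum.cong refl) (metis complex_norm_square)
  then show ?thesis
    by (simp add: norm_vec_def L2_set_def sum_nonneg)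
qed

lemma cmod_herm_le: "cmod (herm u v) \<le> CARD('s) * ((norm u)\<^sup>2 + (norm (v :: complex^'s))\<^sup>2)"
proof -
  have "cmod (u $ a * cnj (v $ a)) \<le> (norm u)\<^sup>2 + (norm v)\<^sup>2" for a
  proof -
    have "cmod (u $ a * cnj (v $ a)) \<le> norm u * norm v"
      by (auto simp: norm_mult intro!: mult_mono Finite_Cartesian_Product.norm_nth_le)
    also have "\<dots> \<le> (norm u)\<^sup>2 + (norm v)\<^sup>2"
      using sum_squares_bound[of "norm u" "norm v"] mult_nonneg_nonneg[OF norm_ge_zero[of u] norm_ge_zero[of v]]
      by linarith
    finally show ?thesis .
  qed
  then have "cmod (herm u v) \<le> (\<Sum>a\<in>(UNIV::'s set). (norm u)\<^sup>2 + (norm v)\<^sup>2)"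
    unfolding herm_def by (intro order_trans[OF norm_sum] sum_mono)
  then show ?thesis
    by simp
qed

lemma measurable_herm:
  fixes f g :: "'a::euclidean_space \<Rightarrow> complex^'s"
  assumes "f \<in> borel_measurable lborel" "g \<in> borel_measurable lborel"
  shows "(\<lambda>x. herm (f x) (g x)) \<in> borel_measurable lborel"
proof -
  have nth: "(\<lambda>x. h x $ a) \<in> borel_measurable lborel"
    if "h \<in> borel_measurable lborel" for h :: "'a \<Rightarrow> complex^'s" and a
    using measurable_compose[OF that borel_measurable_continuous_onI[of "\<lambda>v. v $ a"]]
    by (simp add: continuous_on_component continuous_on_id)
  have "(\<lambda>x. cnj (g x $ a)) \<in> borel_measurable lborel" for a
    using measurable_compose[OF nth[OF assms(2)] borel_measurable_continuous_onI[of cnj]]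
    by (simp add: continuous_on_cnj)
  then show ?thesis
    unfolding herm_def by (intro borel_measurable_sum borel_measurable_times nth assms)
qed

lemma integrable_herm:
  fixes f g :: "'a::euclidean_space \<Rightarrow> complex^'s"
  assumes "square_integrable f" "square_integrable g"
  shows "integrable lborel (\<lambda>x. herm (f x) (g x))"
proof (rule Bochner_Integration.integrable_bound)
  show "integrable lborel (\<lambda>x. CARD('s) * ((norm (f x))\<^sup>2 + (norm (g x))\<^sup>2))"
    using assms by (simp add: square_integrable_def)
  show "AE x in lborel. cmod (herm (f x) (g x)) \<le> norm (CARD('s) * ((norm (f x))\<^sup>2 + (norm (g x))\<^sup>2))"
    by (intro AE_I2 order_trans[OF cmod_herm_le]) simp
qed (use assms measurable_herm in \<open>auto simp: square_integrable_def\<close>)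

lemma square_integrable_zero: "square_integrable (\<lambda>x. 0)"
  by (simp add: square_integrable_def)

lemma square_integrable_scale:
  assumes "square_integrable f"
  shows "square_integrable (\<lambda>x. c *s f x)"
proof -
  have "continuous_on UNIV (\<lambda>v. c *s v :: complex^'b)"
    by (simp add: continuous_on_vec_lambda continuous_intros vector_scalar_mult_def)
  then have "(\<lambda>x. c *s f x) \<in> borel_measurable lborel"
    using measurable_compose[OF _ borel_measurable_continuous_onI] assms
    unfolding square_integrable_def by blast
  then show ?thesis
    using assms by (simp add: square_integrable_def norm_scalar_mult power_mult_distrib)
qed

lemma square_integrable_add:
  assumes "square_integrable f" "square_integrable g"
  shows "square_integrable (\<lambda>x. f x + g x)"
  unfolding square_integrable_def
proof
  show *: "(\<lambda>x. f x + g x) \<in> borel_measurable lborel"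
    using assms by (intro borel_measurable_add) (auto simp: square_integrable_def)
  have le: "(norm (f x + g x))\<^sup>2 \<le> 2 * (norm (f x))\<^sup>2 + 2 * (norm (g x))\<^sup>2" for x
  proof -
    have "(norm (f x + g x))\<^sup>2 \<le> (norm (f x) + norm (g x))\<^sup>2"
      by (intro power_mono norm_triangle_ineq) simp
    also have "\<dots> \<le> 2 * (norm (f x))\<^sup>2 + 2 * (norm (g x))\<^sup>2"
      using sum_squares_bound[of "norm (f x)" "norm (g x)"] by (simp add: power2_sum)
    finally show ?thesis .
  qed
  show "integrable lborel (\<lambda>x. (norm (f x + g x))\<^sup>2)"
  proof (rule Bochner_Integration.integrable_bound)
    show "integrable lborel (\<lambda>x. 2 * (norm (f x))\<^sup>2 + 2 * (norm (g x))\<^sup>2)"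
      using assms by (simp add: square_integrable_def)
    show "AE x in lborel. norm ((norm (f x + g x))\<^sup>2) \<le> norm (2 * (norm (f x))\<^sup>2 + 2 * (norm (g x))\<^sup>2)"
      using le by (intro AE_I2) simp
  qed (use * in simp)
qed

lemma square_integrable_uminus:
  "square_integrable f \<Longrightarrow> square_integrable (\<lambda>x. - f x)"
  by (simp add: square_integrable_def)

lemma square_integrable_scaleR:
  "square_integrable f \<Longrightarrow> square_integrable (\<lambda>x. r *\<^sub>R f x)"
  by (auto simp: square_integrable_def power_mult_distrib intro: borel_measurable_scaleR)

definition L2_rel :: "('a::euclidean_space \<Rightarrow> complex^'s) \<Rightarrow> ('a \<Rightarrow> complex^'s) \<Rightarrow> bool" where
  "L2_rel f g \<longleftrightarrow> square_integrable f \<and> square_integrable g \<and> (AE x in lborel. f x = g x)"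

quotient_type (overloaded) ('a, 's) L2 = "'a::euclidean_space \<Rightarrow> complex^'s::finite" / partial: L2_rel
  morphisms rep_L2 L2_class
proof (rule part_equivpI)
  show "\<exists>f :: 'a \<Rightarrow> complex^'s. L2_rel f f"
    using square_integrable_zero unfolding L2_rel_def by blast
  show "symp (L2_rel :: ('a \<Rightarrow> complex^'s) \<Rightarrow> _)"
    by (auto simp: symp_def L2_rel_def)
  show "transp (L2_rel :: ('a \<Rightarrow> complex^'s) \<Rightarrow> _)"
    unfolding transp_def L2_rel_def by (auto elim: eventually_elim2)
qed


lemma L2_rel_refl: "square_integrable f \<Longrightarrow> L2_rel f f"
  by (simp add: L2_rel_def)

lemma integral_herm_cong:
  assumes "L2_rel f f'" "L2_rel g g'"
  shows "(\<integral>x. herm (f x) (g x) \<partial>lborel) = (\<integral>x. herm (f' x) (g' x) \<partial>lborel)"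
proof (rule integral_cong_AE)
  show "AE x in lborel. herm (f x) (g x) = herm (f' x) (g' x)"
    using assms unfolding L2_rel_def by (auto elim: eventually_elim2)
qed (use assms in \<open>auto simp: L2_rel_def square_integrable_def intro!: measurable_herm[simplified]\<close>)

lift_definition L2_cinner :: "('a::euclidean_space, 's::finite) L2 \<Rightarrow> ('a, 's) L2 \<Rightarrow> complex"
  is "\<lambda>f g. \<integral>x. herm (f x) (g x) \<partial>lborel"
  by (rule integral_herm_cong)

instantiation L2 :: (euclidean_space, finite) real_vector
begin

lift_definition zero_L2 :: "('a, 'b) L2" is "\<lambda>x. 0"
  by (simp add: L2_rel_def square_integrable_zero)

lift_definition plus_L2 :: "('a, 'b) L2 \<Rightarrow> ('a, 'b) L2 \<Rightarrow> ('a, 'b) L2" is "\<lambda>f g x. f x + g x"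
  by (auto simp: L2_rel_def intro: square_integrable_add elim: eventually_elim2)

lift_definition uminus_L2 :: "('a, 'b) L2 \<Rightarrow> ('a, 'b) L2" is "\<lambda>f x. - f x"
  by (auto simp: L2_rel_def intro: square_integrable_uminus)

definition minus_L2 :: "('a, 'b) L2 \<Rightarrow> ('a, 'b) L2 \<Rightarrow> ('a, 'b) L2" where
  "minus_L2 f g = f + (- g)"

lift_definition scaleR_L2 :: "real \<Rightarrow> ('a, 'b) L2 \<Rightarrow> ('a, 'b) L2" is "\<lambda>r f x. r *\<^sub>R f x"
  by (auto simp: L2_rel_def intro: square_integrable_scaleR)

instance
proof
  fix a b c :: "('a, 'b) L2" and r s :: real
  note [intro] = L2_rel_refl square_integrable_add square_integrable_uminus
    square_integrable_scaleR square_integrable_zero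
  show "a + b + c = a + (b + c)"
    by transfer (auto simp: L2_rel_def add.assoc)
  show "a + b = b + a"
    by transfer (auto simp: L2_rel_def add.commute)
  show "0 + a = a"
    by transfer (auto simp: L2_rel_def)
  show "- a + a = 0"
    by transfer (auto simp: L2_rel_def)
  show "a - b = a + - b"
    by (simp add: minus_L2_def)
  show "r *\<^sub>R (a + b) = r *\<^sub>R a + r *\<^sub>R b"
    by transfer (auto simp: L2_rel_def scaleR_add_right)
  show "(r + s) *\<^sub>R a = r *\<^sub>R a + s *\<^sub>R a"
    by transfer (auto simp: L2_rel_def scaleR_add_left)
  show "r *\<^sub>R s *\<^sub>R a = (r * s) *\<^sub>R a"
    by transfer (auto simp: L2_rel_def)
  show "1 *\<^sub>R a = a"
    by transfer (auto simp: L2_rel_def)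
qed

end

lift_definition L2_scaleC :: "complex \<Rightarrow> ('a::euclidean_space, 's::finite) L2 \<Rightarrow> ('a, 's) L2"
  is "\<lambda>c f x. c *s f x"
  by (auto simp: L2_rel_def intro: square_integrable_scale)

lemma L2_cinner_commute: "L2_cinner a b = cnj (L2_cinner b a)"
proof -
  have "(\<integral>x. herm (f x) (g x) \<partial>lborel) = cnj (\<integral>x. herm (g x) (f x) \<partial>lborel)"
    for f g :: "'a \<Rightarrow> complex^'b"
  proof -
    have "(\<lambda>x. herm (f x) (g x)) = (\<lambda>x. cnj (herm (g x) (f x)))"
      by (rule ext) (rule herm_commute)
    then show ?thesis
      by (simp only: Bochner_Integration.integral_cnj)
  qed
  then show ?thesis
    by transfer
qed

lemma L2_cinner_add_left: "L2_cinner (a + b) c = L2_cinner a c + L2_cinner b c"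
  by transfer (simp add: L2_rel_def herm_add_left integrable_herm)

lemma L2_cinner_scaleC_left: "L2_cinner (L2_scaleC c a) b = c * L2_cinner a b"
  by transfer (simp add: herm_scale_left)

lemma L2_scaleC_of_real:
  fixes a :: "('a::euclidean_space, 's::finite) L2"
  shows "L2_scaleC (complex_of_real r) a = r *\<^sub>R a"
proof -
  have eq: "complex_of_real r *s v = r *\<^sub>R v" for v :: "complex^'s" and r
    by (simp add: vec_eq_iff) (simp add: scaleR_conv_of_real)
  show ?thesis
    by transfer (simp add: eq L2_rel_def square_integrable_scaleR)
qed

lemma L2_cinner_self:
  "square_integrable f \<Longrightarrow>
    L2_cinner (L2_class f) (L2_class f) = complex_of_real (\<integral>x. (norm (f x))\<^sup>2 \<partial>lborel)"
  by (simp add: L2_cinner.abs_eq L2_rel_refl herm_self del: of_real_power)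

lemma L2_cases:
  obtains f where "a = L2_class f" "square_integrable f"
  using Quotient_L2 by (metis L2_rel_def Quotient_abs_rep Quotient_rep_reflp)

lemma L2_class_eq_iff:
  "square_integrable f \<Longrightarrow> square_integrable g \<Longrightarrow>
    L2_class f = L2_class g \<longleftrightarrow> (AE x in lborel. f x = g x)"
  using Quotient_rel[OF Quotient_L2, of f g] by (auto simp: L2_rel_def)

instantiation L2 :: (euclidean_space, finite) real_inner
begin

definition inner_L2 :: "('a, 'b) L2 \<Rightarrow> ('a, 'b) L2 \<Rightarrow> real" where
  "inner_L2 a b = Re (L2_cinner a b)"

definition norm_L2 :: "('a, 'b) L2 \<Rightarrow> real" where
  "norm_L2 a = sqrt (inner a a)"

definition dist_L2 :: "('a, 'b) L2 \<Rightarrow> ('a, 'b) L2 \<Rightarrow> real" where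
  "dist_L2 a b = norm (a - b)"

definition sgn_L2 :: "('a, 'b) L2 \<Rightarrow> ('a, 'b) L2" where
  "sgn_L2 a = inverse (norm a) *\<^sub>R a"

definition uniformity_L2 :: "(('a, 'b) L2 \<times> ('a, 'b) L2) filter" where
  "uniformity_L2 = (INF e\<in>{0<..}. principal {(a, b). dist a b < e})"

definition open_L2 :: "('a, 'b) L2 set \<Rightarrow> bool" where
  "open_L2 U \<longleftrightarrow> (\<forall>a\<in>U. \<forall>\<^sub>F (a', b) in uniformity. a' = a \<longrightarrow> b \<in> U)"

instance
proof
  fix a b c :: "('a, 'b) L2" and r :: real and U :: "('a, 'b) L2 set"
  show "dist a b = norm (a - b)"
    by (rule dist_L2_def)
  show "sgn a = inverse (norm a) *\<^sub>R a"
    by (rule sgn_L2_def)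
  show "(uniformity :: (('a, 'b) L2 \<times> ('a, 'b) L2) filter) = (INF e\<in>{0<..}. principal {(a, b). dist a b < e})"
    by (rule uniformity_L2_def)
  show "open U \<longleftrightarrow> (\<forall>a\<in>U. \<forall>\<^sub>F (a', b) in uniformity. a' = a \<longrightarrow> b \<in> U)"
    by (rule open_L2_def)
  show "inner a b = inner b a"
    unfolding inner_L2_def by (subst L2_cinner_commute) simp
  show "inner (a + b) c = inner a c + inner b c"
    by (simp add: inner_L2_def L2_cinner_add_left)
  show "inner (r *\<^sub>R a) b = r * inner a b"
    by (simp add: inner_L2_def L2_scaleC_of_real[symmetric] L2_cinner_scaleC_left)
  obtain f where f: "a = L2_class f" "square_integrable f"
    by (rule L2_cases)
  show "0 \<le> inner a a"
    using f by (simp add: inner_L2_def L2_cinner_self)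
  have "(\<integral>x. (norm (f x))\<^sup>2 \<partial>lborel) = 0 \<longleftrightarrow> (AE x in lborel. f x = 0)"
    using f by (subst integral_nonneg_eq_0_iff_AE) (auto simp: square_integrable_def)
  then show "inner a a = 0 \<longleftrightarrow> a = 0"
    using f by (simp add: inner_L2_def L2_cinner_self zero_L2.abs_eq L2_class_eq_iff square_integrable_zero)
  show "norm a = sqrt (inner a a)"
    by (rule norm_L2_def)
qed

end

lemma norm_L2_class:
  "square_integrable f \<Longrightarrow> (norm (L2_class f))\<^sup>2 = (\<integral>x. (norm (f x))\<^sup>2 \<partial>lborel)"
  by (simp add: norm_L2_def inner_L2_def L2_cinner_self)

lemma L2_class_diff:
  assumes "square_integrable f" "square_integrable g"
  shows "L2_class f - L2_class g = L2_class (\<lambda>x. f x - g x)"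
  using assms by (simp add: minus_L2_def uminus_L2.abs_eq plus_L2.abs_eq L2_rel_refl square_integrable_uminus)

lemma square_integrable_diff:
  assumes "square_integrable f" "square_integrable g"
  shows "square_integrable (\<lambda>x. f x - g x)"
  using square_integrable_add[OF assms(1) square_integrable_uminus[OF assms(2)]] by simp

instance L2 :: (euclidean_space, finite) complete_space
proof
  fix X :: "nat \<Rightarrow> ('a, 'b) L2"
  assume X: "Cauchy X"
  have "\<forall>k. \<exists>N. \<forall>m\<ge>N. \<forall>n\<ge>N. norm (X m - X n) < (1/2)^k"
    using CauchyD[OF X] by simp
  then obtain N where N: "\<And>k m n. m \<ge> N k \<Longrightarrow> n \<ge> N k \<Longrightarrow> norm (X m - X n) < (1/2)^k"
    by metis
  define r where "r k = k + Max (N ` {..k})" for k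
  have r_mono: "strict_mono r"
    unfolding strict_mono_Suc_iff
  proof
    fix k
    have "Max (N ` {..k}) \<le> Max (N ` {..Suc k})"
      by (rule Max_mono) auto
    then show "r k < r (Suc k)"
      unfolding r_def by linarith
  qed
  have r_ge: "r j \<ge> N k" if "j \<ge> k" for j k
  proof -
    have "N k \<le> Max (N ` {..j})"
      by (rule Max_ge) (use that in auto)
    then show ?thesis
      unfolding r_def by linarith
  qed
  have "\<exists>f. X (r k) = L2_class f \<and> square_integrable f" for k
    by (rule L2_cases[of "X (r k)"]) auto
  then obtain f where f: "\<And>k. X (r k) = L2_class (f k)" "\<And>k. square_integrable (f k)"
    by metis
  have meas [measurable]: "f k \<in> borel_measurable lborel" for k
    using f(2) by (simp add: square_integrable_def)
  have half_quarter: "((1/2 :: real)^k)\<^sup>2 = (1/4)^k" for k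
  proof -
    have "((1/2 :: real)^k)\<^sup>2 = ((1/2)\<^sup>2)^k"
      by (metis power_mult mult.commute)
    then show ?thesis
      by (simp add: power2_eq_square)
  qed
  have double_quarter: "2^k * (1/4 :: real)^k = (1/2)^k" for k
    unfolding power_mult_distrib[symmetric] by simp
  have close: "(\<integral>x. (norm (f j x - f k x))\<^sup>2 \<partial>lborel) \<le> (1/4)^k" if "j \<ge> k" for j k
  proof -
    have "(\<integral>x. (norm (f j x - f k x))\<^sup>2 \<partial>lborel) = (norm (X (r j) - X (r k)))\<^sup>2"
      using f by (simp add: L2_class_diff norm_L2_class square_integrable_diff)
    also have "\<dots> \<le> ((1/2)^k)\<^sup>2"
      using N[OF r_ge[OF that] r_ge[OF order_refl]] by (intro power_mono) auto
    also have "\<dots> = (1/4)^k"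
      by (rule half_quarter)
    finally show ?thesis .
  qed
  have close': "(\<integral>\<^sup>+x. ennreal ((norm (f j x - f k x))\<^sup>2) \<partial>lborel) \<le> ennreal ((1/4)^k)"
    if "j \<ge> k" for j k
  proof -
    have "integrable lborel (\<lambda>x. (norm (f j x - f k x))\<^sup>2)"
      using square_integrable_diff[OF f(2) f(2)] by (simp add: square_integrable_def)
    then show ?thesis
      using close[OF that] by (simp add: nn_integral_eq_integral ennreal_leI)
  qed
  define h where "h k x = 2^k * (norm (f (Suc k) x - f k x))\<^sup>2" for k x
  have h_meas [measurable]: "h k \<in> borel_measurable lborel" for k
    unfolding h_def by measurable
  have h_int: "(\<integral>\<^sup>+x. ennreal (h k x) \<partial>lborel) \<le> ennreal ((1/2)^k)" for k
  proof -
    have "(\<integral>\<^sup>+x. ennreal (h k x) \<partial>lborel)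
        = ennreal (2^k) * (\<integral>\<^sup>+x. ennreal ((norm (f (Suc k) x - f k x))\<^sup>2) \<partial>lborel)"
      unfolding h_def by (subst nn_integral_cmult[symmetric]) (auto simp: ennreal_mult)
    also have "\<dots> \<le> ennreal (2^k) * ennreal ((1/4)^k)"
      by (intro mult_left_mono close') auto
    also have "\<dots> = ennreal ((1/2)^k)"
      by (subst ennreal_mult[symmetric]) (simp_all only: double_quarter, simp_all)
    finally show ?thesis .
  qed
  have "(\<integral>\<^sup>+x. (\<Sum>k. ennreal (h k x)) \<partial>lborel) = (\<Sum>k. \<integral>\<^sup>+x. ennreal (h k x) \<partial>lborel)"
    by (intro nn_integral_suminf) measurable
  also have "\<dots> \<le> (\<Sum>k. ennreal ((1/2)^k))"
    by (intro suminf_le h_int) auto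
  also have "\<dots> = ennreal (\<Sum>k. (1/2)^k)"
    by (intro suminf_ennreal2) (auto simp: summable_geometric)
  also have "\<dots> < \<infinity>"
    by simp
  finally have "(\<integral>\<^sup>+x. (\<Sum>k. ennreal (h k x)) \<partial>lborel) \<noteq> \<infinity>"
    by simp
  then have "AE x in lborel. (\<Sum>k. ennreal (h k x)) \<noteq> \<infinity>"
    by (intro nn_integral_noteq_infinite) auto
  then have conv: "AE x in lborel. convergent (\<lambda>k. f k x)"
  proof (rule AE_mp, intro AE_I2 impI)
    fix x
    assume "(\<Sum>k. ennreal (h k x)) \<noteq> \<infinity>"
    then have "summable (\<lambda>k. h k x)"
      by (intro summable_suminf_not_top) (auto simp: h_def)
    then have "Bseq (\<lambda>k. h k x)"
      by (metis convergentI convergent_imp_Bseq summable_LIMSEQ_zero)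
    then obtain C where C: "C > 0" "\<And>k. norm (h k x) \<le> C"
      by (auto simp: Bseq_def)
    have "norm (f (Suc k) x - f k x) \<le> sqrt C * (sqrt (1/2))^k" for k
    proof -
      have "(norm (f (Suc k) x - f k x))\<^sup>2 = h k x * (1/2)^k"
        by (simp add: h_def power_one_over)
      also have "\<dots> \<le> C * (1/2)^k"
        using C(2)[of k] by (intro mult_right_mono) auto
      finally have "norm (f (Suc k) x - f k x) \<le> sqrt (C * (1/2)^k)"
        by (rule real_le_rsqrt)
      then show ?thesis
        by (simp add: real_sqrt_mult real_sqrt_power)
    qed
    moreover have "summable (\<lambda>k. sqrt C * (sqrt (1/2))^k)"
      by (intro summable_mult summable_geometric) (simp add: real_sqrt_divide)
    ultimately have "summable (\<lambda>k. f (Suc k) x - f k x)"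
      by (rule summable_comparison_test'[where N = 0, rotated])
    then have "convergent (\<lambda>n. (\<Sum>k<n. f (Suc k) x - f k x))"
      by (simp add: summable_iff_convergent)
    then have "convergent (\<lambda>n. f n x - f 0 x)"
      by (subst (asm) sum_lessThan_telescope[of "\<lambda>k. f k x"])
    then have "convergent (\<lambda>n. (f n x - f 0 x) + f 0 x)"
      by (intro convergent_add convergent_const)
    then show "convergent (\<lambda>k. f k x)"
      by simp
  qed
  define F where "F x = lim (\<lambda>k. f k x)" for x
  have F_meas [measurable]: "F \<in> borel_measurable lborel"
    unfolding F_def by (intro borel_measurable_lim_metric meas)
  have F: "AE x in lborel. (\<lambda>k. f k x) \<longlonglongrightarrow> F x"
    using conv unfolding F_def by (auto simp: convergent_LIMSEQ_iff)
  have fatou: "(\<integral>\<^sup>+x. ennreal ((norm (F x - f k x))\<^sup>2) \<partial>lborel) \<le> ennreal ((1/4)^k)" for k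
  proof -
    have "(\<integral>\<^sup>+x. ennreal ((norm (F x - f k x))\<^sup>2) \<partial>lborel)
        = (\<integral>\<^sup>+x. liminf (\<lambda>j. ennreal ((norm (f j x - f k x))\<^sup>2)) \<partial>lborel)"
    proof (rule nn_integral_cong_AE, rule AE_mp[OF F], intro AE_I2 impI)
      fix x
      assume "(\<lambda>j. f j x) \<longlonglongrightarrow> F x"
      then have "(\<lambda>j. ennreal ((norm (f j x - f k x))\<^sup>2)) \<longlonglongrightarrow> ennreal ((norm (F x - f k x))\<^sup>2)"
        by (intro tendsto_intros)
      then show "ennreal ((norm (F x - f k x))\<^sup>2) = liminf (\<lambda>j. ennreal ((norm (f j x - f k x))\<^sup>2))"
        by (rule lim_imp_Liminf[symmetric, OF trivial_limit_sequentially])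
    qed
    also have "\<dots> \<le> liminf (\<lambda>j. \<integral>\<^sup>+x. ennreal ((norm (f j x - f k x))\<^sup>2) \<partial>lborel)"
      by (intro nn_integral_liminf) measurable
    also have "\<dots> \<le> liminf (\<lambda>j. ennreal ((1/4)^k))"
      by (intro Liminf_mono eventually_sequentiallyI[of k] close')
    also have "\<dots> = ennreal ((1/4)^k)"
      by (intro lim_imp_Liminf) auto
    finally show ?thesis .
  qed
  have diff: "square_integrable (\<lambda>x. F x - f k x)" for k
    unfolding square_integrable_def
  proof
    show "integrable lborel (\<lambda>x. (norm (F x - f k x))\<^sup>2)"
      using le_less_trans[OF fatou[of k] ennreal_less_top]
      by (intro integrableI_bounded) auto
  qed measurable
  have sq: "square_integrable F"
    using square_integrable_add[OF diff f(2), of 0 0] by simp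
  have bound: "norm (X (r k) - L2_class F) \<le> (1/2)^k" for k
  proof -
    have "(norm (L2_class F - X (r k)))\<^sup>2 = (\<integral>x. (norm (F x - f k x))\<^sup>2 \<partial>lborel)"
      using f sq by (simp add: L2_class_diff norm_L2_class diff)
    also have "\<dots> \<le> (1/4)^k"
    proof -
      have "ennreal (\<integral>x. (norm (F x - f k x))\<^sup>2 \<partial>lborel) \<le> ennreal ((1/4)^k)"
        using fatou[of k] diff[of k] by (simp add: nn_integral_eq_integral square_integrable_def)
      then show ?thesis
        by simp
    qed
    also have "\<dots> = ((1/2)^k)\<^sup>2"
      by (rule half_quarter[symmetric])
    finally have "norm (L2_class F - X (r k)) \<le> (1/2)^k"
      by (rule power2_le_imp_le) simp
    then show ?thesis
      by (subst norm_minus_commute)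
  qed
  have "(\<lambda>k. X (r k) - L2_class F) \<longlonglongrightarrow> 0"
    by (rule Lim_null_comparison[OF always_eventually LIMSEQ_power_zero[of "1/2"]])
      (use bound in auto)
  then have "(X \<circ> r) \<longlonglongrightarrow> L2_class F"
    by (simp add: LIM_zero_iff o_def)
  then have "X \<longlonglongrightarrow> L2_class F"
    by (rule Cauchy_converges_subseq[OF X r_mono])
  then show "convergent X"
    by (rule convergentI)
qed

instantiation L2 :: (euclidean_space, finite) complex_hilbert_space
begin

definition scaleC_L2 :: "complex \<Rightarrow> ('a, 'b) L2 \<Rightarrow> ('a, 'b) L2" where
  "scaleC_L2 = L2_scaleC"

definition cinner_L2 :: "('a, 'b) L2 \<Rightarrow> ('a, 'b) L2 \<Rightarrow> complex" where
  "cinner_L2 = L2_cinner"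

instance
proof
  fix a b c :: "('a, 'b) L2" and z w :: complex and r :: real
  show "z *\<^sub>C (a + b) = z *\<^sub>C a + z *\<^sub>C b"
    unfolding scaleC_L2_def
    by transfer (auto simp: L2_rel_def vector_add_ldistrib intro: square_integrable_add square_integrable_scale)
  show "(z + w) *\<^sub>C a = z *\<^sub>C a + w *\<^sub>C a"
    unfolding scaleC_L2_def
    by transfer (auto simp: L2_rel_def vector_sadd_rdistrib intro: square_integrable_add square_integrable_scale)
  show "z *\<^sub>C w *\<^sub>C a = (z * w) *\<^sub>C a"
    unfolding scaleC_L2_def
    by transfer (auto simp: L2_rel_def vector_smult_assoc intro: square_integrable_scale)
  show "complex_of_real r *\<^sub>C a = r *\<^sub>R a"
    by (simp add: scaleC_L2_def L2_scaleC_of_real)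
  show "cinner a b = cnj (cinner b a)"
    unfolding cinner_L2_def by (rule L2_cinner_commute)
  show "cinner (a + b) c = cinner a c + cinner b c"
    by (simp add: cinner_L2_def L2_cinner_add_left)
  show "cinner (z *\<^sub>C a) b = z * cinner a b"
    by (simp add: cinner_L2_def scaleC_L2_def L2_cinner_scaleC_left)
  show "inner a b = Re (cinner a b)"
    by (simp add: cinner_L2_def inner_L2_def)
qed

end


section \<open>Smooth functions with compact support\<close>

definition partial_deriv ::
    "'a::euclidean_space \<Rightarrow> ('a \<Rightarrow> 'b::real_normed_vector) \<Rightarrow> 'a \<Rightarrow> 'b" where
  "partial_deriv b f x = frechet_derivative f (at x) b"

primrec C_diff :: "nat \<Rightarrow> ('a::euclidean_space \<Rightarrow> 'b::real_normed_vector) \<Rightarrow> bool" where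
  "C_diff 0 f \<longleftrightarrow> continuous_on UNIV f"
| "C_diff (Suc k) f \<longleftrightarrow>
     (\<forall>x. f differentiable (at x)) \<and> (\<forall>b\<in>Basis. C_diff k (partial_deriv b f))"

definition test_functions :: "('a::euclidean_space \<Rightarrow> 'b::real_normed_vector) set" where
  "test_functions = {f. (\<forall>k. C_diff k f) \<and> compact (closure {x. f x \<noteq> 0})}"


section \<open>The spinor module and Clifford multiplication\<close>

text \<open>\<open>\<real>\<^sup>n\<close> is \<open>real^'n\<close> for an arbitrary finite linear order \<open>'n\<close> with
  \<open>n\<close> elements; the coordinates are numbered \<open>1, \<dots>, n\<close> along the order. The signature
  \<open>(p, q)\<close> is given by \<open>p\<close> alone, since \<open>q = n - p\<close>.\<close>

type_synonym 'n Rn = "(real, 'n) vec"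

definition coord_no :: "'n::{finite,linorder} \<Rightarrow> nat" where
  "coord_no i = card {..i}"

definition pseudo_inner :: "nat \<Rightarrow> 'n::{finite,linorder} Rn \<Rightarrow> 'n Rn \<Rightarrow> real" where
  "pseudo_inner p x y =
     - (\<Sum>i | coord_no i \<le> p. x $ i * y $ i) + (\<Sum>i | coord_no i > p. x $ i * y $ i)"

typedef 'n spinor_index = "{..<(2::nat) ^ (CARD('n) div 2)}"
  morphisms spinor_no Spinor_index
  by (rule exI[of _ 0]) simp

instance spinor_index :: (type) finite
proof
  have "finite (range (spinor_no :: 'a spinor_index \<Rightarrow> nat))"
    using type_definition.Rep_range[OF type_definition_spinor_index] by (metis finite_lessThan)
  then show "finite (UNIV :: 'a spinor_index set)"
    by (rule finite_imageD) (simp add: spinor_no_inject inj_on_def)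
qed

lemma card_spinor_index: "CARD('n spinor_index) = 2 ^ (CARD('n) div 2)"
  using type_definition.card[OF type_definition_spinor_index] by simp

text \<open>The spinor module is \<open>\<complex>\<^sup>N\<close> with \<open>N = 2 ^ (n div 2)\<close>, with the Hermitian
  inner product \<^const>\<open>herm\<close>.\<close>

type_synonym 'n spinor = "(complex, 'n spinor_index) vec"

text \<open>Matrices are functions of the row and the column number, both counted from \<open>0\<close>.\<close>

type_synonym cmat = "nat \<Rightarrow> nat \<Rightarrow> complex"

definition mat2 :: "complex \<Rightarrow> complex \<Rightarrow> complex \<Rightarrow> complex \<Rightarrow> cmat" where
  "mat2 a b c d i j = (if i = 0 then (if j = 0 then a else b) else (if j = 0 then c else d))"

definition mat_E :: cmat where "mat_E = mat2 1 0 0 1"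
definition mat_U :: "nat \<Rightarrow> cmat" where
  "mat_U s = (if s = 1 then mat2 \<i> 0 0 (- \<i>) else mat2 0 \<i> \<i> 0)"
definition mat_T :: cmat where "mat_T = mat2 0 (- \<i>) \<i> 0"

text \<open>Kronecker product of a list of \<open>2 \<times> 2\<close> matrices: for \<open>B\<close> of size \<open>r \<times> r\<close>,
  the entry \<open>(i, j)\<close> of \<open>A \<otimes> B\<close> is \<open>A (i div r) (j div r) * B (i mod r) (j mod r)\<close>.\<close>

primrec kronecker :: "cmat list \<Rightarrow> cmat" where
  "kronecker [] = (\<lambda>i j. 1)"
| "kronecker (A # As) =
     (\<lambda>i j. A (i div 2 ^ length As) (j div 2 ^ length As)
          * kronecker As (i mod 2 ^ length As) (j mod 2 ^ length As))"

definition tau :: "nat \<Rightarrow> nat \<Rightarrow> complex" where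
  "tau p j = (if j \<le> p then \<i> else 1)"

definition sigma :: "nat \<Rightarrow> nat" where
  "sigma j = (if odd j then 1 else 2)"

definition clifford_cmat :: "nat \<Rightarrow> nat \<Rightarrow> nat \<Rightarrow> cmat" where
  "clifford_cmat m p j = (\<lambda>a b. tau p j *
     (if j \<le> 2 * m
      then (let t = (j - 1) div 2 in
              kronecker (replicate (m - 1 - t) mat_E @ [mat_U (sigma j)] @ replicate t mat_T) a b)
      else \<i> * kronecker (replicate m mat_T) a b))"

definition clifford_matrix ::
    "nat \<Rightarrow> 'n::{finite,linorder} \<Rightarrow> complex ^ 'n spinor_index ^ 'n spinor_index" where
  "clifford_matrix p i =
     (\<chi> a b. clifford_cmat (CARD('n) div 2) p (coord_no i) (spinor_no a) (spinor_no b))"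

definition clifford_mult ::
    "nat \<Rightarrow> 'n::{finite,linorder} Rn \<Rightarrow> 'n spinor \<Rightarrow> 'n spinor" where
  "clifford_mult p x v = (\<Sum>i\<in>UNIV. x $ i *\<^sub>R (clifford_matrix p i *v v))"


section \<open>The Dirac operator\<close>

definition dirac ::
    "nat \<Rightarrow> ('n::{finite,linorder} Rn \<Rightarrow> 'n spinor) \<Rightarrow> 'n Rn \<Rightarrow> 'n spinor" where
  "dirac p \<psi> x =
     (\<Sum>i\<in>UNIV. pseudo_inner p (axis i 1) (axis i 1) *\<^sub>R
        clifford_mult p (axis i 1) (partial_deriv (axis i 1) \<psi> x))"

definition dirac_operator ::
    "nat \<Rightarrow> ('n::{finite,linorder} Rn, 'n spinor_index) L2 operator" where
  "dirac_operator p = {(L2_class \<psi>, L2_class (dirac p \<psi>)) | \<psi>. \<psi> \<in> test_functions}"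

text \<open>\<^const>\<open>L2_class\<close> is meaningful on square-integrable functions only; the following
  lemmas show that it is applied to such functions in \<^const>\<open>dirac_operator\<close>.\<close>

lemma test_functions_square_integrable:
  fixes f :: "'a::euclidean_space \<Rightarrow> complex^'s"
  assumes "f \<in> test_functions"
  shows "square_integrable f"
  unfolding square_integrable_def
proof
  let ?K = "closure {x. f x \<noteq> 0}"
  have K: "compact ?K" and "C_diff 0 f"
    using assms by (auto simp: test_functions_def)
  then have cont: "continuous_on UNIV f"
    by simp
  then show "f \<in> borel_measurable lborel"
    by (simp add: borel_measurable_continuous_onI)
  have int: "integrable lborel (\<lambda>x. indicator ?K x *\<^sub>R (norm (f x))\<^sup>2)"
    using K cont
    by (intro borel_integrable_compact continuous_intros) (auto intro: continuous_on_subset)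
  have "(\<lambda>x. indicator ?K x *\<^sub>R (norm (f x))\<^sup>2) = (\<lambda>x. (norm (f x))\<^sup>2)"
    using closure_subset[of "{x. f x \<noteq> 0}"] by (auto simp: indicator_def fun_eq_iff)
  with int show "integrable lborel (\<lambda>x. (norm (f x))\<^sup>2)"
    by (simp only:)
qed

lemma C_diff_linear:
  assumes "bounded_linear L" "C_diff k f"
  shows "C_diff k (\<lambda>x. L (f x))"
  using assms(2)
proof (induction k arbitrary: f)
  case 0
  then show ?case
    using assms(1) by (auto intro: bounded_linear.continuous_on)
next
  case (Suc k)
  have deriv: "((\<lambda>x. L (f x)) has_derivative (\<lambda>h. L (frechet_derivative f (at x) h))) (at x)" for x
    using Suc.prems by (auto intro: bounded_linear.has_derivative[OF assms(1)]
        simp flip: frechet_derivative_works)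
  have "partial_deriv b (\<lambda>x. L (f x)) = (\<lambda>x. L (partial_deriv b f x))" for b
    by (simp add: fun_eq_iff partial_deriv_def frechet_derivative_at[OF deriv, symmetric])
  then show ?case
    using Suc deriv by (auto simp: differentiable_def)
qed

lemma C_diff_add:
  assumes "C_diff k f" "C_diff k g"
  shows "C_diff k (\<lambda>x. f x + g x)"
  using assms
proof (induction k arbitrary: f g)
  case 0
  then show ?case
    by (auto intro: continuous_on_add)
next
  case (Suc k)
  have deriv: "((\<lambda>x. f x + g x) has_derivative
      (\<lambda>h. frechet_derivative f (at x) h + frechet_derivative g (at x) h)) (at x)" for x
    using Suc.prems by (auto intro: has_derivative_add simp flip: frechet_derivative_works)
  have "partial_deriv b (\<lambda>x. f x + g x) = (\<lambda>x. partial_deriv b f x + partial_deriv b g x)" for b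
    by (simp add: fun_eq_iff partial_deriv_def frechet_derivative_at[OF deriv, symmetric])
  moreover have "\<forall>x. (\<lambda>x. f x + g x) differentiable (at x)"
    using deriv differentiable_def by blast
  ultimately show ?case
    using Suc by simp
qed

lemma C_diff_zero: "C_diff k (\<lambda>x. 0)"
proof (induction k)
  case (Suc k)
  have "partial_deriv b (\<lambda>x::'a. 0::'b) = (\<lambda>x. 0)" for b
    by (simp add: fun_eq_iff partial_deriv_def)
  then show ?case
    using Suc by simp
qed simp

lemma C_diff_sum:
  "(\<And>i. i \<in> I \<Longrightarrow> C_diff k (f i)) \<Longrightarrow> C_diff k (\<lambda>x. \<Sum>i\<in>I. f i x)"
  by (induction I rule: infinite_finite_induct) (auto intro: C_diff_zero C_diff_add)

lemma bounded_linear_clifford_mult: "bounded_linear (clifford_mult p x)"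
proof -
  have "linear (\<lambda>v. x $ i *\<^sub>R (clifford_matrix p i *v v))" for i
    by (intro linearI) (auto simp: matrix_vector_right_distrib algebra_simps
        matrix_vector_mult_def vec_eq_iff scaleR_sum_right sum.distrib)
  then show ?thesis
    unfolding clifford_mult_def by (auto intro: linear_compose_sum simp flip: linear_conv_bounded_linear)
qed

lemma clifford_mult_zero: "clifford_mult p x 0 = 0"
  by (rule linear_0[OF bounded_linear.linear[OF bounded_linear_clifford_mult]])

lemma dirac_test_functions:
  assumes "\<psi> \<in> test_functions"
  shows "dirac p \<psi> \<in> test_functions"
proof -
  have smooth: "C_diff k \<psi>" for k
    using assms by (simp add: test_functions_def)
  have "C_diff k (partial_deriv (axis i 1) \<psi>)" for k i
    using smooth[of "Suc k"] by (simp add: axis_in_Basis_iff)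
  then have "C_diff k (dirac p \<psi>)" for k
    unfolding dirac_def
    by (intro C_diff_sum C_diff_linear[OF bounded_linear_scaleR_right]
        C_diff_linear[OF bounded_linear_clifford_mult])
  moreover have "{x. dirac p \<psi> x \<noteq> 0} \<subseteq> closure {x. \<psi> x \<noteq> 0}"
  proof (rule subsetI, rule ccontr)
    fix x
    assume x: "x \<in> {x. dirac p \<psi> x \<noteq> 0}" "x \<notin> closure {x. \<psi> x \<noteq> 0}"
    have "(\<psi> has_derivative (\<lambda>h. 0)) (at x)"
    proof (rule has_derivative_transform_within_open)
      show "((\<lambda>x. 0) has_derivative (\<lambda>h. 0)) (at x)"
        by simp
      show "open (- closure {x. \<psi> x \<noteq> 0})" "x \<in> - closure {x. \<psi> x \<noteq> 0}"
        using x by auto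
      show "\<And>y. y \<in> - closure {x. \<psi> x \<noteq> 0} \<Longrightarrow> 0 = \<psi> y"
        using closure_subset[of "{x. \<psi> x \<noteq> 0}"] by auto
    qed
    then have "partial_deriv b \<psi> x = 0" for b
      by (simp add: partial_deriv_def frechet_derivative_at[symmetric])
    then have "dirac p \<psi> x = 0"
      by (simp add: dirac_def clifford_mult_zero)
    then show False
      using x by simp
  qed
  then have "closure {x. dirac p \<psi> x \<noteq> 0} \<subseteq> closure {x. \<psi> x \<noteq> 0}"
    by (simp add: closure_minimal)
  then have "compact (closure {x. dirac p \<psi> x \<noteq> 0})"
    using assms compact_Int_closed[of "closure {x. \<psi> x \<noteq> 0}" "closure {x. dirac p \<psi> x \<noteq> 0}"]
    by (simp add: test_functions_def inf.absorb2)
  ultimately show ?thesis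
    by (simp add: test_functions_def)
qed

end

theory Submission
  imports Defs "HOL-Computational_Algebra.Polynomial"
begin

text \<open>Let \<open>Q = \<Sum> B b \<partial>\<^sub>b\<close> be the Dirac operator or its formal adjoint; the Clifford relations give
  \<open>(\<mu> - Q)(\<mu> + Q) = P\<close> with the scalar operator \<open>P = \<mu>\<^sup>2 + \<Sum> \<kappa> b \<partial>\<^sub>b\<^sup>2\<close>.

  No point and no residual spectrum: both amount to the statement that a square-integrable weak
  solution \<open>g\<close> of \<open>(\<mu> - Q) g = 0\<close> vanishes. Correlating \<open>g\<close> with test functions yields smooth \<open>L\<^sup>2\<close>
  solutions \<open>F\<close> of \<open>P F = 0\<close>. If \<open>\<mu>\<^sup>2\<close> is not real, pair the equation with \<open>F\<close> itself. Otherwise pair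
  \<open>P (a F)\<close>, where \<open>a = sin (t x\<^sub>1)\<close>, with \<open>\<partial>\<^sub>1 F\<close> and integrate by parts: as \<open>t\<close> tends to \<open>0\<close>, the
  commutator \<open>[P, x\<^sub>1] = 2 \<kappa>\<^sub>1 \<partial>\<^sub>1\<close> forces \<open>\<partial>\<^sub>1 F = 0\<close>, hence \<open>F = 0\<close>.

  Unbounded inverse: a bound for \<open>(\<mu> - Q)\<^sup>-\<^sup>1\<close> implies \<open>\<parallel>\<partial>\<^sub>b h\<parallel> \<le> C (\<parallel>h\<parallel> + \<parallel>P h\<parallel>)\<close> for all scalar test
  functions, which fails for wave packets whose frequency is a large null vector.\<close>

section \<open>Partial derivatives and test functions\<close>

text \<open>An eigenvector of the closure is a weak solution for the formal adjoint, because the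
  adjoint relation with test functions is a closed condition on the graph; a vector orthogonal to
  the range is a weak solution for the Dirac operator itself. In the adjoint the signs
  \<open>\<kappa> b\<close> of the coefficients cancel, so both operators are Clifford systems for
  the same form and one argument serves both. A weak solution has no derivatives of its own. Those
  of its correlations fall on the test function, so they stay in L2 to every order. The coordinate
  x_1 is unbounded and may lead out of L2; sin (t x_1) is bounded and equals t x_1 to first order,
  and division by t leaves an error of order t. Indefiniteness of the form enters through null
  vectors, in the unboundedness of the inverse. There the frequency is fixed first, large enough to
  beat the supposed bound; then the envelope is widened until its derivatives become negligible. The
  estimate concerns test functions only, so it holds for every extension of the operator, in
  particular for its closure.\<close>

text \<open>Correlations are differentiated only along lines, so a derivative in the direction
  \<open>b\<close> is kept apart from Frechet differentiability.\<close>

definition has_partial ::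
    "'a::euclidean_space \<Rightarrow> ('a \<Rightarrow> 'b::real_normed_vector) \<Rightarrow> ('a \<Rightarrow> 'b) \<Rightarrow> bool" where
  "has_partial b f f' \<longleftrightarrow> (\<forall>x. ((\<lambda>t. f (x + t *\<^sub>R b)) has_vector_derivative f' x) (at 0))"

text \<open>Moving the base point to \<open>x + s *\<^sub>R b\<close> reduces an arbitrary parameter
  \<open>s\<close> to the parameter 0.\<close>

lemma has_partial_line:
  assumes "has_partial b f f'"
  shows "((\<lambda>t. f (x + t *\<^sub>R b)) has_vector_derivative f' (x + s *\<^sub>R b)) (at s within S)"
proof -
  have 1: "((\<lambda>t. t - s) has_vector_derivative 1) (at s)"
    by (rule has_vector_derivative_eq_rhs[OF has_vector_derivative_diff[OF has_vector_derivative_id has_vector_derivative_const]]) simp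
  have 2: "((\<lambda>t. f (x + s *\<^sub>R b + t *\<^sub>R b)) has_vector_derivative f' (x + s *\<^sub>R b)) (at (s - s))"
    unfolding diff_self by (rule assms[unfolded has_partial_def, rule_format])
  have "x + s *\<^sub>R b + (t - s) *\<^sub>R b = x + t *\<^sub>R b" for t
  proof -
    have "x + s *\<^sub>R b + (t - s) *\<^sub>R b = x + (s + (t - s)) *\<^sub>R b"
      by (simp only: scaleR_left_distrib add.assoc)
    then show ?thesis
      by simp
  qed
  moreover have "((\<lambda>t. f (x + s *\<^sub>R b + (t - s) *\<^sub>R b)) has_vector_derivative 1 *\<^sub>R f' (x + s *\<^sub>R b)) (at s)"
    using vector_diff_chain_at[OF 1, of "\<lambda>t. f (x + s *\<^sub>R b + t *\<^sub>R b)"] 2 unfolding o_def by blast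
  ultimately have "((\<lambda>t. f (x + t *\<^sub>R b)) has_vector_derivative f' (x + s *\<^sub>R b)) (at s)"
    by (simp only: scaleR_one)
  then show ?thesis
    by (rule has_vector_derivative_at_within)
qed

lemma has_partial_add:
  "has_partial b f f' \<Longrightarrow> has_partial b g g' \<Longrightarrow> has_partial b (\<lambda>x. f x + g x) (\<lambda>x. f' x + g' x)"
  unfolding has_partial_def by (auto intro: has_vector_derivative_add)

lemma has_partial_bilinear:
  assumes "bounded_bilinear pr" "has_partial b f f'" "has_partial b g g'"
  shows "has_partial b (\<lambda>x. pr (f x) (g x)) (\<lambda>x. pr (f x) (g' x) + pr (f' x) (g x))"
  unfolding has_partial_def
proof
  fix x
  show "((\<lambda>t. pr (f (x + t *\<^sub>R b)) (g (x + t *\<^sub>R b))) has_vector_derivative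
      pr (f x) (g' x) + pr (f' x) (g x)) (at 0)"
    using bounded_bilinear.has_vector_derivative[OF assms(1),
        OF assms(2)[unfolded has_partial_def, rule_format, of x]
          assms(3)[unfolded has_partial_def, rule_format, of x]]
    by simp
qed

lemma has_partial_linear:
  assumes "bounded_linear L" "has_partial b f f'"
  shows "has_partial b (\<lambda>x. L (f x)) (\<lambda>x. L (f' x))"
  using assms unfolding has_partial_def by (auto intro: bounded_linear.has_vector_derivative)

lemma has_partial_comp_inner:
  assumes "\<And>r. (u has_vector_derivative u' r) (at r)"
  shows "has_partial b (\<lambda>x. u (x \<bullet> v)) (\<lambda>x. (b \<bullet> v) *\<^sub>R u' (x \<bullet> v))"
  unfolding has_partial_def
proof
  fix x
  have "((\<lambda>t. (x + t *\<^sub>R b) \<bullet> v) has_vector_derivative b \<bullet> v) (at 0)"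
    by (auto intro!: derivative_eq_intros simp: inner_add_left)
  then have "(u \<circ> (\<lambda>t. (x + t *\<^sub>R b) \<bullet> v) has_vector_derivative (b \<bullet> v) *\<^sub>R u' ((x + 0 *\<^sub>R b) \<bullet> v)) (at 0)"
    by (rule vector_diff_chain_at) (rule assms)
  then show "((\<lambda>t. u ((x + t *\<^sub>R b) \<bullet> v)) has_vector_derivative (b \<bullet> v) *\<^sub>R u' (x \<bullet> v)) (at 0)"
    by (simp add: o_def)
qed

lemma has_derivative_partial_deriv:
  assumes "(f has_derivative f') (at x)"
  shows "partial_deriv b f x = f' b"
  using frechet_derivative_at[OF assms] by (simp add: partial_deriv_def)

lemma has_partial_differentiable:
  assumes "\<And>x. f differentiable (at x)"
  shows "has_partial b f (partial_deriv b f)"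
  unfolding has_partial_def
proof
  fix x
  have f: "(f has_derivative frechet_derivative f (at x)) (at x)"
    using assms frechet_derivative_works by blast
  interpret bounded_linear "frechet_derivative f (at x)"
    using f by (rule has_derivative_bounded_linear)
  have 1: "((\<lambda>t. x + t *\<^sub>R b) has_derivative (\<lambda>t. t *\<^sub>R b)) (at 0)"
    by (auto intro!: derivative_eq_intros)
  have "((\<lambda>t. f (x + t *\<^sub>R b)) has_derivative (\<lambda>t. frechet_derivative f (at x) (t *\<^sub>R b))) (at 0)"
    using has_derivative_compose[OF 1, of f "frechet_derivative f (at x)"] f by simp
  then show "((\<lambda>t. f (x + t *\<^sub>R b)) has_vector_derivative partial_deriv b f x) (at 0)"
    by (simp add: has_vector_derivative_def partial_deriv_def scaleR)
qed

lemma C_diff_Suc_imp: "C_diff (Suc k) f \<Longrightarrow> C_diff k f"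
proof (induction k arbitrary: f)
  case 0
  then show ?case
    by (auto intro!: differentiable_imp_continuous_on simp: differentiable_on_def)
next
  case (Suc k)
  have "C_diff k (partial_deriv b f)" if "b \<in> Basis" for b
    using Suc.prems that by (intro Suc.IH) (simp only: C_diff.simps, blast)
  then show ?case
    using Suc.prems by (simp only: C_diff.simps, blast)
qed

lemma partial_deriv_bilinear:
  assumes "bounded_bilinear pr" "\<And>x. f differentiable (at x)" "\<And>x. g differentiable (at x)"
  shows "partial_deriv b (\<lambda>x. pr (f x) (g x)) =
      (\<lambda>x. pr (f x) (partial_deriv b g x) + pr (partial_deriv b f x) (g x))"
    and "(\<lambda>x. pr (f x) (g x)) differentiable (at x)"
proof -
  have *: "((\<lambda>x. pr (f x) (g x)) has_derivative (\<lambda>h. pr (f x) (frechet_derivative g (at x) h) +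
      pr (frechet_derivative f (at x) h) (g x))) (at x)" for x
    using assms by (intro bounded_bilinear.FDERIV) (auto simp flip: frechet_derivative_works)
  then show "(\<lambda>x. pr (f x) (g x)) differentiable (at x)"
    by (auto simp: differentiable_def)
  show "partial_deriv b (\<lambda>x. pr (f x) (g x)) =
      (\<lambda>x. pr (f x) (partial_deriv b g x) + pr (partial_deriv b f x) (g x))"
    by (rule ext) (simp add: has_derivative_partial_deriv[OF *] partial_deriv_def)
qed

lemma C_diff_bilinear:
  assumes pr: "bounded_bilinear pr" and "C_diff k f" "C_diff k g"
  shows "C_diff k (\<lambda>x. pr (f x) (g x))"
  using assms(2,3)
proof (induction k arbitrary: f g)
  case 0
  then show ?case
    using bounded_bilinear.continuous_on[OF pr] by auto
next
  case (Suc k)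
  \<comment> \<open>The product rule leaves one factor undifferentiated, so both factors are needed
    at the lower order as well.\<close>
  have "C_diff k f" "C_diff k g"
    using Suc.prems C_diff_Suc_imp by blast+
  then show ?case
    using Suc partial_deriv_bilinear[OF pr, of f g] by (auto intro!: C_diff_add)
qed

lemma partial_deriv_affine:
  assumes "\<And>x. f differentiable (at x)"
  shows "partial_deriv b (\<lambda>x. f (c *\<^sub>R x + a)) = (\<lambda>x. c *\<^sub>R partial_deriv b f (c *\<^sub>R x + a))"
    and "(\<lambda>x. f (c *\<^sub>R x + a)) differentiable (at x)"
proof -
  have f: "(f has_derivative frechet_derivative f (at y)) (at y)" for y
    using assms frechet_derivative_works by blast
  have lin: "((\<lambda>x. c *\<^sub>R x + a) has_derivative (\<lambda>h. c *\<^sub>R h)) (at x)" for x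
    by (auto intro!: derivative_eq_intros)
  have *: "((\<lambda>x. f (c *\<^sub>R x + a)) has_derivative
      (\<lambda>h. frechet_derivative f (at (c *\<^sub>R x + a)) (c *\<^sub>R h))) (at x)" for x
    using has_derivative_compose[OF lin f] .
  then show "(\<lambda>x. f (c *\<^sub>R x + a)) differentiable (at x)"
    by (auto simp: differentiable_def)
  show "partial_deriv b (\<lambda>x. f (c *\<^sub>R x + a)) = (\<lambda>x. c *\<^sub>R partial_deriv b f (c *\<^sub>R x + a))"
    by (rule ext) (simp add: has_derivative_partial_deriv[OF *] partial_deriv_def
        linear_cmul[OF bounded_linear.linear[OF has_derivative_bounded_linear[OF f]]])
qed

lemma C_diff_affine:
  assumes "C_diff k f"
  shows "C_diff k (\<lambda>x. f (c *\<^sub>R x + a))"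
  using assms
proof (induction k arbitrary: f)
  case 0
  then show ?case
    by (auto intro!: continuous_on_compose2[of UNIV f] continuous_intros)
next
  case (Suc k)
  then show ?case
    using partial_deriv_affine[of f] by (auto intro!: C_diff_linear[OF bounded_linear_scaleR_right])
qed

text \<open>\<open>d\<close> lists all derivatives of a function of one variable; with
  \<open>j\<close> arbitrary, each partial derivative is again a multiple of a member of the
  list.\<close>

lemma C_diff_comp_inner:
  assumes "\<And>j r. (d j has_vector_derivative d (Suc j) r) (at r)"
  shows "C_diff k (\<lambda>x. d j (x \<bullet> v))"
proof (induction k arbitrary: j)
  case 0
  have "continuous_on UNIV (d j)"
    using assms by (intro continuous_at_imp_continuous_on) (auto intro: has_vector_derivative_continuous)
  then show ?case
    by (auto intro!: continuous_on_compose2[of UNIV "d j"] continuous_intros)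
next
  case (Suc k)
  have *: "((\<lambda>x. d j (x \<bullet> v)) has_derivative (\<lambda>h. (h \<bullet> v) *\<^sub>R d (Suc j) (x \<bullet> v))) (at x)" for x
    by (rule has_derivative_compose[OF bounded_linear_imp_has_derivative[OF bounded_linear_inner_left],
          of "d j" "\<lambda>h. h *\<^sub>R d (Suc j) (x \<bullet> v)"])
      (use assms[of j "x \<bullet> v"] in \<open>simp add: has_vector_derivative_def\<close>)
  have "partial_deriv b (\<lambda>x. d j (x \<bullet> v)) = (\<lambda>x. (b \<bullet> v) *\<^sub>R d (Suc j) (x \<bullet> v))" for b
    by (rule ext) (simp add: has_derivative_partial_deriv[OF *])
  then show ?case
    using * Suc by (auto simp: differentiable_def intro!: C_diff_linear[OF bounded_linear_scaleR_right])
qed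

section \<open>Symmetry of second partial derivatives\<close>

lemma vector_differentiable_bound:
  fixes f :: "real \<Rightarrow> 'b::real_normed_vector"
  assumes "\<And>s. s \<in> S \<Longrightarrow> (f has_vector_derivative f' s) (at s within S)"
    and "\<And>s. s \<in> S \<Longrightarrow> norm (f' s) \<le> B" and "convex S" "x \<in> S" "y \<in> S"
  shows "norm (f x - f y) \<le> B * \<bar>x - y\<bar>"
proof -
  have "onorm (\<lambda>h. h *\<^sub>R f' s) \<le> B" if "s \<in> S" for s
    using assms(2)[OF that] by (intro onorm_le) (simp add: mult.commute[of B] mult_left_mono)
  then show ?thesis
    using differentiable_bound[of S f "\<lambda>s h. h *\<^sub>R f' s" B x y] assms
    by (auto simp: has_vector_derivative_def)
qed

text \<open>The second difference is symmetric in \<open>b\<close> and \<open>c\<close>, so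
  identifying its limit with one order of differentiation yields the other order too. The mean value
  inequality is applied along \<open>b\<close> to a difference along \<open>c\<close>, after which
  differentiability of the first derivative at the single point \<open>x\<close> suffices.\<close>

lemma second_difference_partial_deriv:
  fixes f :: "'a::euclidean_space \<Rightarrow> 'b::real_normed_vector"
  assumes f: "\<And>x. f differentiable (at x)" and df: "partial_deriv b f differentiable (at x)"
  shows "((\<lambda>t. (1 / t\<^sup>2) *\<^sub>R (f (x + t *\<^sub>R b + t *\<^sub>R c) - f (x + t *\<^sub>R b) - f (x + t *\<^sub>R c) + f x))
           \<longlongrightarrow> partial_deriv c (partial_deriv b f) x) (at_right 0)"
proof -
  define D where "D = frechet_derivative (partial_deriv b f) (at x)"
  have D: "(partial_deriv b f has_derivative D) (at x)"
    using df frechet_derivative_works unfolding D_def by blast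
  interpret D: bounded_linear D
    using D by (rule has_derivative_bounded_linear)
  have Dc: "partial_deriv c (partial_deriv b f) x = D c"
    by (rule has_derivative_partial_deriv[OF D])
  \<comment> \<open>For \<open>0 \<le> s \<le> t\<close> the displacements
    \<open>t *\<^sub>R c + s *\<^sub>R b\<close> and \<open>s *\<^sub>R b\<close> have total length
    at most \<open>K * t\<close>; the summand 1 keeps \<open>K\<close> positive even if both vectors
    vanish.\<close>
  define K where "K = 2 * norm b + norm c + 1"
  have K: "K > 0"
    by (simp add: K_def add_nonneg_pos)
  show ?thesis
    unfolding Dc
  proof (rule tendstoI)
    fix e :: real
    assume e: "e > 0"
    define e' where "e' = e / (2 * K)"
    have e': "e' > 0"
      using e K by (simp add: e'_def)
    obtain d where d: "d > 0" and
      dD: "\<And>y. norm (y - x) < d \<Longrightarrow> norm (partial_deriv b f y - partial_deriv b f x - D (y - x)) \<le> e' * norm (y - x)"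
      using D e' unfolding has_derivative_at_alt by blast
    have "dist ((1 / t\<^sup>2) *\<^sub>R (f (x + t *\<^sub>R b + t *\<^sub>R c) - f (x + t *\<^sub>R b) - f (x + t *\<^sub>R c) + f x)) (D c) < e"
      if t: "t > 0" "t < d / K" for t
    proof -
      \<comment> \<open>\<open>k t - k 0\<close> is the second difference minus its expected value
        \<open>t\<^sup>2 *\<^sub>R D c\<close>, so a bound for \<open>k'\<close> on
        \<open>{0..t}\<close> controls the error.\<close>
      define k where "k s = f (x + t *\<^sub>R c + s *\<^sub>R b) - f (x + s *\<^sub>R b) - (s * t) *\<^sub>R D c" for s
      define k' where "k' s = partial_deriv b f (x + t *\<^sub>R c + s *\<^sub>R b) - partial_deriv b f (x + s *\<^sub>R b) - t *\<^sub>R D c" for s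
      have k: "(k has_vector_derivative k' s) (at s within S)" for s S
        unfolding k_def k'_def
        by (intro has_vector_derivative_diff has_partial_line has_partial_differentiable f)
          (auto intro!: derivative_eq_intros)
      have bnd: "norm (k' s) \<le> e' * (K * t)" if s: "0 \<le> s" "s \<le> t" for s
      proof -
        have n1: "norm (t *\<^sub>R c + s *\<^sub>R b) \<le> t * norm c + t * norm b"
          using s t by (intro order_trans[OF norm_triangle_ineq] add_mono) (auto intro: mult_right_mono)
        have n2: "norm (s *\<^sub>R b) \<le> t * norm b"
          using s t by (auto intro: mult_right_mono)
        have tK: "t * norm c + t * norm b < d" "t * norm b < d"
        proof -
          have "t * norm c + t * norm b \<le> t * K" "t * norm b \<le> t * K"
            unfolding distrib_left[symmetric] using t by (intro mult_left_mono; simp add: K_def)+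
          moreover have "t * K < d"
            using t K by (simp add: field_simps)
          ultimately show "t * norm c + t * norm b < d" "t * norm b < d"
            by linarith+
        qed
        have d1: "norm (partial_deriv b f (x + t *\<^sub>R c + s *\<^sub>R b) - partial_deriv b f x - D (t *\<^sub>R c + s *\<^sub>R b))
            \<le> e' * norm (t *\<^sub>R c + s *\<^sub>R b)"
          using dD[of "x + (t *\<^sub>R c + s *\<^sub>R b)"] n1 tK by (simp add: add.assoc)
        have d2: "norm (partial_deriv b f (x + s *\<^sub>R b) - partial_deriv b f x - D (s *\<^sub>R b))
            \<le> e' * norm (s *\<^sub>R b)"
          using dD[of "x + s *\<^sub>R b"] n2 tK by simp
        have "k' s = (partial_deriv b f (x + t *\<^sub>R c + s *\<^sub>R b) - partial_deriv b f x - D (t *\<^sub>R c + s *\<^sub>R b))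
            - (partial_deriv b f (x + s *\<^sub>R b) - partial_deriv b f x - D (s *\<^sub>R b))"
          by (simp add: k'_def D.add D.scaleR)
        also have "norm \<dots> \<le> e' * norm (t *\<^sub>R c + s *\<^sub>R b) + e' * norm (s *\<^sub>R b)"
          by (rule order_trans[OF norm_triangle_ineq4 add_mono[OF d1 d2]])
        also have "\<dots> \<le> e' * (t * norm c + t * norm b) + e' * (t * norm b)"
          using n1 n2 e' by (intro add_mono mult_left_mono) auto
        also have "\<dots> \<le> e' * (K * t)"
          using t e' by (simp add: K_def algebra_simps)
        finally show ?thesis .
      qed
      have "norm (k t - k 0) \<le> e' * (K * t) * \<bar>t - 0\<bar>"
        by (rule vector_differentiable_bound[where S = "{0..t}"]) (use t k bnd in auto)
      also have "\<dots> = e / 2 * t\<^sup>2"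
        using t K by (simp add: e'_def power2_eq_square)
      finally have le: "norm (k t - k 0) \<le> e / 2 * t\<^sup>2" .
      have "(1 / t\<^sup>2) *\<^sub>R (f (x + t *\<^sub>R b + t *\<^sub>R c) - f (x + t *\<^sub>R b) - f (x + t *\<^sub>R c) + f x) - D c
          = (1 / t\<^sup>2) *\<^sub>R (k t - k 0)"
        using t by (simp add: k_def algebra_simps power2_eq_square)
      then have "dist ((1 / t\<^sup>2) *\<^sub>R (f (x + t *\<^sub>R b + t *\<^sub>R c) - f (x + t *\<^sub>R b) - f (x + t *\<^sub>R c) + f x)) (D c)
          = norm (k t - k 0) / t\<^sup>2"
        by (simp add: dist_norm)
      also have "\<dots> \<le> e / 2"
        using le t by (simp add: divide_le_eq)
      finally show ?thesis
        using e by simp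
    qed
    then show "\<forall>\<^sub>F t in at_right 0. dist ((1 / t\<^sup>2) *\<^sub>R (f (x + t *\<^sub>R b + t *\<^sub>R c) - f (x + t *\<^sub>R b) - f (x + t *\<^sub>R c) + f x)) (D c) < e"
      using d K by (auto simp: eventually_at_right_field intro!: exI[of _ "d / K"])
  qed
qed

lemma partial_deriv_commute:
  fixes f :: "'a::euclidean_space \<Rightarrow> 'b::real_normed_vector"
  assumes "C_diff (Suc (Suc 0)) f" "b \<in> Basis" "c \<in> Basis"
  shows "partial_deriv c (partial_deriv b f) = partial_deriv b (partial_deriv c f)"
proof
  fix x
  have 1: "((\<lambda>t. (1 / t\<^sup>2) *\<^sub>R (f (x + t *\<^sub>R b + t *\<^sub>R c) - f (x + t *\<^sub>R b) - f (x + t *\<^sub>R c) + f x))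
           \<longlongrightarrow> partial_deriv c (partial_deriv b f) x) (at_right 0)"
    using assms by (intro second_difference_partial_deriv) auto
  have 2: "((\<lambda>t. (1 / t\<^sup>2) *\<^sub>R (f (x + t *\<^sub>R c + t *\<^sub>R b) - f (x + t *\<^sub>R c) - f (x + t *\<^sub>R b) + f x))
           \<longlongrightarrow> partial_deriv b (partial_deriv c f) x) (at_right 0)"
    using assms by (intro second_difference_partial_deriv) auto
  have "(\<lambda>t. (1 / t\<^sup>2) *\<^sub>R (f (x + t *\<^sub>R c + t *\<^sub>R b) - f (x + t *\<^sub>R c) - f (x + t *\<^sub>R b) + f x))
      = (\<lambda>t. (1 / t\<^sup>2) *\<^sub>R (f (x + t *\<^sub>R b + t *\<^sub>R c) - f (x + t *\<^sub>R b) - f (x + t *\<^sub>R c) + f x))"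
    by (simp add: algebra_simps)
  from tendsto_unique[OF trivial_limit_at_right_real 1 2[unfolded this]]
  show "partial_deriv c (partial_deriv b f) x = partial_deriv b (partial_deriv c f) x" .
qed

section \<open>Stability properties of the space of test functions\<close>

lemma test_functions_iff:
  "f \<in> test_functions \<longleftrightarrow> (\<forall>k. C_diff k f) \<and> bounded {x. f x \<noteq> 0}"
  by (simp add: test_functions_def)

lemma test_functions_C_diff: "f \<in> test_functions \<Longrightarrow> C_diff k f"
  by (simp add: test_functions_def)

lemma test_functions_differentiable: "f \<in> test_functions \<Longrightarrow> f differentiable (at x)"
  using test_functions_C_diff[of f "Suc 0"] by simp

lemma test_functions_continuous: "f \<in> test_functions \<Longrightarrow> continuous_on UNIV f"
  using test_functions_C_diff[of f 0] by simp

lemma test_functions_has_partial: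
  "f \<in> test_functions \<Longrightarrow> has_partial b f (partial_deriv b f)"
  by (intro has_partial_differentiable test_functions_differentiable)

lemma test_functions_partial_deriv:
  assumes f: "f \<in> test_functions" and b: "b \<in> Basis"
  shows "partial_deriv b f \<in> test_functions"
proof -
  have "C_diff k (partial_deriv b f)" for k
    using test_functions_C_diff[OF f, of "Suc k"] b by simp
  moreover have "{x. partial_deriv b f x \<noteq> 0} \<subseteq> closure {x. f x \<noteq> 0}"
  proof (rule subsetI, rule ccontr)
    fix x
    assume x: "x \<in> {x. partial_deriv b f x \<noteq> 0}" "x \<notin> closure {x. f x \<noteq> 0}"
    have "(f has_derivative (\<lambda>h. 0)) (at x)"
    proof (rule has_derivative_transform_within_open)
      show "((\<lambda>x. 0) has_derivative (\<lambda>h. 0)) (at x)"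
        by simp
      show "open (- closure {x. f x \<noteq> 0})" "x \<in> - closure {x. f x \<noteq> 0}"
        using x by auto
      show "\<And>y. y \<in> - closure {x. f x \<noteq> 0} \<Longrightarrow> 0 = f y"
        using closure_subset[of "{x. f x \<noteq> 0}"] by auto
    qed
    then show False
      using x has_derivative_partial_deriv by fastforce
  qed
  ultimately show ?thesis
    using f bounded_subset unfolding test_functions_iff by (metis bounded_closure)
qed

lemma test_functions_linear:
  assumes L: "bounded_linear L" and f: "f \<in> test_functions"
  shows "(\<lambda>x. L (f x)) \<in> test_functions"
proof -
  have "L 0 = 0"
    using L by (rule linear_simps(3))
  then have "{x. L (f x) \<noteq> 0} \<subseteq> {x. f x \<noteq> 0}"
    by (intro Collect_mono) metis
  then show ?thesis
    using f bounded_subset by (auto simp: test_functions_iff intro: C_diff_linear[OF L])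
qed

lemma test_functions_add:
  assumes f: "f \<in> test_functions" and g: "g \<in> test_functions"
  shows "(\<lambda>x. f x + g x) \<in> test_functions"
proof -
  have "{x. f x + g x \<noteq> 0} \<subseteq> {x. f x \<noteq> 0} \<union> {x. g x \<noteq> 0}"
    by auto
  moreover have "bounded ({x. f x \<noteq> 0} \<union> {x. g x \<noteq> 0})"
    using f g by (simp add: test_functions_iff)
  ultimately have "bounded {x. f x + g x \<noteq> 0}"
    by (rule bounded_subset[rotated])
  then show ?thesis
    using f g by (simp add: test_functions_iff C_diff_add)
qed

lemma test_functions_uminus:
  "f \<in> test_functions \<Longrightarrow> (\<lambda>x. - f x) \<in> test_functions"
  using test_functions_linear[OF bounded_linear_minus[OF bounded_linear_ident]] .

lemma test_functions_diff:
  assumes "f \<in> test_functions" "g \<in> test_functions"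
  shows "(\<lambda>x. f x - g x) \<in> test_functions"
  using test_functions_add[OF assms(1) test_functions_uminus[OF assms(2)]] by simp

lemma test_functions_sum:
  assumes "\<And>i. i \<in> I \<Longrightarrow> f i \<in> test_functions"
  shows "(\<lambda>x. \<Sum>i\<in>I. f i x) \<in> test_functions"
  using assms
proof (induction I rule: infinite_finite_induct)
  case (insert i I)
  then show ?case
    by (auto intro: test_functions_add)
qed (auto simp: test_functions_iff C_diff_zero)

lemma test_functions_bilinear:
  assumes pr: "bounded_bilinear pr" and f: "f \<in> test_functions" and g: "\<And>k. C_diff k g"
  shows "(\<lambda>x. pr (g x) (f x)) \<in> test_functions"
proof -
  have "{x. pr (g x) (f x) \<noteq> 0} \<subseteq> {x. f x \<noteq> 0}"
    using bounded_bilinear.zero_right[OF pr] by auto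
  then show ?thesis
    using f g bounded_subset by (auto simp: test_functions_iff intro: C_diff_bilinear[OF pr])
qed

lemma test_functions_affine:
  assumes c: "c \<noteq> 0" and f: "f \<in> test_functions"
  shows "(\<lambda>x. f (c *\<^sub>R x + a)) \<in> test_functions"
proof -
  have "{x. f (c *\<^sub>R x + a) \<noteq> 0} \<subseteq> (\<lambda>y. (1 / c) *\<^sub>R (y - a)) ` {x. f x \<noteq> 0}"
  proof
    fix x assume "x \<in> {x. f (c *\<^sub>R x + a) \<noteq> 0}"
    then show "x \<in> (\<lambda>y. (1 / c) *\<^sub>R (y - a)) ` {x. f x \<noteq> 0}"
      using c by (intro image_eqI[of _ _ "c *\<^sub>R x + a"]) auto
  qed
  moreover have "(\<lambda>y. (1 / c) *\<^sub>R (y - a)) ` {x. f x \<noteq> 0} = (*\<^sub>R) (1 / c) ` ((\<lambda>y. - a + y) ` {x. f x \<noteq> 0})"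
    by (simp add: image_image)
  moreover have "bounded ((*\<^sub>R) (1 / c) ` ((\<lambda>y. - a + y) ` {x. f x \<noteq> 0}))"
    using f by (intro bounded_scaling bounded_translation) (simp add: test_functions_iff)
  ultimately have "bounded {x. f (c *\<^sub>R x + a) \<noteq> 0}"
    by (metis bounded_subset)
  then show ?thesis
    using f by (auto simp: test_functions_iff intro: C_diff_affine)
qed

lemma test_functions_translate: "f \<in> test_functions \<Longrightarrow> (\<lambda>x. f (x - a)) \<in> test_functions"
  using test_functions_affine[of 1 f "- a"] by simp

lemma integrable_continuous_bounded_support:
  fixes f :: "'a::euclidean_space \<Rightarrow> 'b::{banach, second_countable_topology}"
  assumes f: "continuous_on UNIV f" and b: "bounded {x. f x \<noteq> 0}"
  shows "integrable lborel f"
proof -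
  let ?K = "closure {x. f x \<noteq> 0}"
  have "integrable lborel (\<lambda>x. indicator ?K x *\<^sub>R f x)"
    using assms by (intro borel_integrable_compact) (auto intro: continuous_on_subset)
  moreover have "(\<lambda>x. indicator ?K x *\<^sub>R f x) = f"
    using closure_subset[of "{x. f x \<noteq> 0}"] by (auto simp: indicator_def fun_eq_iff)
  ultimately show ?thesis
    by simp
qed

subsection \<open>Bump functions\<close>

text \<open>The free power \<open>y ^ k\<close> absorbs the factor \<open>y\<close> that a
  \<open>pCons\<close> splits off, which lets the induction on \<open>q\<close> go through.\<close>

lemma tendsto_power_poly_exp_neg:
  fixes q :: "real poly"
  shows "((\<lambda>y. y ^ k * poly q y * exp (- y)) \<longlongrightarrow> 0) at_top"
proof (induction q arbitrary: k)
  case (pCons a q)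
  have "((\<lambda>y. a * (y ^ k / exp y) + y ^ Suc k * poly q y * exp (- y)) \<longlongrightarrow> a * 0 + 0) at_top"
    by (intro tendsto_intros tendsto_power_div_exp_0 pCons.IH)
  then show ?case
    by (simp add: algebra_simps exp_minus divide_inverse)
qed simp

text \<open>Unlike \<open>exp_inv\<close> alone, this family is stable under differentiation, so
  smoothness of all orders follows from one statement about first derivatives.\<close>

definition exp_inv_poly :: "real poly \<Rightarrow> real \<Rightarrow> real" where
  "exp_inv_poly q x = (if x > 0 then poly q (1 / x) * exp (- 1 / x) else 0)"

text \<open>Differentiating \<open>q (1/x) exp (-1/x)\<close> replaces \<open>q\<close> by \<open>X\<^sup>2 (q - q')\<close>.\<close>

definition exp_inv_step :: "real poly \<Rightarrow> real poly" where
  "exp_inv_step q = [:0, 0, 1:] * (q - pderiv q)"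

lemma exp_inv_poly_has_derivative:
  "(exp_inv_poly q has_vector_derivative exp_inv_poly (exp_inv_step q) x) (at x)"
proof -
  consider "x > 0" | "x < 0" | "x = 0"
    by linarith
  then have "(exp_inv_poly q has_real_derivative exp_inv_poly (exp_inv_step q) x) (at x)"
  proof cases
    case 1
    have "((\<lambda>x. poly q (1 / x) * exp (- 1 / x)) has_real_derivative exp_inv_poly (exp_inv_step q) x) (at x)"
      using 1 by (auto intro!: derivative_eq_intros DERIV_chain2[OF poly_DERIV]
          simp: exp_inv_poly_def exp_inv_step_def field_simps power2_eq_square)
    then show ?thesis
      by (rule has_field_derivative_transform_within_open[where S = "{0<..}"])
        (use 1 in \<open>auto simp: exp_inv_poly_def\<close>)
  next
    case 2
    have "((\<lambda>x. 0) has_real_derivative exp_inv_poly (exp_inv_step q) x) (at x)"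
      using 2 by (simp add: exp_inv_poly_def)
    then show ?thesis
      by (rule has_field_derivative_transform_within_open[where S = "{..<0}"])
        (use 2 in \<open>auto simp: exp_inv_poly_def\<close>)
  next
    case 3
    \<comment> \<open>With y = 1/h the difference quotient from the right becomes y q(y) exp (-y);
      the division by h accounts for the power 1 of y.\<close>
    have "((\<lambda>h. exp_inv_poly q h / h) \<longlongrightarrow> 0) (at_right 0)"
    proof -
      have "((\<lambda>h. inverse h ^ 1 * poly q (inverse h) * exp (- inverse h)) \<longlongrightarrow> 0) (at_right 0)"
        by (rule filterlim_compose[OF tendsto_power_poly_exp_neg filterlim_inverse_at_top_right])
      moreover have "\<forall>\<^sub>F h in at_right 0. inverse h ^ 1 * poly q (inverse h) * exp (- inverse h) = exp_inv_poly q h / h"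
        by (auto simp: eventually_at_right_field exp_inv_poly_def field_simps intro!: exI[of _ 1])
      ultimately show ?thesis
        by (rule Lim_transform_eventually)
    qed
    moreover have "((\<lambda>h. exp_inv_poly q h / h) \<longlongrightarrow> 0) (at_left 0)"
      by (rule Lim_transform_eventually[OF tendsto_const])
        (auto simp: eventually_at_left_field exp_inv_poly_def intro!: exI[of _ "-1"])
    ultimately have "((\<lambda>h. exp_inv_poly q h / h) \<longlongrightarrow> 0) (at 0)"
      by (simp add: filterlim_at_split)
    then show ?thesis
      using 3 by (simp add: DERIV_def exp_inv_poly_def)
  qed
  then show ?thesis
    by (simp add: has_real_derivative_iff_has_vector_derivative)
qed

definition exp_inv :: "real \<Rightarrow> real" where
  "exp_inv x = (if x > 0 then exp (- 1 / x) else 0)"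

lemma C_diff_exp_inv: "C_diff k (\<lambda>x. exp_inv (x \<bullet> v))"
proof -
  have "exp_inv = exp_inv_poly 1"
    by (simp add: fun_eq_iff exp_inv_def exp_inv_poly_def)
  moreover have "C_diff k (\<lambda>x. exp_inv_poly ((exp_inv_step ^^ 0) 1) (x \<bullet> v))"
    by (rule C_diff_comp_inner[where d = "\<lambda>j. exp_inv_poly ((exp_inv_step ^^ j) 1)"])
      (simp add: exp_inv_poly_has_derivative)
  ultimately show ?thesis
    by simp
qed

lemma exp_inv_bounds: "0 \<le> exp_inv x" "exp_inv x \<le> 1"
  by (auto simp: exp_inv_def)

lemma C_diff_exp_inv_affine: "C_diff k (\<lambda>x. exp_inv (c * (x \<bullet> v) + d))"
proof -
  \<comment> \<open>The constant \<open>d\<close> is produced by a translation along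
    \<open>v\<close>, which needs \<open>v\<close> to be nonzero.\<close>
  have "C_diff k (\<lambda>x. exp_inv ((c *\<^sub>R x + (d / (v \<bullet> v)) *\<^sub>R v) \<bullet> v))" if "v \<noteq> 0"
    by (rule C_diff_affine[OF C_diff_exp_inv])
  moreover have "C_diff k (\<lambda>x::'a. exp_inv d)"
  proof (induction k)
    case (Suc k)
    have "partial_deriv b (\<lambda>x::'a. exp_inv d) = (\<lambda>x. 0)" for b
      by (simp add: fun_eq_iff partial_deriv_def)
    then show ?case
      by (simp add: C_diff_zero)
  qed simp
  ultimately show ?thesis
    by (cases "v = 0") (auto simp: inner_add_left)
qed

text \<open>For positive \<open>m\<close> it is nonzero exactly on the open box. The parameter
  \<open>m\<close> steepens the walls: exp (-1/(m r)) tends to 1 for every r > 0, so the bumps tend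
  pointwise to the indicator of the box.\<close>

definition box_bump :: "'a::euclidean_space \<Rightarrow> 'a \<Rightarrow> nat \<Rightarrow> 'a \<Rightarrow> real" where
  "box_bump l u m x =
     (\<Prod>b\<in>Basis. exp_inv (real m * (x \<bullet> b - l \<bullet> b)) * exp_inv (real m * (u \<bullet> b - x \<bullet> b)))"

lemma C_diff_const: "C_diff k (\<lambda>x. c)"
  by (cases k) (auto simp: partial_deriv_def[abs_def] C_diff_zero)

lemma C_diff_prod:
  fixes f :: "'i \<Rightarrow> 'a::euclidean_space \<Rightarrow> real"
  shows "(\<And>i. i \<in> I \<Longrightarrow> C_diff k (f i)) \<Longrightarrow> C_diff k (\<lambda>x. \<Prod>i\<in>I. f i x)"
  by (induction I rule: infinite_finite_induct)
    (auto intro: C_diff_const C_diff_bilinear[OF bounded_bilinear_mult])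

lemma box_bump_nonzero: "m > 0 \<Longrightarrow> box_bump l u m x \<noteq> 0 \<longleftrightarrow> x \<in> box l u"
  by (auto simp: box_bump_def mem_box exp_inv_def zero_less_mult_iff split: if_splits)

lemma box_bump_test_function: "m > 0 \<Longrightarrow> box_bump l u m \<in> test_functions"
proof -
  have "C_diff k (\<lambda>x. exp_inv (real m * (x \<bullet> b - l \<bullet> b)))" "C_diff k (\<lambda>x. exp_inv (real m * (u \<bullet> b - x \<bullet> b)))" for k b
    using C_diff_exp_inv_affine[of k "real m" b "- (real m * (l \<bullet> b))"]
      C_diff_exp_inv_affine[of k "- real m" b "real m * (u \<bullet> b)"]
    by (simp_all add: right_diff_distrib)
  then have "C_diff k (box_bump l u m)" for k
    unfolding box_bump_def[abs_def] by (intro C_diff_prod C_diff_bilinear[OF bounded_bilinear_mult])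
  moreover assume "m > 0"
  ultimately show ?thesis
    by (simp add: test_functions_iff box_bump_nonzero)
qed

lemma box_bump_bounds: "0 \<le> box_bump l u m x" "box_bump l u m x \<le> 1"
  unfolding box_bump_def
  by (auto intro!: prod_nonneg prod_le_1 mult_nonneg_nonneg mult_le_one exp_inv_bounds)

lemma tendsto_exp_inv: "(\<lambda>m. exp_inv (real m * r)) \<longlonglongrightarrow> (if r > 0 then 1 else 0)"
proof (cases "r > 0")
  case True
  have "(\<lambda>m. exp (- (1 / r) * inverse (real m))) \<longlonglongrightarrow> exp (- (1 / r) * 0)"
    by (intro tendsto_intros lim_inverse_n)
  moreover have "\<forall>\<^sub>F m in sequentially. exp (- (1 / r) * inverse (real m)) = exp_inv (real m * r)"
    using True by (intro eventually_sequentiallyI[of 1]) (auto simp: exp_inv_def field_simps)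
  ultimately show ?thesis
    using True Lim_transform_eventually by fastforce
next
  case False
  then have "real m * r \<le> 0" for m
    by (intro mult_nonneg_nonpos) auto
  then have "exp_inv (real m * r) = 0" for m
    unfolding exp_inv_def by (meson not_less)
  then show ?thesis
    using False by simp
qed

lemma tendsto_box_bump: "(\<lambda>m. box_bump l u m x) \<longlonglongrightarrow> indicator (box l u) x"
proof -
  have "(\<lambda>m. \<Prod>b\<in>Basis. exp_inv (real m * (x \<bullet> b - l \<bullet> b)) * exp_inv (real m * (u \<bullet> b - x \<bullet> b)))
      \<longlonglongrightarrow> (\<Prod>b\<in>Basis. (if x \<bullet> b - l \<bullet> b > 0 then 1 else 0) * (if u \<bullet> b - x \<bullet> b > 0 then 1 else 0))"
    by (intro tendsto_intros tendsto_exp_inv)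
  moreover have "(\<Prod>b\<in>Basis. (if x \<bullet> b - l \<bullet> b > 0 then 1 else 0) * (if u \<bullet> b - x \<bullet> b > 0 then 1 else 0))
      = (indicator (box l u) x :: real)"
    by (auto simp: indicator_def mem_box intro!: prod.neutral)
  ultimately show ?thesis
    by (simp add: box_bump_def)
qed

section \<open>Integration by parts\<close>

lemma
  fixes f :: "'a::euclidean_space \<Rightarrow> 'b::{banach, second_countable_topology}"
  assumes [measurable]: "f \<in> borel_measurable borel"
  shows integral_lborel_translate: "(\<integral>x. f (x + a) \<partial>lborel) = (\<integral>x. f x \<partial>lborel)"
    and integrable_lborel_translate: "integrable lborel (\<lambda>x. f (x + a)) \<longleftrightarrow> integrable lborel f"
proof -
  have "integral\<^sup>L (distr lborel borel ((+) a)) f = (\<integral>x. f (a + x) \<partial>lborel)"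
    by (rule integral_distr) measurable
  then show "(\<integral>x. f (x + a) \<partial>lborel) = (\<integral>x. f x \<partial>lborel)"
    by (simp add: lborel_distr_plus add.commute)
  have "integrable (distr lborel borel ((+) a)) f = integrable lborel (\<lambda>x. f (a + x))"
    by (rule integrable_distr_eq) measurable
  then show "integrable lborel (\<lambda>x. f (x + a)) \<longleftrightarrow> integrable lborel f"
    by (simp add: lborel_distr_plus add.commute)
qed

text \<open>Average the fundamental theorem of calculus on \<open>[x, x + b]\<close> over all \<open>x\<close>.\<close>

lemma integral_partial_eq_0:
  fixes f f' :: "'a::euclidean_space \<Rightarrow> complex"
  assumes der: "has_partial b f f'" and cont: "continuous_on UNIV f'"
    and f: "integrable lborel f" and f': "integrable lborel f'"
  shows "(\<integral>x. f' x \<partial>lborel) = 0"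
proof -
  have [measurable]: "f' \<in> borel_measurable borel" "f \<in> borel_measurable borel"
    using cont f by (auto intro: borel_measurable_continuous_onI)
  \<comment> \<open>Fubini exchanges the integral over the segment with the one over
    \<open>x\<close>; translation invariance makes the inner integral over \<open>x\<close>
    independent of \<open>s\<close>.\<close>
  define G where "G s x = indicator {0..1} s *\<^sub>R f' (x + s *\<^sub>R b)" for s :: real and x
  have [measurable]: "case_prod G \<in> borel_measurable (lborel \<Otimes>\<^sub>M lborel)"
    unfolding G_def by measurable
  have int: "integrable (lborel \<Otimes>\<^sub>M lborel) (case_prod G)"
  proof (rule lborel_pair.Fubini_integrable)
    have "(\<lambda>s. \<integral>x. norm (case_prod G (s, x)) \<partial>lborel) = (\<lambda>s. indicator {0..1} s *\<^sub>R (\<integral>x. norm (f' x) \<partial>lborel))"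
    proof
      fix s
      have "(\<integral>x. norm (f' (x + s *\<^sub>R b)) \<partial>lborel) = (\<integral>x. norm (f' x) \<partial>lborel)"
        by (rule integral_lborel_translate[of "\<lambda>x. norm (f' x)"]) measurable
      then show "(\<integral>x. norm (case_prod G (s, x)) \<partial>lborel) = indicator {0..1} s *\<^sub>R (\<integral>x. norm (f' x) \<partial>lborel)"
        by (simp add: G_def)
    qed
    then show "integrable lborel (\<lambda>s. \<integral>x. norm (case_prod G (s, x)) \<partial>lborel)"
      by simp
    have "integrable lborel (\<lambda>x. f' (x + s *\<^sub>R b))" for s
      using integrable_lborel_translate[of f'] f' by simp
    then show "AE s in lborel. integrable lborel (\<lambda>x. case_prod G (s, x))"
      by (intro AE_I2) (simp add: G_def)
  qed measurable
  have "(\<integral>s. G s x \<partial>lborel) = f (x + b) - f x" for x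
  proof -
    have "(\<integral>s. indicator {0..1} s *\<^sub>R f' (x + s *\<^sub>R b) \<partial>lborel) = f (x + 1 *\<^sub>R b) - f (x + 0 *\<^sub>R b)"
    proof (rule integral_FTC_Icc)
      show "continuous_on {0..1} (\<lambda>s. f' (x + s *\<^sub>R b))"
        by (intro continuous_on_compose2[OF cont] continuous_intros) auto
    qed (use has_partial_line[OF der] in auto)
    then show ?thesis
      by (simp add: G_def)
  qed
  then have "(\<integral>x. f (x + b) - f x \<partial>lborel) = (\<integral>x. (\<integral>s. G s x \<partial>lborel) \<partial>lborel)"
    by simp
  also have "\<dots> = (\<integral>s. (\<integral>x. G s x \<partial>lborel) \<partial>lborel)"
    by (rule lborel_pair.Fubini_integral[OF int])
  also have "\<dots> = (\<integral>s. indicator {0..1} s *\<^sub>R (\<integral>x. f' x \<partial>lborel) \<partial>(lborel :: real measure))"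
    by (simp add: G_def integral_lborel_translate)
  also have "\<dots> = (\<integral>x. f' x \<partial>lborel)"
    by simp
  finally have "(\<integral>x. f' x \<partial>lborel) = (\<integral>x. f (x + b) - f x \<partial>lborel)" ..
  also have "\<dots> = 0"
    using f by (simp add: integrable_lborel_translate integral_lborel_translate)
  finally show ?thesis .
qed

text \<open>Functions rather than classes, since pointwise derivatives are needed; continuity
  upgrades vanishing almost everywhere to vanishing everywhere.\<close>

definition cL2 :: "('a::euclidean_space \<Rightarrow> complex) \<Rightarrow> bool" where
  "cL2 u \<longleftrightarrow> continuous_on UNIV u \<and> integrable lborel (\<lambda>x. (cmod (u x))\<^sup>2)"

lemma cL2_mult_integrable:
  assumes "cL2 u" "cL2 v"
  shows "integrable lborel (\<lambda>x. u x * cnj (v x))"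
proof (rule Bochner_Integration.integrable_bound)
  show "integrable lborel (\<lambda>x. (cmod (u x))\<^sup>2 + (cmod (v x))\<^sup>2)"
    using assms by (auto simp: cL2_def)
  have "cmod (u x * cnj (v x)) \<le> (cmod (u x))\<^sup>2 + (cmod (v x))\<^sup>2" for x
  proof -
    have "2 * (cmod (u x) * cmod (v x)) \<le> (cmod (u x))\<^sup>2 + (cmod (v x))\<^sup>2"
      using sum_squares_bound[of "cmod (u x)" "cmod (v x)"] by simp
    moreover have "0 \<le> cmod (u x) * cmod (v x)"
      by simp
    ultimately show ?thesis
      unfolding norm_mult complex_mod_cnj by linarith
  qed
  then show "AE x in lborel. cmod (u x * cnj (v x)) \<le> norm ((cmod (u x))\<^sup>2 + (cmod (v x))\<^sup>2)"
    by (intro AE_I2) simp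
  have "continuous_on UNIV (\<lambda>x. u x * cnj (v x))"
    using assms by (auto simp: cL2_def intro!: continuous_intros)
  then show "(\<lambda>x. u x * cnj (v x)) \<in> borel_measurable lborel"
    by (simp add: borel_measurable_continuous_onI)
qed

lemma cL2_add:
  assumes "cL2 u" "cL2 v"
  shows "cL2 (\<lambda>x. u x + v x)"
  unfolding cL2_def
proof
  show cont: "continuous_on UNIV (\<lambda>x. u x + v x)"
    using assms by (auto simp: cL2_def intro!: continuous_intros)
  show "integrable lborel (\<lambda>x. (cmod (u x + v x))\<^sup>2)"
  proof (rule Bochner_Integration.integrable_bound)
    show "integrable lborel (\<lambda>x. 2 * (cmod (u x))\<^sup>2 + 2 * (cmod (v x))\<^sup>2)"
      using assms by (auto simp: cL2_def)
    have "(cmod (u x + v x))\<^sup>2 \<le> 2 * (cmod (u x))\<^sup>2 + 2 * (cmod (v x))\<^sup>2" for x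
    proof -
      have "(cmod (u x + v x))\<^sup>2 \<le> (cmod (u x) + cmod (v x))\<^sup>2"
        by (intro power_mono norm_triangle_ineq) simp
      then show ?thesis
        using sum_squares_bound[of "cmod (u x)" "cmod (v x)"] by (simp add: power2_sum)
    qed
    then show "AE x in lborel. norm ((cmod (u x + v x))\<^sup>2) \<le> norm (2 * (cmod (u x))\<^sup>2 + 2 * (cmod (v x))\<^sup>2)"
      by (intro AE_I2) simp
    have "continuous_on UNIV (\<lambda>x. (cmod (u x + v x))\<^sup>2)"
      by (intro continuous_intros cont)
    then show "(\<lambda>x. (cmod (u x + v x))\<^sup>2) \<in> borel_measurable lborel"
      by (simp add: borel_measurable_continuous_onI)
  qed
qed

lemma cL2_bounded_mult:
  assumes a: "continuous_on UNIV a" "\<And>x. cmod (a x) \<le> K" and u: "cL2 u"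
  shows "cL2 (\<lambda>x. a x * u x)"
  unfolding cL2_def
proof
  show cont: "continuous_on UNIV (\<lambda>x. a x * u x)"
    using assms by (auto simp: cL2_def intro!: continuous_intros)
  show "integrable lborel (\<lambda>x. (cmod (a x * u x))\<^sup>2)"
  proof (rule Bochner_Integration.integrable_bound)
    show "integrable lborel (\<lambda>x. K\<^sup>2 * (cmod (u x))\<^sup>2)"
      using u by (auto simp: cL2_def)
    have "(cmod (a x * u x))\<^sup>2 \<le> K\<^sup>2 * (cmod (u x))\<^sup>2" for x
      unfolding norm_mult power_mult_distrib by (intro mult_right_mono power_mono a) auto
    then show "AE x in lborel. norm ((cmod (a x * u x))\<^sup>2) \<le> norm (K\<^sup>2 * (cmod (u x))\<^sup>2)"
      by (intro AE_I2) simp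
    have "continuous_on UNIV (\<lambda>x. (cmod (a x * u x))\<^sup>2)"
      by (intro continuous_intros cont)
    then show "(\<lambda>x. (cmod (a x * u x))\<^sup>2) \<in> borel_measurable lborel"
      by (simp add: borel_measurable_continuous_onI)
  qed
qed

text \<open>No decay at infinity is demanded: the product and its derivative are integrable, and
  then the integral of the derivative is 0.\<close>

lemma integral_by_parts:
  assumes "has_partial b u u'" "has_partial b v v'" "cL2 u" "cL2 u'" "cL2 v" "cL2 v'"
  shows "(\<integral>x. u' x * cnj (v x) \<partial>lborel) = - (\<integral>x. u x * cnj (v' x) \<partial>lborel)"
proof -
  have "has_partial b (\<lambda>x. u x * cnj (v x)) (\<lambda>x. u x * cnj (v' x) + u' x * cnj (v x))"
    by (intro has_partial_bilinear[OF bounded_bilinear_mult] has_partial_linear[OF bounded_linear_cnj] assms)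
  then have "(\<integral>x. u x * cnj (v' x) + u' x * cnj (v x) \<partial>lborel) = 0"
    by (rule integral_partial_eq_0)
      (use assms in \<open>auto simp: cL2_def intro!: continuous_intros cL2_mult_integrable[unfolded cL2_def]\<close>)
  then show ?thesis
    using assms by (simp add: cL2_mult_integrable add_eq_0_iff)
qed

lemma integral_by_parts_twice:
  assumes "has_partial b u u1" "has_partial b u1 u2" "has_partial b v v1" "has_partial b v1 v2"
    and "cL2 u" "cL2 u1" "cL2 u2" "cL2 v" "cL2 v1" "cL2 v2"
  shows "(\<integral>x. u2 x * cnj (v x) \<partial>lborel) = (\<integral>x. u x * cnj (v2 x) \<partial>lborel)"
  using integral_by_parts[OF assms(2,3)] integral_by_parts[OF assms(1,4)] assms by simp

text \<open>A closed set that contains almost every point is the whole space.\<close>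

lemma continuous_AE_eq_0:
  fixes f :: "'a::euclidean_space \<Rightarrow> 'b::real_normed_vector"
  assumes "continuous_on UNIV f" "AE x in lborel. f x = 0"
  shows "f x = 0"
proof -
  have "closed {x. f x = 0}"
    using assms(1) by (intro closed_Collect_eq continuous_on_const)
  moreover have "AE x in lebesgue. x \<in> {x. f x = 0}"
    using assms(2) by (simp add: AE_completion)
  ultimately show ?thesis
    using mem_closed_if_AE_lebesgue by blast
qed

lemma cL2_integral_eq_0:
  assumes "cL2 u" "(\<integral>x. (cmod (u x))\<^sup>2 \<partial>lborel) = 0"
  shows "u x = 0"
proof (rule continuous_AE_eq_0[of u])
  have "AE x in lborel. (cmod (u x))\<^sup>2 = 0"
    using assms by (subst (asm) integral_nonneg_eq_0_iff_AE) (auto simp: cL2_def)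
  then show "AE x in lborel. u x = 0"
    by simp
qed (use assms in \<open>simp add: cL2_def\<close>)

lemma integral_square: "cL2 u \<Longrightarrow> (\<integral>x. u x * cnj (u x) \<partial>lborel) = of_real (\<integral>x. (cmod (u x))\<^sup>2 \<partial>lborel)"
  by (simp add: complex_norm_square[symmetric] del: of_real_power flip: integral_complex_of_real)

lemma cL2_eq_0:
  assumes "cL2 u" "(\<integral>x. u x * cnj (u x) \<partial>lborel) = 0"
  shows "u x = 0"
proof (rule cL2_integral_eq_0[OF assms(1)])
  show "(\<integral>x. (cmod (u x))\<^sup>2 \<partial>lborel) = 0"
    using assms(2) unfolding integral_square[OF assms(1)] by (simp only: of_real_eq_0_iff)
qed

section \<open>Square-integrable solutions of the scalar equation\<close>

lemma tendsto_integral_cos: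
  fixes g :: "'a::euclidean_space \<Rightarrow> complex"
  assumes "integrable lborel g"
  shows "(\<lambda>n. \<integral>x. of_real (cos (inverse (real (Suc n)) * (x \<bullet> b))) * g x \<partial>lborel) \<longlonglongrightarrow> (\<integral>x. g x \<partial>lborel)"
proof (rule integral_dominated_convergence)
  show "integrable lborel (\<lambda>x. norm (g x))"
    using assms by simp
  have "(\<lambda>n. of_real (cos (inverse (real (Suc n)) * (x \<bullet> b))) * g x) \<longlonglongrightarrow> of_real (cos (0 * (x \<bullet> b))) * g x" for x
    by (intro tendsto_intros LIMSEQ_inverse_real_of_nat)
  then show "AE x in lborel. (\<lambda>n. of_real (cos (inverse (real (Suc n)) * (x \<bullet> b))) * g x) \<longlonglongrightarrow> g x"
    by (intro AE_I2) simp
  show "AE x in lborel. norm (of_real (cos (inverse (real (Suc n)) * (x \<bullet> b))) * g x) \<le> norm (g x)" for n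
    by (intro AE_I2) (simp add: norm_mult mult_left_le_one_le)
qed (use assms in \<open>auto intro!: borel_measurable_times\<close>)

text \<open>Two integrations by parts restore the sign, and the coefficients are real, so they pass
  through the conjugation.\<close>

lemma second_order_symmetric:
  fixes U V :: "'a::euclidean_space \<Rightarrow> complex" and \<kappa> :: "'a \<Rightarrow> real"
  assumes U: "\<And>b. b \<in> Basis \<Longrightarrow> has_partial b U (U1 b)" "\<And>b. b \<in> Basis \<Longrightarrow> has_partial b (U1 b) (U2 b)"
      "cL2 U" "\<And>b. b \<in> Basis \<Longrightarrow> cL2 (U1 b)" "\<And>b. b \<in> Basis \<Longrightarrow> cL2 (U2 b)"
    and V: "\<And>b. b \<in> Basis \<Longrightarrow> has_partial b V (V1 b)" "\<And>b. b \<in> Basis \<Longrightarrow> has_partial b (V1 b) (V2 b)"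
      "cL2 V" "\<And>b. b \<in> Basis \<Longrightarrow> cL2 (V1 b)" "\<And>b. b \<in> Basis \<Longrightarrow> cL2 (V2 b)"
  shows "(\<integral>x. (\<Sum>b\<in>Basis. of_real (\<kappa> b) * U2 b x) * cnj (V x) \<partial>lborel) =
    (\<integral>x. U x * cnj (\<Sum>b\<in>Basis. of_real (\<kappa> b) * V2 b x) \<partial>lborel)"
proof -
  have "(\<integral>x. (\<Sum>b\<in>Basis. of_real (\<kappa> b) * U2 b x) * cnj (V x) \<partial>lborel)
      = (\<Sum>b\<in>Basis. of_real (\<kappa> b) * (\<integral>x. U2 b x * cnj (V x) \<partial>lborel))"
    using U V by (simp add: sum_distrib_right mult.assoc cL2_mult_integrable)
  also have "\<dots> = (\<Sum>b\<in>Basis. of_real (\<kappa> b) * (\<integral>x. U x * cnj (V2 b x) \<partial>lborel))"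
    using integral_by_parts_twice[OF U(1,2) V(1,2)] U V by simp
  also have "\<dots> = (\<integral>x. U x * cnj (\<Sum>b\<in>Basis. of_real (\<kappa> b) * V2 b x) \<partial>lborel)"
  proof -
    have "U x * cnj (\<Sum>b\<in>Basis. of_real (\<kappa> b) * V2 b x) = (\<Sum>b\<in>Basis. of_real (\<kappa> b) * (U x * cnj (V2 b x)))" for x
      by (simp add: sum_distrib_left mult.left_commute)
    then show ?thesis
      using U V by (simp add: cL2_mult_integrable)
  qed
  finally show ?thesis .
qed

lemma has_partial_cos:
  "has_partial b (\<lambda>x. complex_of_real (cos (t * (x \<bullet> v))))
     (\<lambda>x. of_real (- t * (b \<bullet> v)) * of_real (sin (t * (x \<bullet> v))))"
proof -
  have "((\<lambda>r. cos (t * r)) has_real_derivative - t * sin (t * r)) (at r)" for r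
    by (auto intro!: derivative_eq_intros)
  then have "((\<lambda>r. complex_of_real (cos (t * r))) has_vector_derivative of_real (- t * sin (t * r))) (at r)" for r
    unfolding has_real_derivative_iff_has_vector_derivative
    by (rule bounded_linear.has_vector_derivative[OF bounded_linear_of_real])
  from has_partial_comp_inner[OF this, of b v] show ?thesis
    by (simp add: scaleR_conv_of_real mult_ac)
qed

lemma has_partial_sin:
  "has_partial b (\<lambda>x. complex_of_real (sin (t * (x \<bullet> v))))
     (\<lambda>x. of_real (t * (b \<bullet> v)) * of_real (cos (t * (x \<bullet> v))))"
proof -
  have "((\<lambda>r. sin (t * r)) has_real_derivative t * cos (t * r)) (at r)" for r
    by (auto intro!: derivative_eq_intros)
  then have "((\<lambda>r. complex_of_real (sin (t * r))) has_vector_derivative of_real (t * cos (t * r))) (at r)" for r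
    unfolding has_real_derivative_iff_has_vector_derivative
    by (rule bounded_linear.has_vector_derivative[OF bounded_linear_of_real])
  from has_partial_comp_inner[OF this, of b v] show ?thesis
    by (simp add: scaleR_conv_of_real mult_ac)
qed

text \<open>A virial argument: the commutator of the operator with multiplication by (a bounded
  approximation of) the coordinate \<open>x \<bullet> b0\<close> is a multiple of the derivative along \<open>b0\<close>.\<close>

lemma L2_solution_eq_0:
  fixes F :: "'a::euclidean_space \<Rightarrow> complex" and \<kappa> :: "'a \<Rightarrow> real"
  assumes b0: "b0 \<in> Basis" "\<kappa> b0 \<noteq> 0"
    and F: "cL2 F"
    and F1: "\<And>b. b \<in> Basis \<Longrightarrow> has_partial b F (F1 b)" "\<And>b. b \<in> Basis \<Longrightarrow> cL2 (F1 b)"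
    and F2: "\<And>b. b \<in> Basis \<Longrightarrow> has_partial b (F1 b) (F2 b)" "\<And>b. b \<in> Basis \<Longrightarrow> cL2 (F2 b)"
    and H1: "\<And>b. b \<in> Basis \<Longrightarrow> has_partial b (F1 b0) (H1 b)" "\<And>b. b \<in> Basis \<Longrightarrow> cL2 (H1 b)"
    and H2: "\<And>b. b \<in> Basis \<Longrightarrow> has_partial b (H1 b) (H2 b)" "\<And>b. b \<in> Basis \<Longrightarrow> cL2 (H2 b)"
    and eqF: "\<And>x. (\<Sum>b\<in>Basis. of_real (\<kappa> b) * F2 b x) = - (c * F x)"
    and eqH: "\<And>x. (\<Sum>b\<in>Basis. of_real (\<kappa> b) * H2 b x) = - (c * F1 b0 x)"
  shows "F x = 0"
proof -
  show ?thesis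
  proof (cases "cnj c = c")
    \<comment> \<open>Symmetry of the operator makes \<open>c\<close> and \<open>cnj c\<close> give
      the same multiple of the squared norm of \<open>F\<close>.\<close>
    case False
    have "(\<integral>x. (\<Sum>b\<in>Basis. of_real (\<kappa> b) * F2 b x) * cnj (F x) \<partial>lborel) =
        (\<integral>x. F x * cnj (\<Sum>b\<in>Basis. of_real (\<kappa> b) * F2 b x) \<partial>lborel)"
      by (rule second_order_symmetric[where ?U1.0 = F1 and ?V1.0 = F1]) (assumption | rule F F1 F2)+
    then have "(\<integral>x. - c * (F x * cnj (F x)) \<partial>lborel) = (\<integral>x. - cnj c * (F x * cnj (F x)) \<partial>lborel)"
      unfolding eqF by (simp add: mult.assoc mult.left_commute)
    then have "- c * (\<integral>x. F x * cnj (F x) \<partial>lborel) = - cnj c * (\<integral>x. F x * cnj (F x) \<partial>lborel)"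
      unfolding integral_mult_right_zero .
    then have "(\<integral>x. F x * cnj (F x) \<partial>lborel) = 0"
      using False by (metis mult_cancel_right neg_equal_iff_equal)
    then show ?thesis
      by (rule cL2_eq_0[OF F])
  next
    \<comment> \<open>The function \<open>H\<close> is the derivative of \<open>F\<close> along
      \<open>b0\<close>. It is shown to vanish first; then \<open>F\<close> is constant along
      \<open>b0\<close>.\<close>
    case c: True
    define H where "H = F1 b0"
    have H: "cL2 H"
      using F1 b0 by (simp add: H_def)
    define co where "co t x = complex_of_real (cos (t * (x \<bullet> b0)))" for t :: real and x :: 'a
    define si where "si t x = complex_of_real (sin (t * (x \<bullet> b0)))" for t :: real and x :: 'a
    have co: "continuous_on UNIV (co t)" "cmod (co t x) \<le> 1" for t x
      unfolding co_def[abs_def] by (intro continuous_intros) simp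
    have si: "continuous_on UNIV (si t)" "cmod (si t x) \<le> 1" for t x
      unfolding si_def[abs_def] by (intro continuous_intros) simp
    have co': "has_partial b (co t) (\<lambda>x. of_real (- t * (b \<bullet> b0)) * si t x)" for t b
      unfolding co_def[abs_def] si_def[abs_def] by (rule has_partial_cos)
    have si': "has_partial b (si t) (\<lambda>x. of_real (t * (b \<bullet> b0)) * co t x)" for t b
      unfolding si_def[abs_def] co_def[abs_def] by (rule has_partial_sin)
    note mult = has_partial_bilinear[OF bounded_bilinear_mult]
    have cmul: "has_partial b (\<lambda>x. z * f x) (\<lambda>x. z * f' x)" if "has_partial b f f'" for z b and f f' :: "'a \<Rightarrow> complex"
      by (rule has_partial_linear[OF bounded_linear_mult_right that])
    have cL2_cmul: "cL2 (\<lambda>x. z * f x)" if "cL2 f" for z f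
      using cL2_bounded_mult[of "\<lambda>x. z" "cmod z"] that by simp
    \<comment> \<open>The cutoff depends on the coordinate along \<open>b0\<close> only, so among
      the basis vectors only \<open>b0\<close> contributes to the commutator.\<close>
    have sumb0: "(\<Sum>b\<in>Basis. of_real (\<kappa> b) * (of_real (b \<bullet> b0) * w b)) = of_real (\<kappa> b0) * w b0" for w :: "'a \<Rightarrow> complex"
      using b0 by (subst sum.remove[of _ b0]) (auto simp: inner_Basis intro!: sum.neutral)
    \<comment> \<open>Applied to \<open>si t x * F x\<close>, the operator gives
      \<open>- c * (si t x * F x)\<close> plus \<open>\<kappa> b0 * t\<close> times the difference
      of \<open>2 * (co t x * H x)\<close> and \<open>t * (si t x * F x)\<close>. Paired with
      \<open>H\<close>, which solves the same equation, the terms with the real number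
      \<open>c\<close> cancel by symmetry, and \<open>\<kappa> b0 * t\<close> can be divided
      out.\<close>
    have virial: "2 * (\<integral>x. co t x * (H x * cnj (H x)) \<partial>lborel) = of_real t * (\<integral>x. si t x * F x * cnj (H x) \<partial>lborel)"
      if t: "t \<noteq> 0" for t
    proof -
      define U1 where "U1 b x = si t x * F1 b x + of_real (t * (b \<bullet> b0)) * (co t x * F x)" for b x
      define U2 where "U2 b x = (si t x * F2 b x + of_real (t * (b \<bullet> b0)) * (co t x * F1 b x))
        + of_real (t * (b \<bullet> b0)) * (co t x * F1 b x + of_real (- t * (b \<bullet> b0)) * (si t x * F x))" for b x
      have U1: "has_partial b (\<lambda>x. si t x * F x) (U1 b)" if "b \<in> Basis" for b
        using mult[OF si' F1(1)[OF that], of t] unfolding U1_def[abs_def] by (simp add: mult.assoc)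
      have U2: "has_partial b (U1 b) (U2 b)" if "b \<in> Basis" for b
        using has_partial_add[OF mult[OF si' F2(1)[OF that], of t] cmul[OF mult[OF co' F1(1)[OF that], of t], of "of_real (t * (b \<bullet> b0))"]]
        unfolding U1_def[abs_def] U2_def[abs_def] by (simp add: mult.assoc)
      have cU: "cL2 (\<lambda>x. si t x * F x)" "\<And>b. b \<in> Basis \<Longrightarrow> cL2 (U1 b)" "\<And>b. b \<in> Basis \<Longrightarrow> cL2 (U2 b)"
        unfolding U1_def[abs_def] U2_def[abs_def]
        by (intro cL2_add cL2_cmul cL2_bounded_mult[OF si] cL2_bounded_mult[OF co] F F1 F2; assumption)+
      have Usum: "(\<Sum>b\<in>Basis. of_real (\<kappa> b) * U2 b x) =
          - c * (si t x * F x) + of_real (\<kappa> b0 * t) * (2 * (co t x * H x) - of_real t * (si t x * F x))" for x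
      proof -
        have "(\<Sum>b\<in>Basis. of_real (\<kappa> b) * U2 b x) = si t x * (\<Sum>b\<in>Basis. of_real (\<kappa> b) * F2 b x)
          + (\<Sum>b\<in>Basis. of_real (\<kappa> b) * (of_real (b \<bullet> b0) *
              (of_real t * (2 * (co t x * F1 b x) + of_real (- t * (b \<bullet> b0)) * (si t x * F x)))))"
          unfolding U2_def sum_distrib_left sum.distrib[symmetric] by (intro sum.cong refl) (simp add: algebra_simps)
        then show ?thesis
          unfolding sumb0 eqF using b0 by (simp add: H_def algebra_simps)
      qed
      have "(\<integral>x. (\<Sum>b\<in>Basis. of_real (\<kappa> b) * U2 b x) * cnj (H x) \<partial>lborel) =
          (\<integral>x. (si t x * F x) * cnj (\<Sum>b\<in>Basis. of_real (\<kappa> b) * H2 b x) \<partial>lborel)"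
        by (rule second_order_symmetric[where ?U1.0 = U1 and ?V1.0 = H1])
          (assumption | rule U1 U2 cU H1[folded H_def] H2 H)+
      then have eq: "(\<integral>x. - c * (si t x * F x * cnj (H x)) + of_real (\<kappa> b0 * t) *
            (2 * (co t x * (H x * cnj (H x))) - of_real t * (si t x * F x * cnj (H x))) \<partial>lborel)
          = (\<integral>x. - c * (si t x * F x * cnj (H x)) \<partial>lborel)"
        unfolding Usum eqH H_def[symmetric] by (simp add: c algebra_simps)
      have i1: "integrable lborel (\<lambda>x. si t x * F x * cnj (H x))"
        using cL2_mult_integrable[OF cU(1) H] .
      have i2: "integrable lborel (\<lambda>x. co t x * (H x * cnj (H x)))"
        using cL2_mult_integrable[OF cL2_bounded_mult[OF co H] H] by (simp add: mult.assoc)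
      show ?thesis
        using eq i1 i2 t b0 by (simp del: mult_minus_left)
    qed
    have "(\<integral>x. H x * cnj (H x) \<partial>lborel) = 0"
    proof -
      \<comment> \<open>A bound for the right-hand integral that is independent of \<open>t\<close>,
        so the right side of \<open>virial\<close> is of order \<open>t\<close>.\<close>
      define M where "M = (\<integral>x. cmod (F x * cnj (H x)) \<partial>lborel)"
      have iFH: "integrable lborel (\<lambda>x. F x * cnj (H x))"
        by (rule cL2_mult_integrable[OF F H])
      have bound: "cmod (\<integral>x. si t x * F x * cnj (H x) \<partial>lborel) \<le> M" for t
        unfolding M_def
      proof (rule Bochner_Integration.integral_norm_bound_integral)
        show "integrable lborel (\<lambda>x. si t x * F x * cnj (H x))"
          using cL2_mult_integrable[OF cL2_bounded_mult[OF si F] H] .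
        show "cmod (si t x * F x * cnj (H x)) \<le> cmod (F x * cnj (H x))" for x
          unfolding mult.assoc norm_mult[of "si t x"] by (intro mult_left_le_one_le si) auto
      qed (use iFH in simp)
      have "(\<lambda>n. of_real (inverse (real (Suc n))) * (\<integral>x. si (inverse (real (Suc n))) x * F x * cnj (H x) \<partial>lborel)) \<longlonglongrightarrow> 0"
      proof (rule Lim_null_comparison)
        show "(\<lambda>n. inverse (real (Suc n)) * M) \<longlonglongrightarrow> 0"
          by (intro tendsto_mult_left_zero LIMSEQ_inverse_real_of_nat)
        show "\<forall>\<^sub>F n in sequentially. norm (of_real (inverse (real (Suc n))) *
            (\<integral>x. si (inverse (real (Suc n))) x * F x * cnj (H x) \<partial>lborel)) \<le> inverse (real (Suc n)) * M"
          unfolding norm_mult norm_of_real by (intro always_eventually allI mult_mono bound) auto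
      qed
      moreover have "2 * (\<integral>x. co (inverse (real (Suc n))) x * (H x * cnj (H x)) \<partial>lborel) =
          of_real (inverse (real (Suc n))) * (\<integral>x. si (inverse (real (Suc n))) x * F x * cnj (H x) \<partial>lborel)" for n
        by (rule virial) simp
      ultimately have "(\<lambda>n. 2 * (\<integral>x. co (inverse (real (Suc n))) x * (H x * cnj (H x)) \<partial>lborel)) \<longlonglongrightarrow> 0"
        by (simp only:)
      moreover have "(\<lambda>n. 2 * (\<integral>x. co (inverse (real (Suc n))) x * (H x * cnj (H x)) \<partial>lborel))
          \<longlonglongrightarrow> 2 * (\<integral>x. H x * cnj (H x) \<partial>lborel)"
        unfolding co_def by (intro tendsto_intros tendsto_integral_cos cL2_mult_integrable H)
      ultimately have "2 * (\<integral>x. H x * cnj (H x) \<partial>lborel) = 0"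
        by (rule LIMSEQ_unique[rotated])
      then show ?thesis
        by (simp only: mult_eq_0_iff) simp
    qed
    then have H0: "H x = 0" for x
      by (rule cL2_eq_0[OF H])
    \<comment> \<open>As \<open>H\<close> vanishes, the derivative of \<open>si t x * F x\<close>
      along \<open>b0\<close> is \<open>t * (co t x * F x)\<close>. Integrating it against
      \<open>F\<close> moves the derivative onto \<open>F\<close>, where it gives 0.\<close>
    have "(\<integral>x. co t x * (F x * cnj (F x)) \<partial>lborel) = 0" if t: "t \<noteq> 0" for t
    proof -
      have FH: "has_partial b0 F H"
        using F1 b0 by (simp add: H_def)
      have "has_partial b0 (\<lambda>x. si t x * F x) (\<lambda>x. of_real t * (co t x * F x))"
        using mult[OF si'[of b0 t] FH] b0 by (simp add: H0 mult.assoc)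
      from integral_by_parts[OF this FH]
      have "(\<integral>x. of_real t * (co t x * F x) * cnj (F x) \<partial>lborel) = - (\<integral>x. si t x * F x * cnj (H x) \<partial>lborel)"
        by (simp add: cL2_cmul cL2_bounded_mult[OF si] cL2_bounded_mult[OF co] F H)
      then show ?thesis
        using t by (simp add: H0 mult.assoc)
    qed
    then have "(\<lambda>n. \<integral>x. co (inverse (real (Suc n))) x * (F x * cnj (F x)) \<partial>lborel) \<longlonglongrightarrow> 0"
      by simp
    moreover have "(\<lambda>n. \<integral>x. co (inverse (real (Suc n))) x * (F x * cnj (F x)) \<partial>lborel)
        \<longlonglongrightarrow> (\<integral>x. F x * cnj (F x) \<partial>lborel)"
      unfolding co_def by (intro tendsto_integral_cos cL2_mult_integrable F)
    ultimately have "(\<integral>x. F x * cnj (F x) \<partial>lborel) = 0"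
      by (rule LIMSEQ_unique[rotated])
    then show ?thesis
      by (rule cL2_eq_0[OF F])
  qed
qed

section \<open>Correlations of a square-integrable function with test functions\<close>

lemma cmod_herm_le_mult: "cmod (herm u v) \<le> CARD('s) * (norm u * norm (v :: complex^'s))"
proof -
  have "cmod (herm u v) \<le> (\<Sum>a\<in>(UNIV::'s set). norm u * norm v)"
    unfolding herm_def
    by (intro order_trans[OF norm_sum] sum_mono)
      (auto simp: norm_mult intro!: mult_mono Finite_Cartesian_Product.norm_nth_le)
  then show ?thesis
    by simp
qed

lemma herm_scaleR_left: "herm (r *\<^sub>R u) v = of_real r * herm u v"
  by (simp add: herm_def sum_distrib_left scaleR_conv_of_real[where 'a = complex] mult.assoc)

lemma herm_minus_left: "herm (- u) v = - herm u v"
  by (simp add: herm_def sum_negf)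

lemma herm_diff_left: "herm (u - w) v = herm u v - herm w v"
  by (simp add: herm_def sum_subtractf algebra_simps)

lemma herm_zero_left: "herm 0 v = 0"
  by (simp add: herm_def)

lemma herm_sum_left: "herm (\<Sum>i\<in>I. f i) v = (\<Sum>i\<in>I. herm (f i) v)"
  by (induction I rule: infinite_finite_induct) (simp_all add: herm_add_left herm_zero_left)

lemma tendsto_herm_left: "(f \<longlongrightarrow> u) F \<Longrightarrow> ((\<lambda>x. herm (f x) v) \<longlongrightarrow> herm u v) F"
  unfolding herm_def by (intro tendsto_intros) auto

lemma test_functions_bounded:
  assumes "f \<in> test_functions"
  obtains M where "0 \<le> M" "\<And>x. norm (f x) \<le> M"
proof -
  have "compact (f ` closure {x. f x \<noteq> 0})"
    using assms test_functions_continuous[OF assms]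
    by (intro compact_continuous_image) (auto simp: test_functions_def intro: continuous_on_subset)
  then obtain M where M: "M > 0" "\<And>y. y \<in> f ` closure {x. f x \<noteq> 0} \<Longrightarrow> norm y \<le> M"
    using compact_imp_bounded bounded_pos by metis
  have "norm (f x) \<le> M" for x
    using M closure_subset[of "{x. f x \<noteq> 0}"] by (cases "f x = 0") auto
  then show ?thesis
    using that[of M] M(1) by simp
qed

lemma test_functions_support:
  assumes "f \<in> test_functions"
  obtains r where "0 < r" "\<And>x. r < norm x \<Longrightarrow> f x = 0"
proof -
  obtain r where "r > 0" "\<forall>x\<in>{x. f x \<noteq> 0}. norm x \<le> r"
    using assms unfolding test_functions_iff bounded_pos by blast
  with that[of r] show ?thesis
    by (metis mem_Collect_eq not_le)
qed

text \<open>The remainder is uniform in \<open>z\<close>, so it can be integrated against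
  \<open>g\<close> in the difference quotient of a correlation.\<close>

lemma test_functions_taylor:
  assumes f: "f \<in> test_functions" and b: "b \<in> Basis"
  obtains M where "0 \<le> M" "\<And>z t. norm (f (z + t *\<^sub>R b) - f z - t *\<^sub>R partial_deriv b f z) \<le> M * t\<^sup>2"
proof -
  note f1 = test_functions_partial_deriv[OF f b]
  obtain M where M: "0 \<le> M" "\<And>x. norm (partial_deriv b (partial_deriv b f) x) \<le> M"
    using test_functions_bounded[OF test_functions_partial_deriv[OF f1 b]] by metis
  have "norm (f (z + t *\<^sub>R b) - f z - t *\<^sub>R partial_deriv b f z) \<le> M * t\<^sup>2" for z t
  proof -
    define k where "k s = f (z + s *\<^sub>R b) - s *\<^sub>R partial_deriv b f z" for s
    have k: "(k has_vector_derivative partial_deriv b f (z + s *\<^sub>R b) - partial_deriv b f z) (at s within S)" for s S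
      unfolding k_def
      by (intro has_vector_derivative_diff has_partial_line test_functions_has_partial f)
        (auto intro!: derivative_eq_intros)
    have lip: "norm (partial_deriv b f (z + s *\<^sub>R b) - partial_deriv b f (z + 0 *\<^sub>R b)) \<le> M * \<bar>s - 0\<bar>" for s
      by (rule vector_differentiable_bound[where S = UNIV and f = "\<lambda>s. partial_deriv b f (z + s *\<^sub>R b)"])
        (use M in \<open>auto intro!: has_partial_line test_functions_has_partial f1\<close>)
    have "norm (k t - k 0) \<le> M * \<bar>t\<bar> * \<bar>t - 0\<bar>"
    proof (rule vector_differentiable_bound[OF k, where S = "{- \<bar>t\<bar>..\<bar>t\<bar>}"])
      fix s assume "s \<in> {- \<bar>t\<bar>..\<bar>t\<bar>}"
      then have "M * \<bar>s\<bar> \<le> M * \<bar>t\<bar>"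
        using M by (intro mult_left_mono) auto
      then show "norm (partial_deriv b f (z + s *\<^sub>R b) - partial_deriv b f z) \<le> M * \<bar>t\<bar>"
        using lip[of s] by simp
    qed auto
    then show ?thesis
      by (simp add: k_def power2_eq_square mult.assoc abs_mult_self_eq algebra_simps)
  qed
  with M that show ?thesis
    by blast
qed

lemma square_integrable_translate:
  assumes "square_integrable f"
  shows "square_integrable (\<lambda>y. f (y - x))"
proof -
  have m: "f \<in> borel_measurable borel" and i: "integrable lborel (\<lambda>y. (norm (f y))\<^sup>2)"
    using assms by (auto simp: square_integrable_def)
  have "integrable lborel (\<lambda>y. (norm (f (y + - x)))\<^sup>2)"
    using integrable_lborel_translate[of "\<lambda>y. (norm (f y))\<^sup>2" "- x"] m i by simp
  then show ?thesis
    using m by (auto simp: square_integrable_def intro!: measurable_compose[OF _ m])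
qed

lemma square_integrable_imp_locally_integrable:
  assumes "square_integrable g"
  shows "integrable lborel (\<lambda>y. indicator (cball 0 r) y * norm (g y))"
proof (rule Bochner_Integration.integrable_bound)
  show "integrable lborel (\<lambda>y. indicator (cball 0 r) y + (norm (g y))\<^sup>2)"
    using assms by (auto simp: square_integrable_def intro!: Bochner_Integration.integrable_add integrable_real_indicator
        emeasure_bounded_finite)
  have "norm (g y) \<le> 1 + (norm (g y))\<^sup>2" for y
  proof -
    have "2 * norm (g y) \<le> (norm (g y))\<^sup>2 + 1"
      using sum_squares_bound[of "norm (g y)" 1] by simp
    then show ?thesis
      using norm_ge_zero[of "g y"] by linarith
  qed
  then show "AE y in lborel. norm (indicator (cball 0 r) y * norm (g y))
      \<le> norm (indicator (cball 0 r) y + (norm (g y))\<^sup>2)"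
    by (intro AE_I2) (auto simp: indicator_def)
qed (use assms in \<open>auto simp: square_integrable_def intro!: borel_measurable_times borel_measurable_norm borel_measurable_indicator\<close>)

text \<open>The inequality for the real inner product controls only a real part. Multiplying
  \<open>f\<close> by \<open>cnj z\<close>, where \<open>z\<close> is the complex pairing, makes the
  pairing equal to the real number |z|^2.\<close>

lemma L2_Cauchy_Schwarz:
  assumes f: "square_integrable f" and g: "square_integrable g"
  shows "(cmod (\<integral>x. herm (f x) (g x) \<partial>lborel))\<^sup>2
      \<le> (\<integral>x. (norm (f x))\<^sup>2 \<partial>lborel) * (\<integral>x. (norm (g x))\<^sup>2 \<partial>lborel)"
proof -
  define z where "z = (\<integral>x. herm (f x) (g x) \<partial>lborel)"
  have z: "L2_cinner (L2_class f) (L2_class g) = z"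
    using assms by (simp add: z_def L2_cinner.abs_eq L2_rel_refl)
  have nf: "(norm (L2_class (\<lambda>x. cnj z *s f x)))\<^sup>2 = (cmod z)\<^sup>2 * (norm (L2_class f))\<^sup>2"
    using f by (simp add: norm_L2_class square_integrable_scale norm_scalar_mult power_mult_distrib)
  have "inner (L2_class (\<lambda>x. cnj z *s f x)) (L2_class g) = Re (cnj z * z)"
    using f g by (simp add: inner_L2_def L2_cinner.abs_eq L2_rel_refl square_integrable_scale herm_scale_left z_def)
  also have "\<dots> = (cmod z)\<^sup>2"
    by (simp add: cmod_def power2_eq_square)
  finally have "(cmod z)\<^sup>2 \<le> norm (L2_class (\<lambda>x. cnj z *s f x)) * norm (L2_class g)"
    using norm_cauchy_schwarz[of "L2_class (\<lambda>x. cnj z *s f x)" "L2_class g"] by simp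
  then have "((cmod z)\<^sup>2)\<^sup>2 \<le> (norm (L2_class (\<lambda>x. cnj z *s f x)) * norm (L2_class g))\<^sup>2"
    by (rule power_mono) simp
  then have "((cmod z)\<^sup>2)\<^sup>2 \<le> (cmod z)\<^sup>2 * (norm (L2_class f))\<^sup>2 * (norm (L2_class g))\<^sup>2"
    unfolding power_mult_distrib nf .
  then have "(cmod z)\<^sup>2 * (cmod z)\<^sup>2 \<le> (cmod z)\<^sup>2 * ((norm (L2_class f))\<^sup>2 * (norm (L2_class g))\<^sup>2)"
    by (simp add: power2_eq_square mult_ac)
  then have "(cmod z)\<^sup>2 \<le> (norm (L2_class f))\<^sup>2 * (norm (L2_class g))\<^sup>2"
  proof (cases "z = 0")
    case False
    then have "0 < (cmod z)\<^sup>2"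
      by simp
    with \<open>(cmod z)\<^sup>2 * (cmod z)\<^sup>2 \<le> _\<close> show ?thesis
      by (rule mult_left_le_imp_le)
  qed simp
  then show ?thesis
    using f g by (simp add: norm_L2_class z_def)
qed

text \<open>Up to reflection and conjugation this is a convolution of \<open>g\<close> with
  \<open>f\<close>. Translating in \<open>x\<close> translates the test function, so derivatives
  fall on \<open>f\<close> with a minus sign, and the value at 0 is the L2 pairing of
  \<open>f\<close> with \<open>g\<close>.\<close>

definition correlation ::
    "('a::euclidean_space \<Rightarrow> complex^'s) \<Rightarrow> ('a \<Rightarrow> complex^'s) \<Rightarrow> 'a \<Rightarrow> complex" where
  "correlation g f x = (\<integral>y. herm (f (y - x)) (g y) \<partial>lborel)"

context
  fixes g :: "'a::euclidean_space \<Rightarrow> complex^'s"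
  assumes g: "square_integrable g"
begin

lemma correlation_integrable:
  "f \<in> test_functions \<Longrightarrow> integrable lborel (\<lambda>y. herm (f (y - x)) (g y))"
  by (rule integrable_herm[OF square_integrable_translate[OF test_functions_square_integrable] g])

lemma correlation_add:
  assumes "f \<in> test_functions" "h \<in> test_functions"
  shows "correlation g (\<lambda>y. f y + h y) x = correlation g f x + correlation g h x"
  using assms by (simp add: correlation_def herm_add_left correlation_integrable)

lemma correlation_scale: "correlation g (\<lambda>y. c *s f y) x = c * correlation g f x"
  by (simp add: correlation_def herm_scale_left)

lemma correlation_scaleR: "correlation g (\<lambda>y. r *\<^sub>R f y) x = of_real r * correlation g f x"
  by (simp add: correlation_def herm_scaleR_left)

lemma correlation_sum:
  assumes "\<And>i. i \<in> I \<Longrightarrow> f i \<in> test_functions"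
  shows "correlation g (\<lambda>y. \<Sum>i\<in>I. f i y) x = (\<Sum>i\<in>I. correlation g (f i) x)"
  using assms by (simp add: correlation_def herm_sum_left correlation_integrable)

lemma correlation_continuous:
  assumes f: "f \<in> test_functions"
  shows "continuous_on UNIV (correlation g f)"
  unfolding continuous_on_sequentially
proof safe
  fix X :: "nat \<Rightarrow> 'a" and a
  assume X: "X \<longlonglongrightarrow> a"
  obtain M where M: "0 \<le> M" "\<And>x. norm (f x) \<le> M"
    using test_functions_bounded[OF f] by metis
  obtain r where r: "0 < r" "\<And>x. r < norm x \<Longrightarrow> f x = 0"
    using test_functions_support[OF f] by metis
  \<comment> \<open>The base points stay in a ball of radius \<open>R\<close>, so all translates of
    \<open>f\<close> are supported in one ball of radius \<open>r + R\<close>, on which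
    \<open>norm (g y)\<close> is integrable.\<close>
  obtain R where R: "R > 0" "\<And>n. norm (X n) \<le> R"
    using convergent_imp_Bseq[OF convergentI[OF X]] unfolding Bseq_def by blast
  have "(\<lambda>n. \<integral>y. herm (f (y - X n)) (g y) \<partial>lborel) \<longlonglongrightarrow> (\<integral>y. herm (f (y - a)) (g y) \<partial>lborel)"
  proof (rule integral_dominated_convergence)
    show "integrable lborel (\<lambda>y. CARD('s) * (M * (indicator (cball 0 (r + R)) y * norm (g y))))"
      by (intro integrable_mult_right square_integrable_imp_locally_integrable g)
    show "AE y in lborel. (\<lambda>n. herm (f (y - X n)) (g y)) \<longlonglongrightarrow> herm (f (y - a)) (g y)"
    proof (intro AE_I2 tendsto_herm_left)
      fix y
      have "(\<lambda>n. y - X n) \<longlonglongrightarrow> y - a"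
        by (intro tendsto_intros X)
      then show "(\<lambda>n. f (y - X n)) \<longlonglongrightarrow> f (y - a)"
        using test_functions_continuous[OF f]
        by (intro isCont_tendsto_compose[of "y - a" f]) (auto simp: continuous_on_eq_continuous_at)
    qed
    show "AE y in lborel. norm (herm (f (y - X n)) (g y))
        \<le> CARD('s) * (M * (indicator (cball 0 (r + R)) y * norm (g y)))" for n
    proof (intro AE_I2)
      fix y
      have "norm (f (y - X n)) \<le> M * indicator (cball 0 (r + R)) y"
      proof (cases "norm y \<le> r + R")
        case False
        then have "r < norm (y - X n)"
          using R(2)[of n] norm_triangle_ineq2[of y "X n"] by linarith
        then show ?thesis
          using r M by simp
      qed (use M in \<open>simp add: indicator_def\<close>)
      then have "norm (f (y - X n)) * norm (g y) \<le> M * indicator (cball 0 (r + R)) y * norm (g y)"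
        by (rule mult_right_mono) simp
      then show "norm (herm (f (y - X n)) (g y)) \<le> CARD('s) * (M * (indicator (cball 0 (r + R)) y * norm (g y)))"
        by (intro order_trans[OF cmod_herm_le_mult] mult_left_mono) (auto simp: mult.assoc)
    qed
  qed (use correlation_integrable[OF f] in \<open>auto dest: borel_measurable_integrable\<close>)
  then show "(correlation g f \<circ> X) \<longlonglongrightarrow> correlation g f a"
    by (simp add: correlation_def o_def)
qed

lemma correlation_has_partial:
  assumes f: "f \<in> test_functions" and b: "b \<in> Basis"
  shows "has_partial b (correlation g f) (\<lambda>x. - correlation g (partial_deriv b f) x)"
  unfolding has_partial_def
proof
  fix x :: 'a
  note f1 = test_functions_partial_deriv[OF f b]
  obtain M where M: "0 \<le> M" "\<And>z t. norm (f (z + t *\<^sub>R b) - f z - t *\<^sub>R partial_deriv b f z) \<le> M * t\<^sup>2"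
    using test_functions_taylor[OF f b] by metis
  obtain r where r: "0 < r" "\<And>x. r < norm x \<Longrightarrow> f x = 0"
    using test_functions_support[OF f] by metis
  obtain r' where r': "0 < r'" "\<And>x. r' < norm x \<Longrightarrow> partial_deriv b f x = 0"
    using test_functions_support[OF f1] by metis
  \<comment> \<open>A ball of this radius contains the supports of all functions that occur in the
    difference quotient; the summand 1 pays for the shift by \<open>t *\<^sub>R b\<close> with
    \<open>\<bar>t\<bar> \<le> 1\<close>.\<close>
  define \<rho> where "\<rho> = r + r' + norm x + 1"
  define C where "C = CARD('s) * (M * (\<integral>y. indicator (cball 0 \<rho>) y * norm (g y) \<partial>lborel))"
  have C: "C \<ge> 0"
    using M by (auto simp: C_def intro!: mult_nonneg_nonneg Bochner_Integration.integral_nonneg)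
  have est: "norm (correlation g f (x + t *\<^sub>R b) - correlation g f x - t *\<^sub>R (- correlation g (partial_deriv b f) x))
      \<le> C * t\<^sup>2" if t: "\<bar>t\<bar> \<le> 1" for t
  proof -
    \<comment> \<open>Moving \<open>x\<close> by \<open>t *\<^sub>R b\<close> moves the argument of
      \<open>f\<close> by the opposite vector, so this is the Taylor remainder with parameter
      \<open>- t\<close>.\<close>
    define k where "k y = f (y - (x + t *\<^sub>R b)) - f (y - x) - (- t) *\<^sub>R partial_deriv b f (y - x)" for y
    have "correlation g f (x + t *\<^sub>R b) - correlation g f x - t *\<^sub>R (- correlation g (partial_deriv b f) x)
        = (\<integral>y. herm (k y) (g y) \<partial>lborel)"
      using f f1 correlation_integrable unfolding k_def correlation_def
      by (simp add: herm_diff_left herm_add_left herm_minus_left herm_scaleR_left scaleR_conv_of_real[where 'a = complex])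
    also have "norm \<dots> \<le> (\<integral>y. CARD('s) * (M * t\<^sup>2 * (indicator (cball 0 \<rho>) y * norm (g y))) \<partial>lborel)"
    proof (rule Bochner_Integration.integral_norm_bound_integral)
      show "integrable lborel (\<lambda>y. herm (k y) (g y))"
        unfolding k_def
        using f f1 correlation_integrable
        by (simp add: herm_diff_left herm_add_left herm_minus_left herm_scaleR_left)
      show "integrable lborel (\<lambda>y. CARD('s) * (M * t\<^sup>2 * (indicator (cball 0 \<rho>) y * norm (g y))))"
        by (intro integrable_mult_right square_integrable_imp_locally_integrable g)
      fix y
      have "norm (k y) \<le> M * t\<^sup>2 * indicator (cball 0 \<rho>) y"
      proof (cases "norm y \<le> \<rho>")
        case True
        then show ?thesis
          using M(2)[of "y - x" "- t"] by (simp add: k_def diff_diff_eq)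
      next
        case False
        have "norm (t *\<^sub>R b) \<le> 1"
          using t b by simp
        then have "r < norm (y - (x + t *\<^sub>R b))" "r < norm (y - x)" "r' < norm (y - x)"
          using False r r' norm_triangle_ineq2[of y x] norm_triangle_ineq2[of y "x + t *\<^sub>R b"]
            norm_triangle_ineq[of x "t *\<^sub>R b"] unfolding \<rho>_def by linarith+
        then show ?thesis
          using r r' M by (simp add: k_def)
      qed
      then have "norm (k y) * norm (g y) \<le> M * t\<^sup>2 * indicator (cball 0 \<rho>) y * norm (g y)"
        by (rule mult_right_mono) simp
      then show "norm (herm (k y) (g y)) \<le> CARD('s) * (M * t\<^sup>2 * (indicator (cball 0 \<rho>) y * norm (g y)))"
        by (intro order_trans[OF cmod_herm_le_mult] mult_left_mono) (auto simp: mult.assoc)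
    qed
    also have "\<dots> = C * t\<^sup>2"
      by (simp add: C_def)
    finally show ?thesis .
  qed
  show "((\<lambda>t. correlation g f (x + t *\<^sub>R b)) has_vector_derivative - correlation g (partial_deriv b f) x) (at 0)"
    unfolding has_vector_derivative_def has_derivative_at_alt
  proof (intro conjI allI impI)
    show "bounded_linear (\<lambda>t. t *\<^sub>R - correlation g (partial_deriv b f) x)"
      by (rule bounded_linear_scaleR_left)
    fix e :: real
    assume e: "e > 0"
    show "\<exists>d>0. \<forall>t. norm (t - 0) < d \<longrightarrow>
        norm (correlation g f (x + t *\<^sub>R b) - correlation g f (x + 0 *\<^sub>R b) - (t - 0) *\<^sub>R - correlation g (partial_deriv b f) x)
        \<le> e * norm (t - 0)"
    proof (intro exI[of _ "min 1 (e / (C + 1))"] conjI allI impI)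
      show "0 < min 1 (e / (C + 1))"
        using e C by simp
      fix t :: real
      assume t: "norm (t - 0) < min 1 (e / (C + 1))"
      have "C * \<bar>t\<bar> \<le> (C + 1) * \<bar>t\<bar>"
        by (simp add: mult_right_mono)
      also have "\<dots> \<le> e"
        using t C by (simp add: pos_less_divide_eq mult.commute)
      finally have "C * \<bar>t\<bar> * \<bar>t\<bar> \<le> e * \<bar>t\<bar>"
        by (rule mult_right_mono) simp
      then have "C * t\<^sup>2 \<le> e * \<bar>t\<bar>"
        by (simp add: power2_eq_square mult.assoc)
      then show "norm (correlation g f (x + t *\<^sub>R b) - correlation g f (x + 0 *\<^sub>R b) -
          (t - 0) *\<^sub>R - correlation g (partial_deriv b f) x) \<le> e * norm (t - 0)"
        using est[of t] t by simp
    qed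
  qed
qed

text \<open>At \<open>x\<close> only the values of \<open>g\<close> in the ball of radius
  \<open>r\<close> around \<open>x\<close> matter. By Cauchy-Schwarz the squared correlation is at
  most \<open>K\<close> times the integral of |g|^2 over that ball; integrated over
  \<open>x\<close>, Tonelli turns this into the volume of the ball times the squared norm of
  \<open>g\<close>.\<close>

lemma correlation_cL2:
  assumes f: "f \<in> test_functions"
  shows "cL2 (correlation g f)"
  unfolding cL2_def
proof
  show cont: "continuous_on UNIV (correlation g f)"
    by (rule correlation_continuous[OF f])
  have [measurable]: "g \<in> borel_measurable borel" "g \<in> borel_measurable lborel"
    using g by (simp_all add: square_integrable_def)
  obtain r where r: "0 < r" "\<And>x. r < norm x \<Longrightarrow> f x = 0"
    using test_functions_support[OF f] by metis
  define K where "K = (\<integral>x. (norm (f x))\<^sup>2 \<partial>lborel)"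
  have K: "K \<ge> 0"
    by (simp add: K_def)
  define P where "P x y = (if norm (y - x) \<le> r then ennreal ((norm (g y))\<^sup>2) else 0)" for x y :: 'a
  have [measurable]: "case_prod P \<in> borel_measurable (lborel \<Otimes>\<^sub>M lborel)"
    unfolding P_def by measurable
  have le: "ennreal ((cmod (correlation g f x))\<^sup>2) \<le> ennreal K * (\<integral>\<^sup>+y. P x y \<partial>lborel)" for x
  proof -
    define h where "h y = (if norm (y - x) \<le> r then g y else 0)" for y
    have Ph: "P x y = ennreal ((norm (h y))\<^sup>2)" for y
      by (simp add: P_def h_def)
    have h: "square_integrable h"
      unfolding square_integrable_def
    proof
      show [measurable]: "h \<in> borel_measurable lborel"
        unfolding h_def by measurable
      show "integrable lborel (\<lambda>y. (norm (h y))\<^sup>2)"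
        by (rule Bochner_Integration.integrable_bound[of _ "\<lambda>y. (norm (g y))\<^sup>2"])
          (use g in \<open>auto simp: square_integrable_def h_def\<close>)
    qed
    have "correlation g f x = (\<integral>y. herm (f (y - x)) (h y) \<partial>lborel)"
      unfolding correlation_def
    proof (intro Bochner_Integration.integral_cong refl)
      fix y
      show "herm (f (y - x)) (g y) = herm (f (y - x)) (h y)"
        using r(2)[of "y - x"] by (cases "norm (y - x) \<le> r") (auto simp: h_def herm_def)
    qed
    then have "(cmod (correlation g f x))\<^sup>2 \<le> (\<integral>y. (norm (f (y - x)))\<^sup>2 \<partial>lborel) * (\<integral>y. (norm (h y))\<^sup>2 \<partial>lborel)"
      using L2_Cauchy_Schwarz[OF square_integrable_translate[OF test_functions_square_integrable[OF f]] h] by simp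
    also have "(\<integral>y. (norm (f (y - x)))\<^sup>2 \<partial>lborel) = K"
    proof -
      have "f \<in> borel_measurable borel"
        using test_functions_square_integrable[OF f] by (simp add: square_integrable_def)
      then have "(\<lambda>y. (norm (f y))\<^sup>2) \<in> borel_measurable borel"
        by measurable
      from integral_lborel_translate[OF this, of "- x"] show ?thesis
        by (simp add: K_def)
    qed
    finally have "ennreal ((cmod (correlation g f x))\<^sup>2) \<le> ennreal (K * (\<integral>y. (norm (h y))\<^sup>2 \<partial>lborel))"
      by (rule ennreal_leI)
    also have "\<dots> = ennreal K * (\<integral>\<^sup>+y. ennreal ((norm (h y))\<^sup>2) \<partial>lborel)"
      using h K by (subst nn_integral_eq_integral) (auto simp: square_integrable_def ennreal_mult)
    finally show ?thesis
      by (simp add: Ph)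
  qed
  have "(\<integral>\<^sup>+x. (\<integral>\<^sup>+y. P x y \<partial>lborel) \<partial>lborel) = (\<integral>\<^sup>+y. (\<integral>\<^sup>+x. P x y \<partial>lborel) \<partial>lborel)"
    using lborel_pair.Fubini'[of P] by simp
  also have "\<dots> = (\<integral>\<^sup>+y. ennreal (unit_ball_vol (DIM('a)) * r ^ DIM('a)) * ennreal ((norm (g y))\<^sup>2) \<partial>lborel)"
  proof (intro nn_integral_cong)
    fix y
    have "P x y = ennreal ((norm (g y))\<^sup>2) * indicator (cball y r) x" for x
      by (auto simp: P_def indicator_def dist_norm norm_minus_commute)
    then have "(\<integral>\<^sup>+x. P x y \<partial>lborel) = ennreal ((norm (g y))\<^sup>2) * emeasure lborel (cball y r)"
      by (simp add: nn_integral_cmult_indicator)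
    then show "(\<integral>\<^sup>+x. P x y \<partial>lborel) = ennreal (unit_ball_vol (DIM('a)) * r ^ DIM('a)) * ennreal ((norm (g y))\<^sup>2)"
      using r by (simp add: emeasure_cball mult.commute)
  qed
  also have "\<dots> = ennreal (unit_ball_vol (DIM('a)) * r ^ DIM('a)) * (\<integral>\<^sup>+y. ennreal ((norm (g y))\<^sup>2) \<partial>lborel)"
    by (rule nn_integral_cmult) measurable
  also have "(\<integral>\<^sup>+y. ennreal ((norm (g y))\<^sup>2) \<partial>lborel) = ennreal (\<integral>y. (norm (g y))\<^sup>2 \<partial>lborel)"
    using g by (intro nn_integral_eq_integral) (auto simp: square_integrable_def)
  finally have fin: "(\<integral>\<^sup>+x. (\<integral>\<^sup>+y. P x y \<partial>lborel) \<partial>lborel) < \<infinity>"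
    by (simp add: ennreal_mult_less_top)
  have "(\<integral>\<^sup>+x. ennreal ((cmod (correlation g f x))\<^sup>2) \<partial>lborel) \<le> (\<integral>\<^sup>+x. ennreal K * (\<integral>\<^sup>+y. P x y \<partial>lborel) \<partial>lborel)"
    by (intro nn_integral_mono le)
  also have "\<dots> = ennreal K * (\<integral>\<^sup>+x. (\<integral>\<^sup>+y. P x y \<partial>lborel) \<partial>lborel)"
    by (rule nn_integral_cmult) measurable
  also have "\<dots> < \<infinity>"
    using fin by (simp add: ennreal_mult_less_top)
  finally have "(\<integral>\<^sup>+x. ennreal ((cmod (correlation g f x))\<^sup>2) \<partial>lborel) < \<infinity>" .
  moreover have "continuous_on UNIV (\<lambda>x. (cmod (correlation g f x))\<^sup>2)"
    by (intro continuous_intros cont)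
  then have "(\<lambda>x. (cmod (correlation g f x))\<^sup>2) \<in> borel_measurable lborel"
    by (simp add: borel_measurable_continuous_onI)
  ultimately show "integrable lborel (\<lambda>x. (cmod (correlation g f x))\<^sup>2)"
    by (intro integrableI_bounded) auto
qed

end

section \<open>Density of the test functions\<close>

text \<open>Since \<open>h\<close> is integrable only on boxes, it is first cut down to a large box
  \<open>B n\<close>. The Borel sets over which the cut function integrates to 0 form a Dynkin
  system, and boxes are an intersection-stable generator because two boxes meet in a box.\<close>

lemma AE_eq_0_if_box_integrals_eq_0:
  fixes h :: "'a::euclidean_space \<Rightarrow> 'b::{banach, second_countable_topology}"
  assumes int: "\<And>l u. integrable lborel (\<lambda>x. indicator (box l u) x *\<^sub>R h x)"
    and zero: "\<And>l u. (\<integral>x. indicator (box l u) x *\<^sub>R h x \<partial>lborel) = 0"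
  shows "AE x in lborel. h x = 0"
proof -
  define B :: "nat \<Rightarrow> 'a set" where "B n = box (- (real n *\<^sub>R One)) (real n *\<^sub>R One)" for n
  have "AE x in lborel. indicator (B n) x *\<^sub>R h x = 0" for n
  proof (rule sigma_finite_measure.density_zero[OF sigma_finite_lborel])
    let ?h = "\<lambda>x. indicator (B n) x *\<^sub>R h x"
    show i: "integrable lborel ?h"
      unfolding B_def by (rule int)
    have iA: "integrable lborel (\<lambda>x. indicator A x *\<^sub>R ?h x)" if "A \<in> sets borel" for A
      using integrable_mult_indicator[OF _ i] that by simp
    fix A :: "'a set"
    assume "A \<in> sets lborel"
    then have A: "A \<in> sigma_sets UNIV (range (\<lambda>(a, b). box a b))"
      by (simp add: borel_eq_box)
    have "(\<integral>x. indicator A x *\<^sub>R ?h x \<partial>lborel) = 0"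
    proof (rule sigma_sets_induct_disjoint[OF _ _ A])
      show "Int_stable (range (\<lambda>(a, b). box a b :: 'a set))"
        by (auto simp: Int_stable_def box_Int_box)
      show "range (\<lambda>(a, b). box a b :: 'a set) \<subseteq> Pow UNIV"
        by simp
      show "(\<integral>x. indicator A x *\<^sub>R ?h x \<partial>lborel) = 0" if A_range: "A \<in> range (\<lambda>(a, b). box a b)" for A
      proof -
        obtain a b where A: "A = box a b"
          using A_range by auto
        have "\<exists>l u. A \<inter> B n = box l u"
          unfolding A B_def box_Int_box by blast
        then obtain l u where "A \<inter> B n = box l u"
          by blast
        then have "indicator A x *\<^sub>R ?h x = indicator (box l u) x *\<^sub>R h x" for x
          by (metis indicator_inter_arith scaleR_scaleR)
        then show ?thesis
          by (simp only: zero)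
      qed
      show "(\<integral>x. indicator {} x *\<^sub>R ?h x \<partial>lborel) = 0"
        by simp
      show "(\<integral>x. indicator (UNIV - A) x *\<^sub>R ?h x \<partial>lborel) = 0"
        if "A \<in> sigma_sets UNIV (range (\<lambda>(a, b). box a b))" and A0: "(\<integral>x. indicator A x *\<^sub>R ?h x \<partial>lborel) = 0" for A
      proof -
        have "A \<in> sets borel"
          using that by (simp add: borel_eq_box)
        moreover have "indicator (UNIV - A) x *\<^sub>R ?h x = ?h x - indicator A x *\<^sub>R ?h x" for x
          by (simp add: indicator_def)
        ultimately show ?thesis
          using A0 zero iA i by (simp add: B_def)
      qed
      show "(\<integral>x. indicator (\<Union>i. A i) x *\<^sub>R ?h x \<partial>lborel) = 0"
        if "disjoint_family A" "range A \<subseteq> sigma_sets UNIV (range (\<lambda>(a, b). box a b))"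
          and A0: "\<And>i. (\<integral>x. indicator (A i) x *\<^sub>R ?h x \<partial>lborel) = 0" for A :: "nat \<Rightarrow> 'a set"
      proof -
        have A: "A i \<in> sets borel" for i
          using that(2) unfolding borel_eq_box by (auto simp: sets_measure_of)
        have "(LINT x:(\<Union>i. A i)|lborel. ?h x) = (\<Sum>i. (LINT x:(A i)|lborel. ?h x))"
          by (rule lebesgue_integral_countable_add)
            (use A that iA in \<open>auto simp: disjoint_family_on_def set_integrable_def\<close>)
        then show ?thesis
          using A0 by (simp add: set_lebesgue_integral_def)
      qed
    qed
    then show "set_lebesgue_integral lborel A ?h = 0"
      by (simp add: set_lebesgue_integral_def)
  qed
  then have "AE x in lborel. \<forall>n. indicator (B n) x *\<^sub>R h x = 0"
    unfolding AE_all_countable ..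
  then show ?thesis
  proof (rule AE_mp, intro AE_I2 impI)
    fix x
    assume *: "\<forall>n. indicator (B n) x *\<^sub>R h x = 0"
    obtain n where "x \<in> B n"
      using UN_box_eq_UNIV unfolding B_def by blast
    then show "h x = 0"
      using *[rule_format, of n] by simp
  qed
qed

text \<open>Bumps times a coordinate vector approximate the indicator of a box in one component, so
  every component of \<open>g\<close>, conjugated, integrates to 0 over every box.\<close>

lemma AE_eq_0_if_orthogonal_test_functions:
  fixes g :: "'a::euclidean_space \<Rightarrow> complex^'s"
  assumes g: "square_integrable g"
    and orth: "\<And>f. f \<in> test_functions \<Longrightarrow> (\<integral>x. herm (f x) (g x) \<partial>lborel) = 0"
  shows "AE x in lborel. g x = 0"
proof -
  have "AE x in lborel. cnj (g x $ a) = 0" for a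
  proof (rule AE_eq_0_if_box_integrals_eq_0)
    fix l u :: 'a
    have herm_axis: "herm (r *\<^sub>R axis a 1) (g x) = r *\<^sub>R cnj (g x $ a)" for r x
    proof -
      have "herm (r *\<^sub>R axis a 1) (g x) = (\<Sum>c\<in>UNIV. if c = a then r *\<^sub>R cnj (g x $ a) else 0)"
        unfolding herm_def by (intro sum.cong refl) (auto simp: axis_def)
      then show ?thesis
        by simp
    qed
    obtain r where r: "box l u \<subseteq> cball 0 r"
      using bounded_subset_ballD[OF bounded_box[of l u], of 0] ball_subset_cball by blast
    have dom: "integrable lborel (\<lambda>x. indicator (cball 0 r) x * norm (g x))"
      by (rule square_integrable_imp_locally_integrable[OF g])
    have "g \<in> borel_measurable borel"
      using g by (simp add: square_integrable_def)
    then have meas [measurable]: "(\<lambda>x. cnj (g x $ a)) \<in> borel_measurable borel"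
      by (rule measurable_compose) (auto intro!: borel_measurable_continuous_onI continuous_intros)
    have le: "norm (s *\<^sub>R cnj (g x $ a)) \<le> indicator (cball 0 r) x * norm (g x)"
      if "\<bar>s\<bar> \<le> indicator (box l u) x" for s x
    proof -
      have "\<bar>s\<bar> \<le> indicator (cball 0 r) x"
        by (rule order_trans[OF that]) (use r in \<open>auto split: split_indicator\<close>)
      then show ?thesis
        by (auto intro!: mult_mono Finite_Cartesian_Product.norm_nth_le)
    qed
    show "integrable lborel (\<lambda>x. indicator (box l u) x *\<^sub>R cnj (g x $ a))"
    proof (rule Bochner_Integration.integrable_bound[OF dom])
      show "AE x in lborel. norm (indicator (box l u) x *\<^sub>R cnj (g x $ a))
          \<le> norm (indicator (cball 0 r) x * norm (g x))"
        using le[of "indicator (box l u) _"] by (intro AE_I2) simp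
    qed measurable
    have bump_le: "\<bar>box_bump l u (Suc m) x\<bar> \<le> indicator (box l u) x" for m x
      using box_bump_bounds[of l u "Suc m" x] box_bump_nonzero[of "Suc m" l u x] by (cases "x \<in> box l u") auto
    have "(\<lambda>m. \<integral>x. box_bump l u (Suc m) x *\<^sub>R cnj (g x $ a) \<partial>lborel)
        \<longlonglongrightarrow> (\<integral>x. indicator (box l u) x *\<^sub>R cnj (g x $ a) \<partial>lborel)"
    proof (rule integral_dominated_convergence[OF _ _ dom])
      show "AE x in lborel. (\<lambda>m. box_bump l u (Suc m) x *\<^sub>R cnj (g x $ a)) \<longlonglongrightarrow> indicator (box l u) x *\<^sub>R cnj (g x $ a)"
        by (intro AE_I2 tendsto_intros LIMSEQ_Suc[OF tendsto_box_bump])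
      show "AE x in lborel. norm (box_bump l u (Suc m) x *\<^sub>R cnj (g x $ a)) \<le> indicator (cball 0 r) x * norm (g x)" for m
        by (intro AE_I2 le bump_le)
      show "(\<lambda>x. box_bump l u (Suc m) x *\<^sub>R cnj (g x $ a)) \<in> borel_measurable lborel" for m
      proof -
        have [measurable]: "box_bump l u (Suc m) \<in> borel_measurable borel"
          by (intro borel_measurable_continuous_onI test_functions_continuous box_bump_test_function) simp
        show ?thesis
          by measurable
      qed
    qed simp
    moreover have "(\<integral>x. box_bump l u (Suc m) x *\<^sub>R cnj (g x $ a) \<partial>lborel) = 0" for m
    proof -
      have "(\<lambda>x. box_bump l u (Suc m) x *\<^sub>R axis a (1::complex)) \<in> test_functions"
        by (rule test_functions_linear[OF bounded_linear_scaleR_left box_bump_test_function]) simp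
      from orth[OF this] show ?thesis
        by (simp add: herm_axis)
    qed
    ultimately show "(\<integral>x. indicator (box l u) x *\<^sub>R cnj (g x $ a) \<partial>lborel) = 0"
      by (simp add: LIMSEQ_const_iff)
  qed
  then have "AE x in lborel. \<forall>a\<in>UNIV. cnj (g x $ a) = 0"
    by (intro AE_finite_allI) auto
  then show ?thesis
    by (simp add: vec_eq_iff)
qed

section \<open>First-order systems of Clifford type\<close>

lemma bounded_linear_vector_smult: "bounded_linear (\<lambda>v. c *s v :: complex^'s)"
  by (rule bounded_linear_intro[of _ "cmod c"])
    (simp_all add: vector_add_ldistrib norm_scalar_mult mult.commute vec_eq_iff)

lemma
  assumes "bounded_linear L" "\<And>x. f differentiable (at x)"
  shows partial_deriv_linear: "partial_deriv b (\<lambda>x. L (f x)) = (\<lambda>x. L (partial_deriv b f x))"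
    and differentiable_bounded_linear: "(\<lambda>x. L (f x)) differentiable (at x)"
proof -
  have *: "((\<lambda>x. L (f x)) has_derivative (\<lambda>h. L (frechet_derivative f (at x) h))) (at x)" for x
    using assms by (auto intro: bounded_linear.has_derivative[OF assms(1)] simp flip: frechet_derivative_works)
  show "partial_deriv b (\<lambda>x. L (f x)) = (\<lambda>x. L (partial_deriv b f x))"
    by (rule ext) (simp add: has_derivative_partial_deriv[OF *] partial_deriv_def)
  show "(\<lambda>x. L (f x)) differentiable (at x)"
    using * by (auto simp: differentiable_def)
qed

lemma partial_deriv_add:
  assumes "\<And>x. f differentiable (at x)" "\<And>x. g differentiable (at x)"
  shows "partial_deriv b (\<lambda>x. f x + g x) = (\<lambda>x. partial_deriv b f x + partial_deriv b g x)"
proof -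
  have *: "((\<lambda>x. f x + g x) has_derivative
      (\<lambda>h. frechet_derivative f (at x) h + frechet_derivative g (at x) h)) (at x)" for x
    using assms by (auto intro: has_derivative_add simp flip: frechet_derivative_works)
  show ?thesis
    by (rule ext) (simp add: has_derivative_partial_deriv[OF *] partial_deriv_def)
qed

lemma partial_deriv_sum:
  assumes "\<And>i x. i \<in> I \<Longrightarrow> f i differentiable (at x)"
  shows "partial_deriv b (\<lambda>x. \<Sum>i\<in>I. f i x) = (\<lambda>x. \<Sum>i\<in>I. partial_deriv b (f i) x)"
proof -
  have *: "((\<lambda>x. \<Sum>i\<in>I. f i x) has_derivative
      (\<lambda>h. \<Sum>i\<in>I. frechet_derivative (f i) (at x) h)) (at x)" for x
    using assms by (auto intro!: has_derivative_sum simp flip: frechet_derivative_works)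
  show ?thesis
    by (rule ext) (simp add: has_derivative_partial_deriv[OF *] partial_deriv_def)
qed

text \<open>The form \<open>\<kappa>\<close> and the coefficients \<open>B\<close> are kept abstract
  because the Dirac operator and its formal adjoint have different coefficients for the same
  form.\<close>

locale clifford_system =
  fixes \<kappa> :: "'a::euclidean_space \<Rightarrow> real" and B :: "'a \<Rightarrow> complex^'s \<Rightarrow> complex^'s"
  assumes bounded_linear_B: "bounded_linear (B b)"
    and B_scale: "B b (z *s v) = z *s B b v"
    and anticommutator: "b \<in> Basis \<Longrightarrow> c \<in> Basis \<Longrightarrow>
      B b (B c v) + B c (B b v) = (if b = c then - 2 * \<kappa> b else 0) *\<^sub>R v"
    and \<kappa>_nonzero: "b \<in> Basis \<Longrightarrow> \<kappa> b \<noteq> 0"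
begin

definition dop :: "('a \<Rightarrow> complex^'s) \<Rightarrow> 'a \<Rightarrow> complex^'s" where
  "dop f x = (\<Sum>b\<in>Basis. B b (partial_deriv b f x))"

lemma dop_test_functions:
  assumes "f \<in> test_functions"
  shows "dop f \<in> test_functions"
  unfolding dop_def[abs_def]
  by (intro test_functions_sum test_functions_linear[OF bounded_linear_B] test_functions_partial_deriv assms)

lemma dop_translate:
  assumes "f \<in> test_functions"
  shows "dop (\<lambda>y. f (y - x)) y = dop f (y - x)"
  using partial_deriv_affine(1)[OF test_functions_differentiable[OF assms], of _ 1 "- x"]
  by (simp add: dop_def)

lemma dop_add:
  assumes "f \<in> test_functions" "g \<in> test_functions"
  shows "dop (\<lambda>y. f y + g y) y = dop f y + dop g y"
  using assms
  by (simp add: dop_def partial_deriv_add test_functions_differentiable sum.distrib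
      linear_add[OF bounded_linear.linear[OF bounded_linear_B]])

lemma dop_scale:
  assumes "f \<in> test_functions"
  shows "dop (\<lambda>y. c *s f y) y = c *s dop f y"
  using partial_deriv_linear[OF bounded_linear_vector_smult test_functions_differentiable[OF assms]]
  by (simp add: dop_def B_scale vec.scale_sum_right)

text \<open>Second derivatives commute, so the double sum equals its transpose. Adding the two
  produces anticommutators, of which only the diagonal survives; the result is then halved.\<close>

lemma dop_dop:
  assumes f: "f \<in> test_functions"
  shows "dop (dop f) x = - (\<Sum>b\<in>Basis. \<kappa> b *\<^sub>R partial_deriv b (partial_deriv b f) x)"
proof -
  define P where "P b c = partial_deriv b (partial_deriv c f) x" for b c
  have d1: "partial_deriv c f differentiable (at x)" if "c \<in> Basis" for c x
    using that test_functions_differentiable test_functions_partial_deriv f by blast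
  have "partial_deriv b (dop f) x = (\<Sum>c\<in>Basis. B c (P b c))" for b
  proof -
    have "partial_deriv b (\<lambda>x. \<Sum>c\<in>Basis. B c (partial_deriv c f x)) =
        (\<lambda>x. \<Sum>c\<in>Basis. partial_deriv b (\<lambda>x. B c (partial_deriv c f x)) x)"
      by (rule partial_deriv_sum) (rule differentiable_bounded_linear[OF bounded_linear_B d1])
    also have "\<dots> = (\<lambda>x. \<Sum>c\<in>Basis. B c (partial_deriv b (partial_deriv c f) x))"
      using partial_deriv_linear[OF bounded_linear_B d1] by (intro ext sum.cong refl) metis
    finally show ?thesis
      unfolding dop_def[abs_def] P_def by (rule fun_cong)
  qed
  then have "dop (dop f) x = (\<Sum>b\<in>Basis. B b (\<Sum>c\<in>Basis. B c (P b c)))"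
    by (simp add: dop_def[of "dop f"])
  then have 1: "dop (dop f) x = (\<Sum>b\<in>Basis. \<Sum>c\<in>Basis. B b (B c (P b c)))"
    by (simp add: linear_sum[OF bounded_linear.linear[OF bounded_linear_B]])
  also have "\<dots> = (\<Sum>c\<in>Basis. \<Sum>b\<in>Basis. B b (B c (P b c)))"
    by (rule sum.swap)
  also have "\<dots> = (\<Sum>b\<in>Basis. \<Sum>c\<in>Basis. B c (B b (P b c)))"
  proof (intro sum.cong refl)
    fix b c :: 'a
    assume "b \<in> Basis" "c \<in> Basis"
    then have "partial_deriv c (partial_deriv b f) = partial_deriv b (partial_deriv c f)"
      using partial_deriv_commute[OF test_functions_C_diff[OF f]] by blast
    then show "B c (B b (P c b)) = B c (B b (P b c))"
      by (simp add: P_def)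
  qed
  finally have 2: "dop (dop f) x = (\<Sum>b\<in>Basis. \<Sum>c\<in>Basis. B c (B b (P b c)))" .
  have "dop (dop f) x + dop (dop f) x = (\<Sum>b\<in>Basis. \<Sum>c\<in>Basis. B b (B c (P b c)) + B c (B b (P b c)))"
    by (subst (1) 1, subst 2) (simp only: sum.distrib)
  also have "\<dots> = (\<Sum>b\<in>Basis. \<Sum>c\<in>Basis. if b = c then (- 2 * \<kappa> b) *\<^sub>R P b b else 0)"
    by (intro sum.cong refl) (simp add: anticommutator)
  also have "\<dots> = (\<Sum>b\<in>Basis. (- 2 * \<kappa> b) *\<^sub>R P b b)"
    by simp
  also have "\<dots> = 2 *\<^sub>R (- (\<Sum>b\<in>Basis. \<kappa> b *\<^sub>R P b b))"
    by (simp add: scaleR_sum_right sum_negf)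
  finally have "2 *\<^sub>R dop (dop f) x = 2 *\<^sub>R (- (\<Sum>b\<in>Basis. \<kappa> b *\<^sub>R P b b))"
    by (simp add: scaleR_2)
  then show ?thesis
    unfolding P_def by (simp only: scaleR_cancel_left) simp
qed

lemma dop_factor:
  assumes f: "f \<in> test_functions"
  shows "\<mu> *s (\<mu> *s f y + dop f y) - dop (\<lambda>y. \<mu> *s f y + dop f y) y =
    (\<mu> * \<mu>) *s f y + (\<Sum>b\<in>Basis. \<kappa> b *\<^sub>R partial_deriv b (partial_deriv b f) y)"
proof -
  have "dop (\<lambda>y. \<mu> *s f y + dop f y) y = \<mu> *s dop f y + dop (dop f) y"
    using f by (simp add: dop_add dop_scale dop_test_functions test_functions_linear[OF bounded_linear_vector_smult])
  then show ?thesis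
    by (simp add: dop_dop[OF f] vector_add_ldistrib vector_smult_assoc)
qed

text \<open>The correlations of a weak solution \<open>g\<close> with test functions are smooth, square-integrable
  and, by \<open>(\<mu> - Q)(\<mu> + Q) = \<mu>\<^sup>2 + \<Sum> \<kappa> b \<partial>\<^sub>b\<^sup>2\<close>, solve a scalar equation.\<close>

theorem weak_solution_eq_0:
  assumes g: "square_integrable g"
    and weak: "\<And>f. f \<in> test_functions \<Longrightarrow> Re (\<integral>x. herm (\<mu> *s f x - dop f x) (g x) \<partial>lborel) = 0"
  shows "AE x in lborel. g x = 0"
proof (rule AE_eq_0_if_orthogonal_test_functions[OF g])
  \<comment> \<open>The hypothesis speaks of the real inner product only. Testing with
    \<open>\<i> *s f x\<close> supplies the imaginary part.\<close>
  have weak': "(\<integral>x. herm (\<mu> *s f x - dop f x) (g x) \<partial>lborel) = 0" if f: "f \<in> test_functions" for f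
  proof -
    let ?z = "\<integral>x. herm (\<mu> *s f x - dop f x) (g x) \<partial>lborel"
    have eq: "\<mu> *s (\<i> *s f x) - dop (\<lambda>x. \<i> *s f x) x = \<i> *s (\<mu> *s f x - dop f x)" for x
      by (simp add: dop_scale[OF f] vec_eq_iff algebra_simps)
    have "(\<lambda>x. \<i> *s f x) \<in> test_functions"
      by (rule test_functions_linear[OF bounded_linear_vector_smult f])
    from weak[OF this] have "Re (\<i> * ?z) = 0"
      unfolding eq herm_scale_left integral_mult_right_zero .
    with weak[OF f] show ?thesis
      by (simp add: complex_eq_iff)
  qed
  have scalar: "(\<Sum>b\<in>Basis. of_real (\<kappa> b) * correlation g (partial_deriv b (partial_deriv b f)) x) =
      - (\<mu> * \<mu> * correlation g f x)" if f: "f \<in> test_functions" for f x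
  proof -
    \<comment> \<open>A translate of (mu + Q) f is the test function that turns the first-order
      equation into the scalar one.\<close>
    define h where "h y = \<mu> *s f y + dop f y" for y
    have h: "h \<in> test_functions"
      unfolding h_def by (intro test_functions_add dop_test_functions f test_functions_linear[OF bounded_linear_vector_smult])
    have "0 = (\<integral>y. herm (\<mu> *s h (y - x) - dop (\<lambda>y. h (y - x)) y) (g y) \<partial>lborel)"
      using weak'[OF test_functions_translate[OF h]] by simp
    also have "\<dots> = correlation g (\<lambda>y. \<mu> *s h y - dop h y) x"
      by (simp add: dop_translate[OF h] correlation_def)
    also have "(\<lambda>y. \<mu> *s h y - dop h y) = (\<lambda>y. (\<mu> * \<mu>) *s f y + (\<Sum>b\<in>Basis. \<kappa> b *\<^sub>R partial_deriv b (partial_deriv b f) y))"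
      unfolding h_def[abs_def] by (rule ext) (rule dop_factor[OF f])
    also have "correlation g \<dots> x = \<mu> * \<mu> * correlation g f x +
        (\<Sum>b\<in>Basis. of_real (\<kappa> b) * correlation g (partial_deriv b (partial_deriv b f)) x)"
      using g f
      by (simp add: correlation_add correlation_sum correlation_scale correlation_scaleR test_functions_sum
          test_functions_linear[OF bounded_linear_vector_smult] test_functions_linear[OF bounded_linear_scaleR_right]
          test_functions_partial_deriv)
    finally show ?thesis
      by (simp add: eq_neg_iff_add_eq_0 add.commute)
  qed
  fix f :: "'a \<Rightarrow> complex^'s"
  assume f: "f \<in> test_functions"
  obtain b0 :: 'a where b0: "b0 \<in> Basis"
    using nonempty_Basis by blast
  \<comment> \<open>The derivative of a test function is again one, so the scalar equation is
    available for the derivative of the correlation as well.\<close>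
  define f0 where "f0 = partial_deriv b0 f"
  have f0: "f0 \<in> test_functions"
    unfolding f0_def by (rule test_functions_partial_deriv[OF f b0])
  note pd = test_functions_partial_deriv
  note hp = correlation_has_partial[OF g]
  have neg: "has_partial b (\<lambda>x. - u x) (\<lambda>x. - u' x)" if "has_partial b u u'" for b and u u' :: "'a \<Rightarrow> complex"
    by (rule has_partial_linear[OF bounded_linear_minus[OF bounded_linear_ident] that])
  have cneg: "cL2 (\<lambda>x. - u x)" if "cL2 u" for u
    using cL2_bounded_mult[of "\<lambda>_. - 1" 1 u] that by simp
  \<comment> \<open>Each derivative of a correlation costs a sign. Hence first and third derivatives
    appear negated below, second ones not.\<close>
  have "correlation g f 0 = 0"
  proof (rule L2_solution_eq_0[where ?b0.0 = b0 and \<kappa> = \<kappa> and F = "correlation g f" and x = 0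
        and ?F1.0 = "\<lambda>b x. - correlation g (partial_deriv b f) x"
        and ?F2.0 = "\<lambda>b. correlation g (partial_deriv b (partial_deriv b f))"
        and ?H1.0 = "\<lambda>b. correlation g (partial_deriv b f0)"
        and ?H2.0 = "\<lambda>b x. - correlation g (partial_deriv b (partial_deriv b f0)) x"
        and c = "\<mu> * \<mu>"])
    show "b0 \<in> Basis" "\<kappa> b0 \<noteq> 0"
      using b0 \<kappa>_nonzero by auto
    show "cL2 (correlation g f)"
      by (rule correlation_cL2[OF g f])
    show "(\<Sum>b\<in>Basis. of_real (\<kappa> b) * correlation g (partial_deriv b (partial_deriv b f)) x) = - (\<mu> * \<mu> * correlation g f x)" for x
      by (rule scalar[OF f])
    show "(\<Sum>b\<in>Basis. of_real (\<kappa> b) * - correlation g (partial_deriv b (partial_deriv b f0)) x)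
        = - (\<mu> * \<mu> * - correlation g (partial_deriv b0 f) x)" for x
      using scalar[OF f0, of x] by (simp add: sum_negf f0_def)
    fix b :: 'a
    assume b: "b \<in> Basis"
    show "has_partial b (correlation g f) (\<lambda>x. - correlation g (partial_deriv b f) x)"
      by (rule hp[OF f b])
    show "cL2 (\<lambda>x. - correlation g (partial_deriv b f) x)"
      by (intro cneg correlation_cL2 g pd f b)
    show "has_partial b (\<lambda>x. - correlation g (partial_deriv b f) x) (correlation g (partial_deriv b (partial_deriv b f)))"
      using neg[OF hp[OF pd[OF f b] b]] by simp
    show "cL2 (correlation g (partial_deriv b (partial_deriv b f)))"
      by (intro correlation_cL2 g pd f b)
    show "has_partial b (\<lambda>x. - correlation g (partial_deriv b0 f) x) (correlation g (partial_deriv b f0))"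
      using neg[OF hp[OF f0 b]] by (simp add: f0_def)
    show "cL2 (correlation g (partial_deriv b f0))"
      by (intro correlation_cL2 g pd f0 b)
    show "has_partial b (correlation g (partial_deriv b f0)) (\<lambda>x. - correlation g (partial_deriv b (partial_deriv b f0)) x)"
      by (rule hp[OF pd[OF f0 b] b])
    show "cL2 (\<lambda>x. - correlation g (partial_deriv b (partial_deriv b f0)) x)"
      by (intro cneg correlation_cL2 g pd f0 b)
  qed
  then show "(\<integral>x. herm (f x) (g x) \<partial>lborel) = 0"
    by (simp add: correlation_def)
qed

end

section \<open>Orthogonal complements of subspaces that are not dense\<close>

text \<open>The parallelogram law makes a minimising sequence for the distance from \<open>x\<close>
  to \<open>V\<close> Cauchy; \<open>z\<close> is \<open>x\<close> minus its limit, which lies in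
  the closure of \<open>V\<close>.\<close>

lemma exists_orthogonal_vector:
  fixes V :: "'h::{real_inner, complete_space} set"
  assumes V: "subspace V" and not_dense: "closure V \<noteq> UNIV"
  obtains z where "z \<noteq> 0" "\<And>v. v \<in> V \<Longrightarrow> inner v z = 0"
proof -
  obtain x where x: "x \<notin> closure V"
    using not_dense by blast
  have ne: "V \<noteq> {}"
    using subspace_0[OF V] by blast
  define d where "d = infdist x V"
  have d: "0 \<le> d" "\<And>v. v \<in> V \<Longrightarrow> d \<le> norm (x - v)"
    by (simp_all add: d_def infdist_nonneg infdist_le flip: dist_norm)
  have "\<exists>v\<in>V. norm (x - v) < d + inverse (real (Suc n))" for n
  proof -
    have "(INF a\<in>V. dist x a) < d + inverse (real (Suc n))"
      using ne by (simp add: d_def infdist_notempty)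
    then show ?thesis
      using ne cInf_lessD[of "dist x ` V"] by (auto simp: dist_norm)
  qed
  then obtain s where s: "\<And>n. s n \<in> V" "\<And>n. norm (x - s n) < d + inverse (real (Suc n))"
    by metis
  have par: "(norm (s m - s n))\<^sup>2 \<le> 2 * (norm (x - s m))\<^sup>2 + 2 * (norm (x - s n))\<^sup>2 - 4 * d\<^sup>2" for m n
  proof -
    have "d \<le> norm (x - (1/2) *\<^sub>R (s m + s n))"
      using V s by (intro d subspace_scale subspace_add)
    then have "d\<^sup>2 \<le> (norm (x - (1/2) *\<^sub>R (s m + s n)))\<^sup>2"
      using d(1) by (rule power_mono)
    moreover have "(x - s m) + (x - s n) = 2 *\<^sub>R (x - (1/2) *\<^sub>R (s m + s n))"
      by (simp add: scaleR_right_diff_distrib scaleR_2 add_diff_add[symmetric])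
    then have "(norm ((x - s m) + (x - s n)))\<^sup>2 = 4 * (norm (x - (1/2) *\<^sub>R (s m + s n)))\<^sup>2"
      by (simp only: norm_scaleR power_mult_distrib) simp
    ultimately have "4 * d\<^sup>2 \<le> (norm ((x - s m) + (x - s n)))\<^sup>2"
      by linarith
    moreover have "(norm (b - a))\<^sup>2 + (norm (a + b))\<^sup>2 = 2 * (norm a)\<^sup>2 + 2 * (norm b)\<^sup>2" for a b :: 'h
      by (simp add: power2_norm_eq_inner inner_diff_left inner_diff_right inner_add_left inner_add_right)
    from this[of "x - s n" "x - s m"]
    have "(norm (s m - s n))\<^sup>2 + (norm ((x - s m) + (x - s n)))\<^sup>2 = 2 * (norm (x - s m))\<^sup>2 + 2 * (norm (x - s n))\<^sup>2"
      by (simp add: norm_minus_commute)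
    ultimately show ?thesis
      by linarith
  qed
  have lim: "(\<lambda>n. (norm (x - s n))\<^sup>2) \<longlonglongrightarrow> d\<^sup>2"
  proof (rule tendsto_power, rule tendsto_sandwich[where f = "\<lambda>_. d" and h = "\<lambda>n. d + inverse (real (Suc n))"])
    show "(\<lambda>n. d + inverse (real (Suc n))) \<longlonglongrightarrow> d"
      using tendsto_add[OF tendsto_const LIMSEQ_inverse_real_of_nat, of d] by simp
    show "\<forall>\<^sub>F n in sequentially. norm (x - s n) \<le> d + inverse (real (Suc n))"
      using s(2) by (intro always_eventually allI less_imp_le)
    show "\<forall>\<^sub>F n in sequentially. d \<le> norm (x - s n)"
      using s(1) d by (intro always_eventually) auto
  qed (rule tendsto_const)
  have "Cauchy s"
  proof (rule CauchyI)
    fix e :: real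
    assume e: "e > 0"
    have "\<forall>\<^sub>F n in sequentially. (norm (x - s n))\<^sup>2 < d\<^sup>2 + e\<^sup>2 / 4"
      using e by (intro order_tendstoD[OF lim]) simp
    then obtain N where N: "\<And>n. n \<ge> N \<Longrightarrow> (norm (x - s n))\<^sup>2 < d\<^sup>2 + e\<^sup>2 / 4"
      by (auto simp: eventually_sequentially)
    have "norm (s m - s n) < e" if "m \<ge> N" "n \<ge> N" for m n
    proof -
      have "(norm (s m - s n))\<^sup>2 < e\<^sup>2"
        using par[of m n] N[OF that(1)] N[OF that(2)] by linarith
      then show ?thesis
        by (rule power2_less_imp_less) (use e in simp)
    qed
    then show "\<exists>M. \<forall>m\<ge>M. \<forall>n\<ge>M. norm (s m - s n) < e"
      by blast
  qed
  then obtain v where v: "s \<longlonglongrightarrow> v"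
    using Cauchy_convergent[OF \<open>Cauchy s\<close>] unfolding convergent_def by blast
  have "(\<lambda>n. (norm (x - s n))\<^sup>2) \<longlonglongrightarrow> (norm (x - v))\<^sup>2"
    by (intro tendsto_intros v)
  then have nz: "(norm (x - v))\<^sup>2 = d\<^sup>2"
    using lim LIMSEQ_unique by blast
  define z where "z = x - v"
  have "v \<in> closure V"
    unfolding closure_sequential using v s(1) by (intro exI[of _ s] conjI allI)
  then have "z \<noteq> 0"
    using x by (auto simp: z_def)
  moreover have "inner w z = 0" if w: "w \<in> V" for w
  proof (cases "w = 0")
    case False
    have le: "(norm z)\<^sup>2 \<le> (norm (z - t *\<^sub>R w))\<^sup>2" for t
    proof (rule LIMSEQ_le_const)
      show "(\<lambda>n. (norm (x - s n - t *\<^sub>R w))\<^sup>2) \<longlonglongrightarrow> (norm (z - t *\<^sub>R w))\<^sup>2"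
        unfolding z_def by (intro tendsto_intros v)
      have "d \<le> norm (x - (s n + t *\<^sub>R w))" for n
        using V s w by (intro d subspace_scale subspace_add)
      then have "d\<^sup>2 \<le> (norm (x - s n - t *\<^sub>R w))\<^sup>2" for n
        using d by (intro power_mono) (simp_all add: diff_diff_eq)
      then show "\<exists>N. \<forall>n\<ge>N. (norm z)\<^sup>2 \<le> (norm (x - s n - t *\<^sub>R w))\<^sup>2"
        using nz by (simp add: z_def)
    qed
    \<comment> \<open>The minimiser of the quadratic function t -> |z - t w|^2. Minimality of
      \<open>z\<close> there forces the squared inner product to be at most 0.\<close>
    define t where "t = inner w z / inner w w"
    have ww: "inner w w > 0"
      using False by simp
    have "(norm (z - t *\<^sub>R w))\<^sup>2 = (norm z)\<^sup>2 - 2 * (t * inner w z) + t * (t * inner w w)"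
      by (simp add: power2_norm_eq_inner inner_diff_left inner_diff_right inner_commute[of z w] right_diff_distrib)
    moreover have "t * inner w w = inner w z"
      using ww by (simp add: t_def)
    ultimately have "t * inner w z \<le> 0"
      using le[of t] by simp
    then have "(inner w z)\<^sup>2 / inner w w \<le> 0"
      by (simp add: t_def power2_eq_square)
    then show ?thesis
      using ww by (simp add: divide_le_0_iff)
  qed simp
  ultimately show ?thesis
    by (rule that)
qed

section \<open>The Clifford relations\<close>

text \<open>The product of 2 x 2 matrices. Since \<open>mat2\<close> reads every nonzero index as 1,
  identities between such products hold at all natural indices, without range conditions.\<close>

definition kmult :: "cmat \<Rightarrow> cmat \<Rightarrow> cmat" where
  "kmult A B = (\<lambda>i j. A i 0 * B 0 j + A i 1 * B 1 j)"

definition kadj :: "cmat \<Rightarrow> cmat" where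
  "kadj A = (\<lambda>i j. cnj (A j i))"

text \<open>Scalars pulled out of the single factors multiply to one scalar of the Kronecker
  product. This reduces sign computations on large matrices to 2 x 2 blocks.\<close>

inductive kscale :: "complex \<Rightarrow> cmat list \<Rightarrow> cmat list \<Rightarrow> bool" where
  kscale_Nil: "kscale 1 [] []"
| kscale_Cons: "(\<And>i j. A i j = a * B i j) \<Longrightarrow> kscale c As Bs \<Longrightarrow> kscale (a * c) (A # As) (B # Bs)"

lemma kscale_length: "kscale c As Bs \<Longrightarrow> length As = length Bs"
  by (induction rule: kscale.induct) auto

lemma kscale_kronecker: "kscale c As Bs \<Longrightarrow> kronecker As i j = c * kronecker Bs i j"
  by (induction arbitrary: i j rule: kscale.induct) (auto simp: kscale_length)

lemma kscale_append: "kscale c As Bs \<Longrightarrow> kscale d As' Bs' \<Longrightarrow> kscale (c * d) (As @ As') (Bs @ Bs')"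
  by (induction rule: kscale.induct) (auto simp: mult.assoc intro: kscale_Cons)

lemma kscale_single: "(\<And>i j. A i j = a * B i j) \<Longrightarrow> kscale a [A] [B]"
  using kscale_Cons[OF _ kscale_Nil, of A a B] by simp

lemma kscale_replicate:
  assumes "\<And>i j. A i j = B i j"
  shows "kscale 1 (replicate n A) (replicate n B)"
proof -
  have "A = B"
    using assms by (intro ext)
  moreover have "kscale 1 (replicate n B) (replicate n B)"
  proof (induction n)
    case (Suc n)
    then show ?case
      using kscale_Cons[of B 1 B 1 "replicate n B" "replicate n B"] by simp
  qed (simp add: kscale_Nil)
  ultimately show ?thesis
    by simp
qed

lemma sum_lessThan_add:
  fixes f :: "nat \<Rightarrow> 'a::comm_monoid_add"
  shows "(\<Sum>k<N + M. f k) = (\<Sum>k<N. f k) + (\<Sum>k<M. f (N + k))"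
  by (induction M) (auto simp: add.assoc)

text \<open>The mixed-product rule. The leading bit \<open>k div N\<close> of the summation index is
  summed inside \<open>kmult\<close>; the remainder \<open>k mod N\<close> is left to the
  induction.\<close>

lemma kronecker_mult:
  "length As = length Bs \<Longrightarrow>
    (\<Sum>k<2 ^ length As. kronecker As i k * kronecker Bs k j) = kronecker (map2 kmult As Bs) i j"
proof (induction As Bs arbitrary: i j rule: list_induct2)
  case (Cons A As B Bs)
  define N :: nat where "N = 2 ^ length As"
  have N: "N > 0" and N': "2 ^ length Bs = N"
    using Cons.hyps by (simp_all add: N_def)
  have "(\<Sum>k<2 ^ length (A # As). kronecker (A # As) i k * kronecker (B # Bs) k j) =
      (\<Sum>k<N + N. A (i div N) (k div N) * kronecker As (i mod N) (k mod N) *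
        (B (k div N) (j div N) * kronecker Bs (k mod N) (j mod N)))"
    by (simp add: N' mult_2 flip: N_def)
  also have "\<dots> = (\<Sum>k<N. A (i div N) 0 * B 0 (j div N) * (kronecker As (i mod N) k * kronecker Bs k (j mod N)))
      + (\<Sum>k<N. A (i div N) 1 * B 1 (j div N) * (kronecker As (i mod N) k * kronecker Bs k (j mod N)))"
    unfolding sum_lessThan_add using N by (intro arg_cong2[where f = "(+)"] sum.cong) (auto simp: mult_ac)
  also have "\<dots> = kmult A B (i div N) (j div N) * kronecker (map2 kmult As Bs) (i mod N) (j mod N)"
    using Cons.IH[of "i mod N" "j mod N"]
    by (simp add: kmult_def algebra_simps flip: N_def sum_distrib_left)
  finally show ?case
    using Cons.hyps by (simp add: N_def)
qed simp

lemma kronecker_adj: "cnj (kronecker As j i) = kronecker (map kadj As) i j"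
  by (induction As arbitrary: i j) (auto simp: kadj_def)

lemma kronecker_E:
  "i < 2 ^ m \<Longrightarrow> j < 2 ^ m \<Longrightarrow> kronecker (replicate m mat_E) i j = (if i = j then 1 else 0)"
proof (induction m arbitrary: i j)
  case (Suc m)
  define N :: nat where "N = 2 ^ m"
  have N: "N > 0"
    by (simp add: N_def)
  have "i div N < 2" "j div N < 2"
    using Suc.prems by (simp_all add: N_def less_mult_imp_div_less mult.commute)
  then have E: "mat_E (i div N) (j div N) = (if i div N = j div N then 1 else 0)"
    by (auto simp: mat_E_def mat2_def less_2_cases_iff)
  have "i = j \<longleftrightarrow> i div N = j div N \<and> i mod N = j mod N"
    by (metis div_mult_mod_eq)
  then show ?case
    using Suc.IH[of "i mod N" "j mod N"] N E by (simp add: N_def)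
qed simp

lemma kmult_mat2:
  "kmult (mat2 a b c d) (mat2 a' b' c' d') =
     mat2 (a * a' + b * c') (a * b' + b * d') (c * a' + d * c') (c * b' + d * d')"
  by (intro ext) (simp add: kmult_def mat2_def)

lemma mat2_scale: "r * mat2 a b c d i j = mat2 (r * a) (r * b) (r * c) (r * d) i j"
  by (simp add: mat2_def)

lemma kadj_mat2: "kadj (mat2 a b c d) = mat2 (cnj a) (cnj c) (cnj b) (cnj d)"
  by (intro ext) (simp add: kadj_def mat2_def)

lemma mat2_uminus: "- mat2 a b c d i j = mat2 (- a) (- b) (- c) (- d) i j"
  by (simp add: mat2_def)

lemmas kmat_simps = mat_E_def mat_U_def mat_T_def kmult_mat2 kadj_mat2 mat2_scale mat2_uminus

section \<open>Anticommutation, squares and adjoints of the Kronecker words\<close>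

definition cword :: "nat \<Rightarrow> nat \<Rightarrow> nat \<Rightarrow> cmat list" where
  "cword m t s = replicate (m - 1 - t) mat_E @ [mat_U s] @ replicate t mat_T"

text \<open>Slotwise form of anticommutation: in every slot the two products agree up to a scalar,
  and these scalars multiply to -1.\<close>

definition anticommute :: "cmat list \<Rightarrow> cmat list \<Rightarrow> bool" where
  "anticommute As Bs \<longleftrightarrow> length As = length Bs \<and> kscale (- 1) (map2 kmult Bs As) (map2 kmult As Bs)"

lemma map2_replicate: "map2 f (replicate n x) (replicate n y) = replicate n (f x y)"
  by (simp add: zip_replicate)

lemma length_cword: "t < m \<Longrightarrow> length (cword m t s) = m"
  by (simp add: cword_def)

text \<open>The words differ in a single slot, where U_1 meets U_2; these two anticommute.\<close>

lemma anticommute_cword_same: "t < m \<Longrightarrow> s = 1 \<and> s' = 2 \<or> s = 2 \<and> s' = 1 \<Longrightarrow> anticommute (cword m t s) (cword m t s')"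
proof -
  assume s: "s = 1 \<and> s' = 2 \<or> s = 2 \<and> s' = 1"
  have "kscale (1 * (- 1 * 1))
      (replicate (m - 1 - t) (kmult mat_E mat_E) @ [kmult (mat_U s') (mat_U s)] @ replicate t (kmult mat_T mat_T))
      (replicate (m - 1 - t) (kmult mat_E mat_E) @ [kmult (mat_U s) (mat_U s')] @ replicate t (kmult mat_T mat_T))"
    using s by (intro kscale_append kscale_replicate kscale_single) (auto simp: kmat_simps)
  then show ?thesis
    unfolding anticommute_def cword_def by (simp add: map2_replicate)
qed

text \<open>The word with fewer factors T has its U facing a T. In every other slot one factor is E
  or both are T, so exactly one sign arises.\<close>

lemma anticommute_cword_less:
  assumes "t < t'" "t' < m" "s \<in> {1, 2}" "s' \<in> {1, 2}"
  shows "anticommute (cword m t s) (cword m t' s')"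
proof -
  \<comment> \<open>The number of slots strictly between the two factors U; there E faces T.\<close>
  define k where "k = t' - t - 1"
  have t': "t' = k + Suc t"
    using assms by (simp add: k_def)
  have 1: "cword m t s = replicate (m - 1 - t') mat_E @ [mat_E] @ replicate k mat_E @ [mat_U s] @ replicate t mat_T"
  proof -
    have "m - 1 - t = (m - 1 - t') + Suc k"
      using assms t' by simp
    then have "replicate (m - 1 - t) mat_E = replicate (m - 1 - t') mat_E @ replicate (Suc k) mat_E"
      by (simp only: replicate_add)
    then show ?thesis
      by (simp add: cword_def)
  qed
  have 2: "cword m t' s' = replicate (m - 1 - t') mat_E @ [mat_U s'] @ replicate k mat_T @ [mat_T] @ replicate t mat_T"
    by (simp add: cword_def replicate_add t' replicate_append_same)
  have "kscale (1 * (1 * (1 * (- 1 * 1))))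
      (replicate (m - 1 - t') (kmult mat_E mat_E) @ [kmult (mat_U s') mat_E] @ replicate k (kmult mat_T mat_E)
        @ [kmult mat_T (mat_U s)] @ replicate t (kmult mat_T mat_T))
      (replicate (m - 1 - t') (kmult mat_E mat_E) @ [kmult mat_E (mat_U s')] @ replicate k (kmult mat_E mat_T)
        @ [kmult (mat_U s) mat_T] @ replicate t (kmult mat_T mat_T))"
    using assms by (intro kscale_append kscale_replicate kscale_single) (auto simp: kmat_simps)
  then show ?thesis
    unfolding anticommute_def 1 2 by (simp add: map2_replicate)
qed

text \<open>T commutes with E and with itself and anticommutes with the single U.\<close>

lemma anticommute_cword_T:
  assumes "t < m" "s \<in> {1, 2}"
  shows "anticommute (cword m t s) (replicate m mat_T)"
proof -
  have T: "replicate m mat_T = replicate (m - 1 - t) mat_T @ [mat_T] @ replicate t mat_T"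
  proof -
    have "m = (m - 1 - t) + Suc t"
      using assms by simp
    then have "replicate m mat_T = replicate (m - 1 - t) mat_T @ replicate (Suc t) mat_T"
      by (metis replicate_add)
    then show ?thesis
      by simp
  qed
  have "kscale (1 * (- 1 * 1))
      (replicate (m - 1 - t) (kmult mat_T mat_E) @ [kmult mat_T (mat_U s)] @ replicate t (kmult mat_T mat_T))
      (replicate (m - 1 - t) (kmult mat_E mat_T) @ [kmult (mat_U s) mat_T] @ replicate t (kmult mat_T mat_T))"
    using assms by (intro kscale_append kscale_replicate kscale_single) (auto simp: kmat_simps)
  then show ?thesis
    unfolding anticommute_def T cword_def by (simp add: map2_replicate)
qed

lemma kronecker_anticommute:
  assumes "anticommute As Bs"
  shows "kronecker (map2 kmult As Bs) i j + kronecker (map2 kmult Bs As) i j = 0"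
proof -
  have "kscale (- 1) (map2 kmult Bs As) (map2 kmult As Bs)"
    using assms by (simp add: anticommute_def)
  from kscale_kronecker[OF this] show ?thesis
    by simp
qed

definition gword :: "nat \<Rightarrow> nat \<Rightarrow> cmat list" where
  "gword m j = (if j \<le> 2 * m then cword m ((j - 1) div 2) (sigma j) else replicate m mat_T)"

text \<open>The word consisting of T alone squares to 1, whereas words with a U square to -1; the
  extra \<open>\<i>\<close> removes this difference.\<close>

definition gcoef :: "nat \<Rightarrow> nat \<Rightarrow> nat \<Rightarrow> complex" where
  "gcoef m p j = tau p j * (if j \<le> 2 * m then 1 else \<i>)"

lemma clifford_cmat_eq: "clifford_cmat m p j a b = gcoef m p j * kronecker (gword m j) a b"
  by (simp add: clifford_cmat_def gcoef_def gword_def cword_def Let_def)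

lemma length_gword: "1 \<le> j \<Longrightarrow> length (gword m j) = m"
  by (auto simp: gword_def length_cword)

lemma kronecker_gword_anticommute:
  assumes "j \<noteq> k" "1 \<le> j" "1 \<le> k" "j \<le> 2 * m + 1" "k \<le> 2 * m + 1"
  shows "kronecker (map2 kmult (gword m j) (gword m k)) a b + kronecker (map2 kmult (gword m k) (gword m j)) a b = 0"
proof -
  have main: "kronecker (map2 kmult (gword m j) (gword m k)) a b + kronecker (map2 kmult (gword m k) (gword m j)) a b = 0"
    if "j < k" "1 \<le> j" "k \<le> 2 * m + 1" for j k
  proof -
    have j: "j \<le> 2 * m" "(j - 1) div 2 < m" and s: "sigma j \<in> {1, 2}" "sigma k \<in> {1, 2}"
      using that by (auto simp: sigma_def)
    show ?thesis
    proof (cases "k \<le> 2 * m")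
      case True
      then have k: "(k - 1) div 2 < m"
        using that by auto
      have "(j - 1) div 2 \<le> (k - 1) div 2"
        using that by (intro div_le_mono) auto
      then consider "(j - 1) div 2 < (k - 1) div 2" | "(j - 1) div 2 = (k - 1) div 2"
        by linarith
      then have "anticommute (gword m j) (gword m k)"
      proof cases
        case 1
        then show ?thesis
          using j k s True anticommute_cword_less by (simp add: gword_def)
      next
        case 2
        \<comment> \<open>Distinct generators with the same block number are a consecutive pair 2 t
          + 1, 2 t + 2, so one carries U_1 and the other U_2.\<close>
        then have "odd j \<and> even k \<or> even j \<and> odd k"
          using that by presburger
        then have "anticommute (cword m ((k - 1) div 2) (sigma j)) (cword m ((k - 1) div 2) (sigma k))"
          by (intro anticommute_cword_same k) (auto simp: sigma_def)
        then show ?thesis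
          using j True 2 by (simp add: gword_def)
      qed
      then show ?thesis
        by (rule kronecker_anticommute)
    next
      case False
      then show ?thesis
        using j s anticommute_cword_T by (intro kronecker_anticommute) (simp add: gword_def)
    qed
  qed
  show ?thesis
    using main[of j k] main[of k j] assms by (cases "j < k") (auto simp: add.commute)
qed

text \<open>U_1 and U_2 square to -E and T squares to E, so the sign records whether the word
  contains a U.\<close>

lemma kronecker_gword_square:
  assumes "1 \<le> j" "a < 2 ^ m" "b < 2 ^ m"
  shows "kronecker (map2 kmult (gword m j) (gword m j)) a b = (if j \<le> 2 * m then - 1 else 1) * (if a = b then 1 else 0)"
proof -
  have "kscale (if j \<le> 2 * m then - 1 else 1) (map2 kmult (gword m j) (gword m j)) (replicate m mat_E)"
  proof (cases "j \<le> 2 * m")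
    case True
    define t where "t = (j - Suc 0) div 2"
    have "t < m"
      using True assms unfolding t_def by auto
    then have "m = (m - 1 - t) + Suc t"
      by simp
    then have E: "replicate m mat_E = replicate (m - 1 - t) mat_E @ [mat_E] @ replicate t mat_E"
      by (metis append_Cons append_Nil replicate_Suc replicate_add)
    have "kscale (1 * (- 1 * 1))
        (replicate (m - 1 - t) (kmult mat_E mat_E) @ [kmult (mat_U (sigma j)) (mat_U (sigma j))] @ replicate t (kmult mat_T mat_T))
        (replicate m mat_E)"
      unfolding E by (intro kscale_append kscale_replicate kscale_single) (auto simp: kmat_simps)
    then show ?thesis
      using True by (simp add: gword_def cword_def map2_replicate flip: t_def)
  next
    case False
    have "kscale 1 (replicate m (kmult mat_T mat_T)) (replicate m mat_E)"
      by (intro kscale_replicate) (simp add: kmat_simps)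
    then show ?thesis
      using False by (simp add: gword_def map2_replicate)
  qed
  then show ?thesis
    using assms by (simp add: kscale_kronecker kronecker_E)
qed

text \<open>E and T are Hermitian, U_1 and U_2 skew-Hermitian.\<close>

lemma kronecker_gword_adj:
  "cnj (kronecker (gword m j) b a) = (if j \<le> 2 * m then - 1 else 1) * kronecker (gword m j) a b"
proof -
  have "kscale (if j \<le> 2 * m then - 1 else 1) (map kadj (gword m j)) (gword m j)"
  proof (cases "j \<le> 2 * m")
    case True
    define t where "t = (j - Suc 0) div 2"
    have "kscale (1 * (- 1 * 1))
        (replicate (m - 1 - t) (kadj mat_E) @ [kadj (mat_U (sigma j))] @ replicate t (kadj mat_T))
        (replicate (m - 1 - t) mat_E @ [mat_U (sigma j)] @ replicate t mat_T)"
      by (intro kscale_append kscale_replicate kscale_single) (auto simp: kmat_simps)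
    then show ?thesis
      using True by (simp add: gword_def cword_def flip: t_def)
  next
    case False
    have "kscale 1 (replicate m (kadj mat_T)) (replicate m mat_T)"
      by (intro kscale_replicate) (simp add: kmat_simps)
    then show ?thesis
      using False by (simp add: gword_def)
  qed
  then show ?thesis
    by (simp add: kronecker_adj kscale_kronecker)
qed

section \<open>Clifford multiplication by the coordinate vectors\<close>

lemma coord_no_bounds: "1 \<le> coord_no (i :: 'n::{finite,linorder})" "coord_no i \<le> CARD('n)"
proof -
  have "card {..i} > 0"
    by (auto simp: card_gt_0_iff)
  then show "1 \<le> coord_no i"
    by (simp add: coord_no_def)
  show "coord_no i \<le> CARD('n)"
    unfolding coord_no_def by (intro card_mono) auto
qed

lemma strict_mono_coord_no: "strict_mono (coord_no :: 'n::{finite,linorder} \<Rightarrow> nat)"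
  unfolding coord_no_def by (intro strict_monoI psubset_card_mono) auto

lemma coord_no_inject: "coord_no i = coord_no j \<longleftrightarrow> i = (j :: 'n::{finite,linorder})"
  using strict_mono_eq[OF strict_mono_coord_no] .

lemma coord_no_surj:
  assumes "1 \<le> k" "k \<le> CARD('n)"
  obtains i :: "'n::{finite,linorder}" where "coord_no i = k"
proof -
  have "card (range (coord_no :: 'n \<Rightarrow> nat)) = CARD('n)"
    by (intro card_image) (simp add: inj_on_def coord_no_inject)
  moreover have "range (coord_no :: 'n \<Rightarrow> nat) \<subseteq> {1..CARD('n)}"
    using coord_no_bounds by auto
  ultimately have "range (coord_no :: 'n \<Rightarrow> nat) = {1..CARD('n)}"
    by (intro card_subset_eq) auto
  then show ?thesis
    using assms that by (metis atLeastAtMost_iff imageE)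
qed

lemma pseudo_inner_axis:
  "pseudo_inner p (axis i 1) (axis i 1) = (if coord_no i \<le> p then - 1 else 1)"
proof -
  have "(\<Sum>k | P k. axis i 1 $ k * axis i 1 $ k) = (if P i then 1 else (0::real))" for P
  proof -
    have "(\<Sum>k | P k. axis i 1 $ k * axis i 1 $ k) = (\<Sum>k\<in>{k. P k}. if k = i then 1 else (0::real))"
      by (intro sum.cong) (auto simp: axis_def)
    then show ?thesis
      by simp
  qed
  then show ?thesis
    by (simp add: pseudo_inner_def)
qed

lemma sum_spinor_index: "(\<Sum>c\<in>UNIV. f (spinor_no (c :: 'n spinor_index))) = (\<Sum>k<2 ^ (CARD('n) div 2). f k)"
proof (rule sum.reindex_bij_betw)
  have "range (spinor_no :: 'n spinor_index \<Rightarrow> nat) = {..<2 ^ (CARD('n) div 2)}"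
    using type_definition.Rep_range[OF type_definition_spinor_index] .
  then show "bij_betw (spinor_no :: 'n spinor_index \<Rightarrow> nat) UNIV {..<2 ^ (CARD('n) div 2)}"
    by (simp add: bij_betw_def inj_on_def spinor_no_inject)
qed

lemma spinor_no_less: "spinor_no (a :: 'n spinor_index) < 2 ^ (CARD('n) div 2)"
  using spinor_no[of a] by simp

lemma clifford_matrix_mult:
  fixes i k :: "'n::{finite,linorder}" and m :: nat
  defines "m \<equiv> CARD('n) div 2"
  shows "(clifford_matrix p i ** clifford_matrix p k) $ a $ b =
    gcoef m p (coord_no i) * gcoef m p (coord_no k) *
      kronecker (map2 kmult (gword m (coord_no i)) (gword m (coord_no k))) (spinor_no a) (spinor_no b)"
proof -
  have len: "length (gword m (coord_no i)) = m" "length (gword m (coord_no k)) = m"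
    by (rule length_gword[OF coord_no_bounds(1)])+
  have "(clifford_matrix p i ** clifford_matrix p k) $ a $ b =
      gcoef m p (coord_no i) * gcoef m p (coord_no k) *
      (\<Sum>c\<in>UNIV. kronecker (gword m (coord_no i)) (spinor_no a) (spinor_no (c :: 'n spinor_index)) *
        kronecker (gword m (coord_no k)) (spinor_no c) (spinor_no b))"
    by (simp add: matrix_matrix_mult_def clifford_matrix_def clifford_cmat_eq sum_distrib_left mult_ac flip: m_def)
  also have "(\<Sum>c\<in>UNIV. kronecker (gword m (coord_no i)) (spinor_no a) (spinor_no (c :: 'n spinor_index)) *
        kronecker (gword m (coord_no k)) (spinor_no c) (spinor_no b)) =
      kronecker (map2 kmult (gword m (coord_no i)) (gword m (coord_no k))) (spinor_no a) (spinor_no b)"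
    using kronecker_mult[of "gword m (coord_no i)" "gword m (coord_no k)"] len
    by (subst sum_spinor_index[where f = "\<lambda>c. kronecker (gword m (coord_no i)) (spinor_no a) c *
        kronecker (gword m (coord_no k)) c (spinor_no b)"]) (simp flip: m_def)
  finally show ?thesis .
qed


lemma clifford_matrix_anticommute:
  fixes i k :: "'n::{finite,linorder}"
  assumes "i \<noteq> k"
  shows "clifford_matrix p i ** clifford_matrix p k + clifford_matrix p k ** clifford_matrix p i = 0"
proof -
  let ?m = "CARD('n) div 2"
  have "coord_no i \<le> 2 * ?m + 1" "coord_no k \<le> 2 * ?m + 1"
    using coord_no_bounds(2)[of i] coord_no_bounds(2)[of k] by linarith+
  then have "kronecker (map2 kmult (gword ?m (coord_no i)) (gword ?m (coord_no k))) a b +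
      kronecker (map2 kmult (gword ?m (coord_no k)) (gword ?m (coord_no i))) a b = 0" for a b
    using assms coord_no_bounds(1) by (intro kronecker_gword_anticommute) (simp_all add: coord_no_inject)
  then have "(clifford_matrix p i ** clifford_matrix p k) $ a $ b + (clifford_matrix p k ** clifford_matrix p i) $ a $ b = 0" for a b
    unfolding clifford_matrix_mult by (metis (no_types, lifting) distrib_left mult.commute mult_zero_right)
  then show ?thesis
    by (simp add: vec_eq_iff)
qed

lemma clifford_matrix_square:
  fixes i :: "'n::{finite,linorder}"
  shows "clifford_matrix p i ** clifford_matrix p i = mat (- of_real (pseudo_inner p (axis i 1) (axis i 1)))"
proof -
  let ?m = "CARD('n) div 2"
  have "(clifford_matrix p i ** clifford_matrix p i) $ a $ b = mat (- of_real (pseudo_inner p (axis i 1) (axis i 1))) $ a $ b" for a b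
    using kronecker_gword_square[of "coord_no i" "spinor_no a" ?m "spinor_no b", OF coord_no_bounds(1) spinor_no_less spinor_no_less]
    unfolding clifford_matrix_mult
    by (auto simp: gcoef_def tau_def pseudo_inner_axis mat_def spinor_no_inject)
  then show ?thesis
    by (simp add: vec_eq_iff)
qed

text \<open>Before the factor \<open>tau\<close> all generators are skew-Hermitian. This factor
  multiplies the time-like ones by \<open>\<i>\<close> and so makes them Hermitian.\<close>

lemma clifford_matrix_adjoint:
  fixes i :: "'n::{finite,linorder}"
  shows "cnj (clifford_matrix p i $ b $ a) = - of_real (pseudo_inner p (axis i 1) (axis i 1)) * clifford_matrix p i $ a $ b"
  unfolding clifford_matrix_def
  by (auto simp: clifford_cmat_eq kronecker_gword_adj gcoef_def tau_def pseudo_inner_axis)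

lemma clifford_mult_axis: "clifford_mult p (axis i 1) v = clifford_matrix p i *v v"
proof -
  have "clifford_mult p (axis i 1) v = (\<Sum>k\<in>UNIV. if k = i then clifford_matrix p i *v v else 0)"
    unfolding clifford_mult_def by (intro sum.cong) (auto simp: axis_def)
  then show ?thesis
    by simp
qed

lemma Basis_Rn: "b \<in> Basis \<longleftrightarrow> (\<exists>i. b = (axis i 1 :: 'n::finite Rn))"
  by (auto simp: Basis_vec_def)

lemma clifford_mult_relation:
  fixes b c :: "'n::{finite,linorder} Rn"
  assumes "b \<in> Basis" "c \<in> Basis"
  shows "clifford_mult p b (clifford_mult p c v) + clifford_mult p c (clifford_mult p b v) =
    (if b = c then - 2 * pseudo_inner p b b else 0) *\<^sub>R v"
proof -
  obtain i k where ik: "b = axis i 1" "c = axis k 1"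
    using assms unfolding Basis_Rn by blast
  show ?thesis
  proof (cases "i = k")
    case True
    have "mat (- of_real r) *v v = (- r) *\<^sub>R v" for r :: real
    proof -
      have "(mat (- of_real r) *v v) $ a = ((- r) *\<^sub>R v) $ a" for a
      proof -
        have "(mat (- of_real r) *v v) $ a = (\<Sum>j\<in>UNIV. mat (- of_real r) $ a $ j * v $ j)"
          by (simp add: matrix_vector_mult_def)
        also have "\<dots> = (\<Sum>j\<in>UNIV. if j = a then - of_real r * v $ a else 0)"
          by (intro sum.cong refl) (auto simp: mat_def)
        finally show ?thesis
          by (simp add: scaleR_conv_of_real[where 'a = complex])
      qed
      then show ?thesis
        by (simp add: vec_eq_iff)
    qed
    then have "clifford_mult p b (clifford_mult p b v) = (- pseudo_inner p b b) *\<^sub>R v"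
      unfolding ik clifford_mult_axis matrix_vector_mul_assoc clifford_matrix_square .
    moreover have "(- r) *\<^sub>R v + (- r) *\<^sub>R v = (- 2 * r) *\<^sub>R v" for r
      by (simp only: scaleR_add_left[symmetric]) simp
    ultimately show ?thesis
      using True ik by (simp only: if_True refl)
  next
    case False
    then have "b \<noteq> c"
      unfolding ik by (simp add: axis_eq_axis)
    then show ?thesis
      unfolding ik clifford_mult_axis matrix_vector_mul_assoc
      by (simp add: clifford_matrix_anticommute[OF False] flip: matrix_vector_mult_add_rdistrib)
  qed
qed

lemma clifford_mult_adjoint:
  fixes b :: "'n::{finite,linorder} Rn"
  assumes "b \<in> Basis"
  shows "herm (clifford_mult p b v) w = herm v (- pseudo_inner p b b *\<^sub>R clifford_mult p b w)"
proof -
  obtain i where i: "b = axis i 1"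
    using assms unfolding Basis_Rn by blast
  let ?M = "clifford_matrix p i" and ?k = "of_real (pseudo_inner p b b) :: complex"
  have M: "cnj (?M $ c $ a) = - ?k * ?M $ a $ c" for a c
    using clifford_matrix_adjoint[of p i c a] by (simp add: i)
  have "herm (clifford_mult p b v) w = (\<Sum>a\<in>UNIV. \<Sum>c\<in>UNIV. ?M $ a $ c * v $ c * cnj (w $ a))"
    unfolding i clifford_mult_axis herm_def matrix_vector_mult_def by (simp add: sum_distrib_right)
  also have "\<dots> = (\<Sum>c\<in>UNIV. \<Sum>a\<in>UNIV. ?M $ a $ c * v $ c * cnj (w $ a))"
    by (rule sum.swap)
  also have "\<dots> = (\<Sum>c\<in>UNIV. v $ c * cnj ((- pseudo_inner p b b *\<^sub>R clifford_mult p b w) $ c))"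
  proof (intro sum.cong refl)
    fix c
    have "?M $ a $ c * v $ c * cnj (w $ a) = v $ c * cnj (- ?k * (?M $ c $ a * w $ a))" for a
    proof -
      have "cnj (- ?k * (?M $ c $ a * w $ a)) = - ?k * (- ?k * ?M $ a $ c * cnj (w $ a))"
        by (simp add: M)
      moreover have "?k * ?k = 1"
        by (simp add: i pseudo_inner_axis)
      ultimately show ?thesis
        by (simp add: mult_ac)
    qed
    then have "(\<Sum>a\<in>UNIV. ?M $ a $ c * v $ c * cnj (w $ a)) = v $ c * cnj (- ?k * (\<Sum>a\<in>UNIV. ?M $ c $ a * w $ a))"
      by (simp only: sum_distrib_left[symmetric] cnj_sum[symmetric])
    then show "(\<Sum>a\<in>UNIV. ?M $ a $ c * v $ c * cnj (w $ a)) = v $ c * cnj ((- pseudo_inner p b b *\<^sub>R clifford_mult p b w) $ c)"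
      unfolding i clifford_mult_axis by (simp add: matrix_vector_mult_def scaleR_conv_of_real[where 'a = complex])
  qed
  finally show ?thesis
    by (simp add: herm_def)
qed

lemma clifford_mult_scale: "clifford_mult p x (c *s v) = c *s clifford_mult p x v"
  by (simp add: clifford_mult_def vec_eq_iff matrix_vector_mult_def sum_distrib_left mult_ac)

section \<open>Systems of Clifford type with indefinite form are not bounded below\<close>

lemma integral_lborel_scale:
  fixes g :: "'a::euclidean_space \<Rightarrow> real"
  assumes [measurable]: "g \<in> borel_measurable borel" and c: "c > 0"
  shows "(\<integral>x. g (c *\<^sub>R x) \<partial>lborel) = inverse (c ^ DIM('a)) * (\<integral>x. g x \<partial>lborel)"
proof -
  have "(\<integral>x. g x \<partial>lborel) = integral\<^sup>L (density (distr lborel borel (\<lambda>x. 0 + c *\<^sub>R x)) (\<lambda>_. ennreal (\<bar>c\<bar> ^ DIM('a)))) g"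
    using lborel_affine[of c "0::'a"] c by simp
  also have "\<dots> = (\<integral>x. (\<bar>c\<bar> ^ DIM('a)) *\<^sub>R g x \<partial>(distr lborel borel (\<lambda>x. 0 + c *\<^sub>R x)))"
    by (rule integral_density) auto
  also have "\<dots> = (\<integral>x. (\<bar>c\<bar> ^ DIM('a)) *\<^sub>R g (0 + c *\<^sub>R x) \<partial>lborel)"
    by (rule integral_distr) auto
  finally show ?thesis
    using c by (simp add: field_simps)
qed

lemma test_functions_integrable_square:
  fixes f :: "'a::euclidean_space \<Rightarrow> complex"
  assumes f: "f \<in> test_functions"
  shows "integrable lborel (\<lambda>x. (cmod (f x))\<^sup>2)"
proof (rule integrable_continuous_bounded_support)
  show "continuous_on UNIV (\<lambda>x. (cmod (f x))\<^sup>2)"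
    by (intro continuous_intros test_functions_continuous f)
  show "bounded {x. (cmod (f x))\<^sup>2 \<noteq> 0}"
    using f by (simp add: test_functions_iff)
qed

lemma test_functions_cL2: "f \<in> test_functions \<Longrightarrow> cL2 f"
  by (simp add: cL2_def test_functions_continuous test_functions_integrable_square)

section \<open>The L2 norm of scalar functions\<close>

definition l2norm :: "('a::euclidean_space \<Rightarrow> complex) \<Rightarrow> real" where
  "l2norm f = sqrt (\<integral>x. (cmod (f x))\<^sup>2 \<partial>lborel)"

lemma l2norm_nonneg: "0 \<le> l2norm f"
  by (simp add: l2norm_def)

lemma bounded_linear_smult_vector: "bounded_linear (\<lambda>z. z *s (v :: complex^'s))"
proof (rule bounded_linear_intro[of _ "norm v"])
  show "(r *\<^sub>R z) *s v = r *\<^sub>R (z *s v)" for r :: real and z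
    by (simp add: vec_eq_iff)
qed (simp_all add: vector_sadd_rdistrib norm_scalar_mult)

lemma test_functions_smult:
  "f \<in> test_functions \<Longrightarrow> (\<lambda>x. f x *s (v :: complex^'s)) \<in> test_functions"
  by (rule test_functions_linear[OF bounded_linear_smult_vector])

lemma norm_L2_class_smult:
  fixes v :: "complex^'s"
  assumes f: "f \<in> test_functions"
  shows "norm (L2_class (\<lambda>x. f x *s v)) = l2norm f * norm v"
proof -
  have "(norm (L2_class (\<lambda>x. f x *s v)))\<^sup>2 = (l2norm f * norm v)\<^sup>2"
    using test_functions_square_integrable[OF test_functions_smult[OF f, of v]]
    by (simp add: norm_L2_class norm_scalar_mult power_mult_distrib l2norm_def)
  then show ?thesis
    by (simp add: l2norm_nonneg)
qed

lemma L2_class_add: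
  "square_integrable f \<Longrightarrow> square_integrable g \<Longrightarrow> L2_class f + L2_class g = L2_class (\<lambda>x. f x + g x)"
  by (simp add: plus_L2.abs_eq L2_rel_refl)

lemma norm_L2_class_mono:
  fixes f g :: "'a::euclidean_space \<Rightarrow> complex^'s"
  assumes f: "square_integrable f" and g: "square_integrable g"
    and le: "\<And>x. norm (f x) \<le> K * norm (g x)" and K: "0 \<le> K"
  shows "norm (L2_class f) \<le> K * norm (L2_class g)"
proof -
  have "(norm (L2_class f))\<^sup>2 \<le> (\<integral>x. K\<^sup>2 * (norm (g x))\<^sup>2 \<partial>lborel)"
    unfolding norm_L2_class[OF f]
  proof (rule integral_mono)
    show "(norm (f x))\<^sup>2 \<le> K\<^sup>2 * (norm (g x))\<^sup>2" for x
      using power_mono[OF le, of x 2] by (simp add: power_mult_distrib)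
  qed (use f g in \<open>simp_all add: square_integrable_def\<close>)
  also have "\<dots> = (K * norm (L2_class g))\<^sup>2"
    using g by (simp add: norm_L2_class power_mult_distrib)
  finally show ?thesis
    by (rule power2_le_imp_le) (use K in simp)
qed

text \<open>Scalars are embedded as multiples of a unit vector, which carries the triangle
  inequality over from the Hilbert space of vector-valued functions.\<close>

lemma l2norm_add:
  assumes f: "f \<in> test_functions" and g: "g \<in> test_functions"
  shows "l2norm (\<lambda>x. f x + g x) \<le> l2norm f + l2norm g"
proof -
  let ?v = "axis 1 1 :: complex^1"
  have v: "norm ?v = 1"
    by (simp add: norm_axis_1)
  have "norm (L2_class (\<lambda>x. (f x + g x) *s ?v)) = norm (L2_class (\<lambda>x. f x *s ?v) + L2_class (\<lambda>x. g x *s ?v))"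
    using f g by (simp add: L2_class_add test_functions_square_integrable test_functions_smult vector_sadd_rdistrib)
  also have "\<dots> \<le> norm (L2_class (\<lambda>x. f x *s ?v)) + norm (L2_class (\<lambda>x. g x *s ?v))"
    by (rule norm_triangle_ineq)
  finally show ?thesis
    unfolding norm_L2_class_smult[OF f] norm_L2_class_smult[OF g] norm_L2_class_smult[OF test_functions_add[OF f g]]
      v mult_1_right .
qed

lemma l2norm_mult: "(\<And>x. cmod (a x) = r) \<Longrightarrow> l2norm (\<lambda>x. a x * f x) = r * l2norm f"
proof -
  assume a: "\<And>x. cmod (a x) = r"
  have "r \<ge> 0"
    using norm_ge_zero a by metis
  then show ?thesis
    by (simp add: l2norm_def norm_mult a power_mult_distrib real_sqrt_mult)
qed

lemma l2norm_scale:
  fixes f :: "'a::euclidean_space \<Rightarrow> complex"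
  assumes f: "f \<in> test_functions" and c: "c > 0"
  shows "l2norm (\<lambda>x. f (c *\<^sub>R x)) = sqrt (inverse (c ^ DIM('a))) * l2norm f"
proof -
  have "continuous_on UNIV (\<lambda>x. (cmod (f x))\<^sup>2)"
    by (intro continuous_intros test_functions_continuous f)
  from integral_lborel_scale[OF borel_measurable_continuous_onI[OF this] c]
  show ?thesis
    by (simp add: l2norm_def real_sqrt_mult)
qed

lemma test_functions_scale: "f \<in> test_functions \<Longrightarrow> c > 0 \<Longrightarrow> (\<lambda>x. f (c *\<^sub>R x)) \<in> test_functions"
  using test_functions_affine[of c f 0] by simp

lemma test_functions_cmult:
  fixes f :: "'a::euclidean_space \<Rightarrow> complex"
  shows "f \<in> test_functions \<Longrightarrow> (\<lambda>x. c * f x) \<in> test_functions"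
  by (rule test_functions_linear[OF bounded_linear_mult_right])

section \<open>Plane waves\<close>

lemma has_partial_imp_partial_deriv:
  assumes "\<And>x. f differentiable (at x)" "has_partial b f f'"
  shows "partial_deriv b f = f'"
proof
  fix x
  show "partial_deriv b f x = f' x"
    using has_partial_differentiable[OF assms(1), of b] assms(2) vector_derivative_unique_at
    unfolding has_partial_def by blast
qed

lemma has_vector_derivative_exp_i:
  "((\<lambda>r. c * exp (\<i> * of_real R * of_real r)) has_vector_derivative
     c * (\<i> * of_real R) * exp (\<i> * of_real R * of_real r)) (at r)"
proof (rule has_vector_derivative_real_field[where f = "\<lambda>z. c * exp (\<i> * of_real R * z)"])
  show "((\<lambda>z. c * exp (\<i> * of_real R * z)) has_field_derivative
      c * (\<i> * of_real R) * exp (\<i> * of_real R * of_real r)) (at (of_real r))"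
    by (auto intro!: derivative_eq_intros)
qed

lemma C_diff_exp_i: "C_diff k (\<lambda>x. exp (\<i> * of_real R * of_real (x \<bullet> w)))"
proof -
  have "C_diff k (\<lambda>x. (\<i> * of_real R) ^ 0 * exp (\<i> * of_real R * of_real (x \<bullet> w)))"
    by (rule C_diff_comp_inner[where d = "\<lambda>j r. (\<i> * of_real R) ^ j * exp (\<i> * of_real R * of_real r)"])
      (unfold power_Suc2, rule has_vector_derivative_exp_i)
  then show ?thesis
    by simp
qed

lemma has_partial_exp_i:
  "has_partial b (\<lambda>x. exp (\<i> * of_real R * of_real (x \<bullet> w)))
     (\<lambda>x. \<i> * of_real (R * (b \<bullet> w)) * exp (\<i> * of_real R * of_real (x \<bullet> w)))"
  using has_partial_comp_inner[of "\<lambda>r. exp (\<i> * of_real R * of_real r)"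
      "\<lambda>r. \<i> * of_real R * exp (\<i> * of_real R * of_real r)" b w]
    has_vector_derivative_exp_i[of 1 R]
  by (simp add: scaleR_conv_of_real mult_ac)

lemma cmod_exp_i: "cmod (exp (\<i> * of_real R * of_real r)) = 1"
  using norm_exp_i_times[of "R * r"] by (simp add: mult.assoc)

context clifford_system
begin

lemma dop_smult:
  assumes h: "h \<in> test_functions"
  shows "dop (\<lambda>x. h x *s v) x = (\<Sum>b\<in>Basis. partial_deriv b h x *s B b v)"
  by (simp add: dop_def B_scale partial_deriv_linear[OF bounded_linear_smult_vector test_functions_differentiable[OF h]])

text \<open>The ultrahyperbolic operator of the form \<open>\<kappa>\<close>; the square of Q is its
  negative, applied componentwise.\<close>

definition wave :: "('a \<Rightarrow> complex) \<Rightarrow> 'a \<Rightarrow> complex" where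
  "wave h x = (\<Sum>b\<in>Basis. of_real (\<kappa> b) * partial_deriv b (partial_deriv b h) x)"

lemma wave_test_functions: "h \<in> test_functions \<Longrightarrow> wave h \<in> test_functions"
  unfolding wave_def[abs_def]
  by (intro test_functions_sum test_functions_cmult test_functions_partial_deriv)

text \<open>If \<open>\<mu> - Q\<close> is bounded below, then so is \<open>\<mu>\<^sup>2 + \<Sum> \<kappa> b \<partial>\<^sub>b\<^sup>2\<close> relative to \<open>\<mu> + Q\<close>, and the
  anticommutation relations turn this into a bound for each single partial derivative.\<close>

lemma partial_deriv_bound:
  assumes C: "0 \<le> C" "\<And>f. f \<in> test_functions \<Longrightarrow>
      norm (L2_class f) \<le> C * norm (L2_class (\<lambda>x. \<mu> *s f x - dop f x))"
    and k: "k \<in> Basis" and K: "0 \<le> K" "\<And>v. norm (B k v) \<le> K * norm v"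
    and h: "h \<in> test_functions"
  shows "\<bar>\<kappa> k\<bar> * l2norm (partial_deriv k h) \<le>
    K * (cmod \<mu> * l2norm h + C * l2norm (\<lambda>x. \<mu> * \<mu> * h x + wave h x))"
proof -
  define T where "T = cmod \<mu> * l2norm h + C * l2norm (\<lambda>x. \<mu> * \<mu> * h x + wave h x)"
  have T: "0 \<le> T"
    using C by (simp add: T_def l2norm_nonneg)
  note sm = test_functions_smult and si = test_functions_square_integrable
  have hw: "(\<lambda>x. \<mu> * \<mu> * h x + wave h x) \<in> test_functions"
    by (intro test_functions_add test_functions_cmult h wave_test_functions)
  \<comment> \<open>With psi = (mu + Q)(h v) the factorisation gives (mu - Q) psi = (P h) v, so the
    assumed estimate bounds psi, and Q (h v) = psi - mu h v.\<close>
  have bound: "norm (L2_class (dop (\<lambda>x. h x *s v))) \<le> T * norm v" for v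
  proof -
    let ?f = "\<lambda>x. h x *s v"
    define \<psi> where "\<psi> y = \<mu> *s ?f y + dop ?f y" for y
    have \<psi>: "\<psi> \<in> test_functions"
      unfolding \<psi>_def
      by (intro test_functions_add dop_test_functions sm h test_functions_linear[OF bounded_linear_vector_smult])
    have "partial_deriv b (partial_deriv b ?f) = (\<lambda>x. partial_deriv b (partial_deriv b h) x *s v)" if "b \<in> Basis" for b
      using h that by (simp add: partial_deriv_linear[OF bounded_linear_smult_vector]
          test_functions_differentiable test_functions_partial_deriv)
    then have "(\<Sum>b\<in>Basis. \<kappa> b *\<^sub>R partial_deriv b (partial_deriv b ?f) y) =
        (\<Sum>b\<in>Basis. \<kappa> b *\<^sub>R (partial_deriv b (partial_deriv b h) y *s v))" for y
      by (intro sum.cong refl) simp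
    also have "(\<Sum>b\<in>Basis. \<kappa> b *\<^sub>R (partial_deriv b (partial_deriv b h) y *s v)) = wave h y *s v" for y
      by (simp add: wave_def vec_eq_iff sum_distrib_right scaleR_conv_of_real[where 'a = complex] mult.assoc)
    finally have wave: "(\<Sum>b\<in>Basis. \<kappa> b *\<^sub>R partial_deriv b (partial_deriv b ?f) y) = wave h y *s v" for y .
    have eq: "(\<lambda>y. \<mu> *s \<psi> y - dop \<psi> y) = (\<lambda>y. (\<mu> * \<mu> * h y + wave h y) *s v)"
      unfolding \<psi>_def[abs_def] dop_factor[OF sm[OF h]] wave
      by (simp add: fun_eq_iff vector_smult_assoc vector_sadd_rdistrib)
    have "norm (L2_class \<psi>) \<le> C * (l2norm (\<lambda>x. \<mu> * \<mu> * h x + wave h x) * norm v)"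
      using C(2)[OF \<psi>] unfolding eq norm_L2_class_smult[OF hw] .
    moreover have "L2_class (dop ?f) = L2_class \<psi> + L2_class (\<lambda>x. (- \<mu> * h x) *s v)"
    proof -
      have "dop ?f = (\<lambda>x. \<psi> x + (- \<mu> * h x) *s v)"
        by (simp add: \<psi>_def fun_eq_iff vec_eq_iff)
      then show ?thesis
        using si[OF \<psi>] si[OF sm[OF test_functions_cmult[OF h, of "- \<mu>"], of v]] by (simp add: L2_class_add)
    qed
    moreover have "norm (L2_class (\<lambda>x. (- \<mu> * h x) *s v)) = cmod \<mu> * l2norm h * norm v"
      using norm_L2_class_smult[OF test_functions_cmult[OF h, of "- \<mu>"], of v] l2norm_mult[of "\<lambda>_. - \<mu>" "cmod \<mu>" h]
      by simp
    ultimately have "norm (L2_class (dop ?f)) \<le>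
        C * (l2norm (\<lambda>x. \<mu> * \<mu> * h x + wave h x) * norm v) + cmod \<mu> * l2norm h * norm v"
      using norm_triangle_ineq[of "L2_class \<psi>" "L2_class (\<lambda>x. (- \<mu> * h x) *s v)"] by simp
    then show ?thesis
      by (simp add: T_def algebra_simps)
  qed
  define v :: "complex^'s" where "v = axis undefined 1"
  have v: "norm v = 1"
    by (simp add: v_def norm_axis_1)
  let ?d = "dop (\<lambda>x. h x *s v)" and ?d' = "dop (\<lambda>x. h x *s B k v)"
  \<comment> \<open>The anticommutator of \<open>B k\<close> with the coefficients of Q is nonzero
    only at \<open>k\<close>, which isolates a single derivative of \<open>h\<close>.\<close>
  have "B k (?d x) + ?d' x = (- 2 * of_real (\<kappa> k) * partial_deriv k h x) *s v" for x
  proof -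
    have "B k (?d x) + ?d' x = (\<Sum>b\<in>Basis. partial_deriv b h x *s (B k (B b v) + B b (B k v)))"
      by (simp add: dop_smult[OF h] linear_sum[OF bounded_linear.linear[OF bounded_linear_B]] B_scale
          vector_add_ldistrib sum.distrib)
    also have "\<dots> = (\<Sum>b\<in>Basis. if b = k then partial_deriv k h x *s ((- 2 * \<kappa> k) *\<^sub>R v) else 0)"
      using k by (intro sum.cong refl) (auto simp: anticommutator)
    also have "\<dots> = (- 2 * of_real (\<kappa> k) * partial_deriv k h x) *s v"
      using k by (simp add: vec_eq_iff scaleR_conv_of_real[where 'a = complex])
    finally show ?thesis .
  qed
  then have eq: "(\<lambda>x. B k (?d x) + ?d' x) = (\<lambda>x. (- 2 * of_real (\<kappa> k) * partial_deriv k h x) *s v)"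
    by blast
  have d: "?d \<in> test_functions" "?d' \<in> test_functions" "(\<lambda>x. B k (?d x)) \<in> test_functions"
    by (intro dop_test_functions sm h test_functions_linear[OF bounded_linear_B])+
  have "2 * (\<bar>\<kappa> k\<bar> * l2norm (partial_deriv k h)) = norm (L2_class (\<lambda>x. (- 2 * of_real (\<kappa> k) * partial_deriv k h x) *s v))"
    using norm_L2_class_smult[OF test_functions_cmult[OF test_functions_partial_deriv[OF h k], of "- 2 * of_real (\<kappa> k)"], of v] v
      l2norm_mult[of "\<lambda>_. - 2 * of_real (\<kappa> k)" "2 * \<bar>\<kappa> k\<bar>" "partial_deriv k h"]
    by (simp add: norm_mult)
  also have "\<dots> = norm (L2_class (\<lambda>x. B k (?d x)) + L2_class ?d')"
    using d by (simp add: L2_class_add si eq)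
  also have "\<dots> \<le> norm (L2_class (\<lambda>x. B k (?d x))) + norm (L2_class ?d')"
    by (rule norm_triangle_ineq)
  also have "norm (L2_class (\<lambda>x. B k (?d x))) \<le> K * norm (L2_class ?d)"
    by (rule norm_L2_class_mono) (use d K si in auto)
  also have "K * norm (L2_class ?d) \<le> K * T"
    using bound[of v] v K by (intro mult_left_mono) auto
  also have "norm (L2_class ?d') \<le> T * K"
    using bound[of "B k v"] K(2)[of v] v T by (auto intro: order_trans mult_left_mono)
  finally show ?thesis
    by (simp add: T_def)
qed

text \<open>All terms of order R^2 in \<open>wave h\<close> share the factor
  \<open>\<kappa> b1 + \<kappa> b2 = 0\<close>: the frequency is a null vector. Each remaining term
  differentiates the dilated envelope at least once and so carries a factor
  \<open>\<epsilon>\<close>, while the derivative along \<open>b1\<close> keeps a term of size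
  \<open>R\<close>.\<close>

lemma wave_packet:
  fixes \<phi> :: "'a \<Rightarrow> complex" and R \<epsilon> :: real
  assumes b12: "b1 \<in> Basis" "b2 \<in> Basis" "\<kappa> b1 + \<kappa> b2 = 0"
    and \<phi>: "\<phi> \<in> test_functions" and \<epsilon>: "\<epsilon> > 0"
  defines "w \<equiv> b1 + b2"
  defines "e \<equiv> \<lambda>x. exp (\<i> * of_real R * of_real (x \<bullet> w))"
  defines "h \<equiv> \<lambda>x. e x * \<phi> (\<epsilon> *\<^sub>R x)"
  defines "G \<equiv> \<lambda>x. \<Sum>b\<in>Basis. of_real (\<kappa> b * (b \<bullet> w)) * partial_deriv b \<phi> x"
  shows "h \<in> test_functions"
    and "partial_deriv b1 h x = e x * (of_real \<epsilon> * partial_deriv b1 \<phi> (\<epsilon> *\<^sub>R x) + \<i> * of_real R * \<phi> (\<epsilon> *\<^sub>R x))"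
    and "wave h x = e x * (of_real (\<epsilon>\<^sup>2) * wave \<phi> (\<epsilon> *\<^sub>R x) + 2 * \<i> * of_real (R * \<epsilon>) * G (\<epsilon> *\<^sub>R x))"
proof -
  have neq: "b1 \<noteq> b2"
    using b12 \<kappa>_nonzero by force
  have bw: "b \<bullet> w = (if b = b1 \<or> b = b2 then 1 else 0)" if "b \<in> Basis" for b
    using that b12 neq by (auto simp: w_def inner_add_right inner_Basis)
  show h: "h \<in> test_functions"
    unfolding h_def e_def
    by (rule test_functions_bilinear[OF bounded_bilinear_mult test_functions_scale[OF \<phi> \<epsilon>] C_diff_exp_i])
  note mult = has_partial_bilinear[OF bounded_bilinear_mult]
  have e: "has_partial b e (\<lambda>x. \<i> * of_real (R * (b \<bullet> w)) * e x)" for b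
    unfolding e_def by (rule has_partial_exp_i)
  have scale: "has_partial b (\<lambda>x. f (\<epsilon> *\<^sub>R x)) (\<lambda>x. of_real \<epsilon> * partial_deriv b f (\<epsilon> *\<^sub>R x))"
    if f: "f \<in> test_functions" for f :: "'a \<Rightarrow> complex" and b
    using test_functions_has_partial[OF test_functions_scale[OF f \<epsilon>], of b]
      partial_deriv_affine(1)[OF test_functions_differentiable[OF f], of b \<epsilon> 0]
    by (simp add: scaleR_conv_of_real)
  have p1: "partial_deriv b h = (\<lambda>x. e x * (of_real \<epsilon> * partial_deriv b \<phi> (\<epsilon> *\<^sub>R x)) + \<i> * of_real (R * (b \<bullet> w)) * e x * \<phi> (\<epsilon> *\<^sub>R x))" for b
    by (rule has_partial_imp_partial_deriv[OF test_functions_differentiable[OF h]])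
      (unfold h_def, rule mult[OF e scale[OF \<phi>]])
  show "partial_deriv b1 h x = e x * (of_real \<epsilon> * partial_deriv b1 \<phi> (\<epsilon> *\<^sub>R x) + \<i> * of_real R * \<phi> (\<epsilon> *\<^sub>R x))"
    using bw[OF b12(1)] by (simp add: p1 algebra_simps)
  have p2: "partial_deriv b (partial_deriv b h) x = e x * (of_real (\<epsilon>\<^sup>2) * partial_deriv b (partial_deriv b \<phi>) (\<epsilon> *\<^sub>R x)
      + 2 * \<i> * of_real (R * \<epsilon> * (b \<bullet> w)) * partial_deriv b \<phi> (\<epsilon> *\<^sub>R x) - of_real (R\<^sup>2 * (b \<bullet> w)\<^sup>2) * \<phi> (\<epsilon> *\<^sub>R x))"
    if b: "b \<in> Basis" for b
  proof -
    have cm: "has_partial b (\<lambda>x. c * f x) (\<lambda>x. c * f' x)" if "has_partial b f f'" for c and f f' :: "'a \<Rightarrow> complex"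
      by (rule has_partial_linear[OF bounded_linear_mult_right that])
    have "has_partial b (partial_deriv b h) (\<lambda>x.
        (e x * (of_real \<epsilon> * (of_real \<epsilon> * partial_deriv b (partial_deriv b \<phi>) (\<epsilon> *\<^sub>R x)))
          + (\<i> * of_real (R * (b \<bullet> w)) * e x) * (of_real \<epsilon> * partial_deriv b \<phi> (\<epsilon> *\<^sub>R x)))
        + ((\<i> * of_real (R * (b \<bullet> w)) * e x) * (of_real \<epsilon> * partial_deriv b \<phi> (\<epsilon> *\<^sub>R x))
          + (\<i> * of_real (R * (b \<bullet> w)) * (\<i> * of_real (R * (b \<bullet> w)) * e x)) * \<phi> (\<epsilon> *\<^sub>R x)))"
      unfolding p1
      by (rule has_partial_add[OF mult[OF e cm[OF scale[OF test_functions_partial_deriv[OF \<phi> b]]]] mult[OF cm[OF e] scale[OF \<phi>]]])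
    from fun_cong[OF has_partial_imp_partial_deriv[OF test_functions_differentiable[OF test_functions_partial_deriv[OF h b]] this], of x]
    show ?thesis
      by (simp add: algebra_simps power2_eq_square)
  qed
  have "wave h x = (\<Sum>b\<in>Basis. e x * (of_real (\<epsilon>\<^sup>2) * (of_real (\<kappa> b) * partial_deriv b (partial_deriv b \<phi>) (\<epsilon> *\<^sub>R x))
      + 2 * \<i> * of_real (R * \<epsilon>) * (of_real (\<kappa> b * (b \<bullet> w)) * partial_deriv b \<phi> (\<epsilon> *\<^sub>R x))
      - of_real (R\<^sup>2) * \<phi> (\<epsilon> *\<^sub>R x) * of_real (\<kappa> b * (b \<bullet> w)\<^sup>2)))"
    unfolding wave_def by (intro sum.cong refl) (simp add: p2 algebra_simps)
  also have "\<dots> = e x * (of_real (\<epsilon>\<^sup>2) * wave \<phi> (\<epsilon> *\<^sub>R x) + 2 * \<i> * of_real (R * \<epsilon>) * G (\<epsilon> *\<^sub>R x)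
      - of_real (R\<^sup>2) * \<phi> (\<epsilon> *\<^sub>R x) * of_real (\<Sum>b\<in>Basis. \<kappa> b * (b \<bullet> w)\<^sup>2))"
    by (simp only: wave_def G_def of_real_sum sum_distrib_left sum.distrib sum_subtractf distrib_left right_diff_distrib)
  also have "(\<Sum>b\<in>Basis. \<kappa> b * (b \<bullet> w)\<^sup>2) = (\<Sum>b\<in>{b1, b2}. \<kappa> b)"
    using b12 by (intro sum.mono_neutral_cong_right) (auto simp: bw)
  also have "\<dots> = 0"
    using b12 neq by simp
  finally show "wave h x = e x * (of_real (\<epsilon>\<^sup>2) * wave \<phi> (\<epsilon> *\<^sub>R x) + 2 * \<i> * of_real (R * \<epsilon>) * G (\<epsilon> *\<^sub>R x))"
    by simp
qed

text \<open>Wave packets with a null frequency \<open>R (b1 + b2)\<close>: \<open>wave\<close> stays bounded on them, while the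
  partial derivative along \<open>b1\<close> grows linearly in \<open>R\<close>.\<close>

theorem not_bounded_below:
  assumes b12: "b1 \<in> Basis" "b2 \<in> Basis" "\<kappa> b1 + \<kappa> b2 = 0"
  shows "\<not> (\<forall>f\<in>test_functions. norm (L2_class f) \<le> C * norm (L2_class (\<lambda>x. \<mu> *s f x - dop f x)))"
proof
  assume bnd: "\<forall>f\<in>test_functions. norm (L2_class f) \<le> C * norm (L2_class (\<lambda>x. \<mu> *s f x - dop f x))"
  \<comment> \<open>A nonnegative constant is needed for multiplying the estimates below.\<close>
  define C' where "C' = max C 0"
  have C'0: "0 \<le> C'"
    by (simp add: C'_def)
  have C'bnd: "norm (L2_class f) \<le> C' * norm (L2_class (\<lambda>x. \<mu> *s f x - dop f x))"
    if "f \<in> test_functions" for f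
  proof -
    have "norm (L2_class f) \<le> C * norm (L2_class (\<lambda>x. \<mu> *s f x - dop f x))"
      using bnd that by blast
    also have "\<dots> \<le> C' * norm (L2_class (\<lambda>x. \<mu> *s f x - dop f x))"
      by (rule mult_right_mono) (simp_all add: C'_def)
    finally show ?thesis .
  qed
  note C' = C'0 C'bnd
  obtain K where K: "0 \<le> K" "\<And>v. norm (B b1 v) \<le> K * norm v"
    using bounded_linear.nonneg_bounded[OF bounded_linear_B, of b1] by (metis mult.commute)
  define \<phi> :: "'a \<Rightarrow> complex" where "\<phi> x = of_real (box_bump (- One) One 1 x)" for x
  have \<phi>: "\<phi> \<in> test_functions"
    unfolding \<phi>_def[abs_def] by (rule test_functions_linear[OF bounded_linear_of_real box_bump_test_function]) simp
  have "\<phi> 0 \<noteq> 0"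
    using box_bump_nonzero[of 1 "- One" One "0::'a"] by (simp add: \<phi>_def mem_box)
  then have "(\<integral>x. (cmod (\<phi> x))\<^sup>2 \<partial>lborel) \<noteq> 0"
    using cL2_integral_eq_0[OF test_functions_cL2[OF \<phi>]] by blast
  then have S0: "l2norm \<phi> > 0"
    by (simp add: l2norm_def order_less_le)
  define G where "G x = (\<Sum>b\<in>Basis. of_real (\<kappa> b * (b \<bullet> (b1 + b2))) * partial_deriv b \<phi> x)" for x
  have G: "G \<in> test_functions"
    unfolding G_def[abs_def] by (intro test_functions_sum test_functions_cmult test_functions_partial_deriv \<phi>)
  \<comment> \<open>The coefficient of \<open>l2norm \<phi>\<close> that survives in the upper bound
    when \<open>\<epsilon>\<close> tends to 0.\<close>
  define A where "A = K * (cmod \<mu> + C' * (cmod \<mu>)\<^sup>2)"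
  define k where "k = \<bar>\<kappa> b1\<bar>"
  have k: "k > 0"
    using \<kappa>_nonzero[OF b12(1)] by (simp add: k_def)
  \<comment> \<open>Chosen so that \<open>k * R\<close> exceeds \<open>A\<close> by 1; what remains
    of the estimate is then \<open>l2norm \<phi> \<le> \<epsilon> * M\<close>. Both \<open>R\<close>
    and \<open>M\<close> are fixed before \<open>\<epsilon>\<close>.\<close>
  define R where "R = (A + 1) / k"
  have R: "R \<ge> 0"
    using k K C' by (simp add: R_def A_def)
  define M where "M = k * l2norm (partial_deriv b1 \<phi>) + K * (C' * (l2norm (wave \<phi>) + 2 * R * l2norm G))"
  have M: "M \<ge> 0"
    using k K C' R by (auto simp: M_def l2norm_nonneg)
  have key: "k * R * l2norm \<phi> \<le> A * l2norm \<phi> + \<epsilon> * M" if \<epsilon>: "0 < \<epsilon>" "\<epsilon> \<le> 1" for \<epsilon>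
  proof -
    define e where "e x = exp (\<i> * of_real R * of_real (x \<bullet> (b1 + b2)))" for x
    define h where "h x = e x * \<phi> (\<epsilon> *\<^sub>R x)" for x
    \<comment> \<open>The factor by which the dilation changes every norm. It is common to all terms
      and cancels at the end.\<close>
    define s where "s = sqrt (inverse (\<epsilon> ^ DIM('a)))"
    have s: "s > 0"
      using \<epsilon> by (simp add: s_def)
    have e: "cmod (e x) = 1" for x
      unfolding e_def by (rule cmod_exp_i)
    have em: "l2norm (\<lambda>x. e x * f x) = l2norm f" for f
      using l2norm_mult[of e 1 f] e by simp
    have packet: "h \<in> test_functions"
      "partial_deriv b1 h x = e x * (of_real \<epsilon> * partial_deriv b1 \<phi> (\<epsilon> *\<^sub>R x) + \<i> * of_real R * \<phi> (\<epsilon> *\<^sub>R x))"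
      "wave h x = e x * (of_real (\<epsilon>\<^sup>2) * wave \<phi> (\<epsilon> *\<^sub>R x) + 2 * \<i> * of_real (R * \<epsilon>) * G (\<epsilon> *\<^sub>R x))" for x
      unfolding h_def[abs_def] e_def G_def by (rule wave_packet[OF b12 \<phi> \<epsilon>(1)])+
    have scale: "l2norm (\<lambda>x. f (\<epsilon> *\<^sub>R x)) = s * l2norm f" "(\<lambda>x. f (\<epsilon> *\<^sub>R x)) \<in> test_functions"
      if "f \<in> test_functions" for f :: "'a \<Rightarrow> complex"
      unfolding s_def using that \<epsilon> by (auto intro: l2norm_scale test_functions_scale)
    have cm: "l2norm (\<lambda>x. c * f x) = cmod c * l2norm f" for c f
      by (rule l2norm_mult) simp
    note pd = test_functions_partial_deriv
    have n0: "l2norm h = s * l2norm \<phi>"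
      unfolding h_def[abs_def] using em scale(1)[OF \<phi>] by simp
    have n1: "R * (s * l2norm \<phi>) \<le> l2norm (partial_deriv b1 h) + \<epsilon> * (s * l2norm (partial_deriv b1 \<phi>))"
    proof -
      define u where "u x = of_real \<epsilon> * partial_deriv b1 \<phi> (\<epsilon> *\<^sub>R x) + \<i> * of_real R * \<phi> (\<epsilon> *\<^sub>R x)" for x
      have u: "u \<in> test_functions"
        unfolding u_def[abs_def] by (intro test_functions_add test_functions_cmult scale(2) pd \<phi> b12)
      have "l2norm (partial_deriv b1 h) = l2norm (\<lambda>x. e x * u x)"
        by (rule arg_cong[where f = l2norm]) (simp add: fun_eq_iff packet u_def)
      then have u1: "l2norm (partial_deriv b1 h) = l2norm u"
        using em by simp
      have "l2norm (\<lambda>x. (\<i> * of_real R) * \<phi> (\<epsilon> *\<^sub>R x)) =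
          l2norm (\<lambda>x. u x + (- of_real \<epsilon>) * partial_deriv b1 \<phi> (\<epsilon> *\<^sub>R x))"
        by (simp add: u_def)
      also have "\<dots> \<le> l2norm u + l2norm (\<lambda>x. (- of_real \<epsilon>) * partial_deriv b1 \<phi> (\<epsilon> *\<^sub>R x))"
        by (intro l2norm_add u test_functions_cmult scale(2) pd \<phi> b12)
      finally show ?thesis
        unfolding cm scale(1)[OF \<phi>] scale(1)[OF pd[OF \<phi> b12(1)]] u1 using R \<epsilon> by (simp add: norm_mult)
    qed
    have n2: "l2norm (\<lambda>x. \<mu> * \<mu> * h x + wave h x) \<le>
        (cmod \<mu>)\<^sup>2 * (s * l2norm \<phi>) + \<epsilon> * (s * (l2norm (wave \<phi>) + 2 * R * l2norm G))"
    proof -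
      define u where "u x = of_real (\<epsilon>\<^sup>2) * wave \<phi> (\<epsilon> *\<^sub>R x) + 2 * \<i> * of_real (R * \<epsilon>) * G (\<epsilon> *\<^sub>R x)" for x
      have "l2norm (wave h) = l2norm (\<lambda>x. e x * u x)"
        by (rule arg_cong[where f = l2norm]) (simp add: fun_eq_iff packet u_def)
      then have "l2norm (wave h) = l2norm u"
        using em by simp
      also have "\<dots> \<le> l2norm (\<lambda>x. of_real (\<epsilon>\<^sup>2) * wave \<phi> (\<epsilon> *\<^sub>R x)) + l2norm (\<lambda>x. (2 * \<i> * of_real (R * \<epsilon>)) * G (\<epsilon> *\<^sub>R x))"
        unfolding u_def[abs_def] by (intro l2norm_add test_functions_cmult scale(2) wave_test_functions \<phi> G)
      also have "\<dots> = \<epsilon>\<^sup>2 * (s * l2norm (wave \<phi>)) + 2 * (R * \<epsilon>) * (s * l2norm G)"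
        unfolding cm scale(1)[OF wave_test_functions[OF \<phi>]] scale(1)[OF G] using R \<epsilon> by (simp add: norm_mult norm_power)
      also have "\<dots> \<le> \<epsilon> * (s * l2norm (wave \<phi>)) + 2 * (R * \<epsilon>) * (s * l2norm G)"
        using \<epsilon> s l2norm_nonneg[of "wave \<phi>"]
        by (intro add_right_mono mult_right_mono) (auto simp: power2_eq_square mult_left_le)
      finally have "l2norm (wave h) \<le> \<epsilon> * (s * (l2norm (wave \<phi>) + 2 * R * l2norm G))"
        by (simp add: algebra_simps)
      moreover have "l2norm (\<lambda>x. \<mu> * \<mu> * h x + wave h x) \<le> l2norm (\<lambda>x. (\<mu> * \<mu>) * h x) + l2norm (wave h)"
        by (intro l2norm_add test_functions_cmult packet wave_test_functions)
      ultimately show ?thesis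
        unfolding cm n0 by (simp add: norm_mult power2_eq_square)
    qed
    have "k * l2norm (partial_deriv b1 h) \<le> K * (cmod \<mu> * l2norm h + C' * l2norm (\<lambda>x. \<mu> * \<mu> * h x + wave h x))"
      unfolding k_def by (rule partial_deriv_bound[OF C' b12(1) K packet(1)])
    also have "\<dots> \<le> K * (cmod \<mu> * (s * l2norm \<phi>) + C' *
        ((cmod \<mu>)\<^sup>2 * (s * l2norm \<phi>) + \<epsilon> * (s * (l2norm (wave \<phi>) + 2 * R * l2norm G))))"
      unfolding n0 using n2 K C' by (intro mult_left_mono add_left_mono)
    finally have "k * l2norm (partial_deriv b1 h) \<le> \<dots>" .
    moreover have "k * (R * (s * l2norm \<phi>)) \<le> k * (l2norm (partial_deriv b1 h) + \<epsilon> * (s * l2norm (partial_deriv b1 \<phi>)))"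
      using n1 k by (intro mult_left_mono) auto
    ultimately have "s * (k * R * l2norm \<phi>) \<le> s * (A * l2norm \<phi> + \<epsilon> * M)"
      by (simp add: A_def M_def algebra_simps)
    then show ?thesis
      using s by simp
  qed
  have "k * R = A + 1"
    using k by (simp add: R_def)
  then have small: "l2norm \<phi> \<le> \<epsilon> * M" if "0 < \<epsilon>" "\<epsilon> \<le> 1" for \<epsilon>
    using key[OF that] by (simp add: algebra_simps)
  \<comment> \<open>Small enough to make the error at most half of \<open>l2norm \<phi>\<close>;
    \<open>M + 1\<close> avoids a division by 0.\<close>
  define \<epsilon> where "\<epsilon> = min 1 (l2norm \<phi> / (2 * (M + 1)))"
  have "0 < \<epsilon>" "\<epsilon> \<le> 1"
    using S0 M by (auto simp: \<epsilon>_def)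
  then have "l2norm \<phi> \<le> \<epsilon> * M"
    by (rule small)
  also have "\<epsilon> * M \<le> l2norm \<phi> / (2 * (M + 1)) * (M + 1)"
    using M S0 by (intro mult_mono) (auto simp: \<epsilon>_def)
  also have "l2norm \<phi> / (2 * (M + 1)) * (M + 1) = l2norm \<phi> / 2"
  proof -
    have "M + 1 \<noteq> 0"
      using M by linarith
    then show ?thesis
      by (simp add: field_simps)
  qed
  finally show False
    using S0 by linarith
qed

end

section \<open>The spectrum of the Dirac operator\<close>

lemma test_functions_zero: "(\<lambda>x. 0) \<in> test_functions"
  by (simp add: test_functions_iff C_diff_zero)

lemma inner_L2_class:
  "square_integrable f \<Longrightarrow> square_integrable g \<Longrightarrow>
    inner (L2_class f) (L2_class g) = Re (\<integral>x. herm (f x) (g x) \<partial>lborel)"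
  by (simp add: inner_L2_def L2_cinner.abs_eq L2_rel_refl)

lemma inner_scaleC_cnj: "inner (cnj c *\<^sub>C a) b = inner a (c *\<^sub>C (b :: 'h::complex_hilbert_space))"
proof -
  have "cinner a (c *\<^sub>C b) = cnj c * cinner a b"
    using cinner_commute[of a "c *\<^sub>C b"] cinner_commute[of a b] by (simp add: cinner_scaleC_left)
  then show ?thesis
    by (simp add: inner_eq_Re_cinner cinner_scaleC_left)
qed

lemma bounded_bilinear_herm: "bounded_bilinear (herm :: complex^'s \<Rightarrow> complex^'s \<Rightarrow> complex)"
proof
  fix u u' v v' :: "complex^'s" and r :: real
  show "herm (u + u') v = herm u v + herm u' v"
    by (rule herm_add_left)
  show "herm u (v + v') = herm u v + herm u v'"
    using herm_add_left[of v v' u] herm_commute[of u] by (metis complex_cnj_add)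
  show "herm (r *\<^sub>R u) v = r *\<^sub>R herm u v"
    by (simp add: herm_scaleR_left scaleR_conv_of_real[where 'a = complex])
  show "herm u (r *\<^sub>R v) = r *\<^sub>R herm u v"
    using herm_scaleR_left[of r v u] herm_commute[of u]
    by (metis complex_cnj_complex_of_real complex_cnj_mult scaleR_conv_of_real)
  show "\<exists>K. \<forall>u v. norm (herm u v) \<le> norm u * norm (v :: complex^'s) * K"
    using cmod_herm_le_mult by (metis mult.commute)
qed

lemma integral_herm_by_parts:
  assumes f: "f \<in> test_functions" and g: "g \<in> test_functions" and b: "b \<in> Basis"
  shows "(\<integral>x. herm (partial_deriv b f x) (g x) \<partial>lborel) = - (\<integral>x. herm (f x) (partial_deriv b g x) \<partial>lborel)"
proof -
  note sq = test_functions_square_integrable and pd = test_functions_partial_deriv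
  have i: "integrable lborel (\<lambda>x. herm (f x) (partial_deriv b g x))"
    "integrable lborel (\<lambda>x. herm (partial_deriv b f x) (g x))" "integrable lborel (\<lambda>x. herm (f x) (g x))"
    using f g b by (auto intro!: integrable_herm sq pd)
  have "(\<integral>x. herm (f x) (partial_deriv b g x) + herm (partial_deriv b f x) (g x) \<partial>lborel) = 0"
  proof (rule integral_partial_eq_0)
    show "has_partial b (\<lambda>x. herm (f x) (g x)) (\<lambda>x. herm (f x) (partial_deriv b g x) + herm (partial_deriv b f x) (g x))"
      by (intro has_partial_bilinear[OF bounded_bilinear_herm] test_functions_has_partial f g)
    show "continuous_on UNIV (\<lambda>x. herm (f x) (partial_deriv b g x) + herm (partial_deriv b f x) (g x))"
      by (intro continuous_on_add bounded_bilinear.continuous_on[OF bounded_bilinear_herm]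
          test_functions_continuous pd f g b)
  qed (use i in auto)
  then show ?thesis
    using i by (simp add: add_eq_0_iff)
qed

text \<open>Otherwise a nonzero vector would be orthogonal to the range, that is, a nonzero
  square-integrable weak solution.\<close>

lemma (in clifford_system) dense_range:
  "closure {L2_class (\<lambda>x. \<mu> *s f x - dop f x) | f. f \<in> test_functions} = UNIV"
proof (rule ccontr)
  define T where "T f x = \<mu> *s f x - dop f x" for f x
  define V where "V = {L2_class (T f) | f. f \<in> test_functions}"
  assume "closure {L2_class (\<lambda>x. \<mu> *s f x - dop f x) | f. f \<in> test_functions} \<noteq> UNIV"
  then have nd: "closure V \<noteq> UNIV"
    by (simp add: V_def T_def[abs_def])
  have T: "T f \<in> test_functions" if "f \<in> test_functions" for f
    unfolding T_def[abs_def]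
    by (intro test_functions_diff dop_test_functions that test_functions_linear[OF bounded_linear_vector_smult])
  note sq = test_functions_square_integrable
  have "subspace V"
  proof (rule subspaceI)
    have "T (\<lambda>x. 0) = (\<lambda>x. 0)"
      by (simp add: T_def fun_eq_iff dop_def partial_deriv_def linear_0[OF bounded_linear.linear[OF bounded_linear_B]])
    then show "0 \<in> V"
      using test_functions_zero by (force simp: V_def zero_L2.abs_eq)
    fix u v and r :: real
    assume "u \<in> V"
    then obtain f where f: "u = L2_class (T f)" "f \<in> test_functions"
      by (auto simp: V_def)
    have f': "(\<lambda>x. of_real r *s f x) \<in> test_functions"
      by (rule test_functions_linear[OF bounded_linear_vector_smult f(2)])
    have "T (\<lambda>x. of_real r *s f x) = (\<lambda>x. r *\<^sub>R T f x)"
      using dop_scale[OF f(2)]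
      by (simp add: T_def fun_eq_iff vec_eq_iff scaleR_conv_of_real[where 'a = complex] algebra_simps)
    then have "r *\<^sub>R u = L2_class (T (\<lambda>x. of_real r *s f x))"
      using f sq[OF T[OF f(2)]] by (simp add: scaleR_L2.abs_eq L2_rel_refl)
    then show "r *\<^sub>R u \<in> V"
      using f' by (auto simp: V_def)
    assume "v \<in> V"
    then obtain g where g: "v = L2_class (T g)" "g \<in> test_functions"
      by (auto simp: V_def)
    have "T (\<lambda>x. f x + g x) = (\<lambda>x. T f x + T g x)"
      using dop_add[OF f(2) g(2)] by (simp add: T_def fun_eq_iff vector_add_ldistrib)
    then have "u + v = L2_class (T (\<lambda>x. f x + g x))"
      using f g L2_class_add[OF sq[OF T[OF f(2)]] sq[OF T[OF g(2)]]] by simp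
    then show "u + v \<in> V"
      using test_functions_add[OF f(2) g(2)] by (auto simp: V_def)
  qed
  from exists_orthogonal_vector[OF this nd]
  obtain z where z: "z \<noteq> 0" "\<And>v. v \<in> V \<Longrightarrow> inner v z = 0"
    by blast
  obtain g where g: "z = L2_class g" "square_integrable g"
    by (rule L2_cases)
  have "AE x in lborel. g x = 0"
  proof (rule weak_solution_eq_0[OF g(2)])
    fix f :: "'a \<Rightarrow> complex^'s"
    assume f: "f \<in> test_functions"
    then have "inner (L2_class (T f)) z = 0"
      by (intro z) (auto simp: V_def)
    then show "Re (\<integral>x. herm (\<mu> *s f x - dop f x) (g x) \<partial>lborel) = 0"
      using inner_L2_class[OF sq[OF T[OF f]] g(2)] by (simp add: g T_def)
  qed
  then have "z = 0"
    using g by (simp add: zero_L2.abs_eq L2_class_eq_iff square_integrable_zero)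
  with z show False
    by simp
qed

section \<open>The Dirac operator and its formal adjoint as Clifford systems\<close>

definition dirac_coeff :: "nat \<Rightarrow> 'n::{finite,linorder} Rn \<Rightarrow> 'n spinor \<Rightarrow> 'n spinor" where
  "dirac_coeff p b v = pseudo_inner p b b *\<^sub>R clifford_mult p b v"

lemma pseudo_inner_Basis:
  assumes "b \<in> Basis"
  shows "pseudo_inner p b b * pseudo_inner p b b = 1"
  using assms by (auto simp: Basis_Rn pseudo_inner_axis)

lemma clifford_system_clifford_mult:
  "clifford_system (\<lambda>b. pseudo_inner p b b) (clifford_mult p :: 'n::{finite,linorder} Rn \<Rightarrow> 'n spinor \<Rightarrow> 'n spinor)"
proof (rule clifford_system.intro)
  show "pseudo_inner p b b \<noteq> 0" if "b \<in> Basis" for b :: "'n Rn"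
    using pseudo_inner_Basis[OF that, of p] by auto
qed (simp_all add: bounded_linear_clifford_mult clifford_mult_scale clifford_mult_relation)

text \<open>The signs in the coefficients multiply each anticommutator by the product of two of
  them. This product is 1 on the diagonal, and off the diagonal the anticommutator is 0.\<close>

lemma clifford_system_dirac_coeff:
  "clifford_system (\<lambda>b. pseudo_inner p b b) (dirac_coeff p :: 'n::{finite,linorder} Rn \<Rightarrow> 'n spinor \<Rightarrow> 'n spinor)"
proof (rule clifford_system.intro)
  fix b c :: "'n Rn" and v and z :: complex
  show "bounded_linear (dirac_coeff p b)"
    unfolding dirac_coeff_def[abs_def]
    by (rule bounded_linear_compose[OF bounded_linear_scaleR_right bounded_linear_clifford_mult])
  show "dirac_coeff p b (z *s v) = z *s dirac_coeff p b v"
    by (simp add: dirac_coeff_def clifford_mult_scale vec_eq_iff)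
  assume b: "b \<in> Basis"
  then show "pseudo_inner p b b \<noteq> 0"
    using pseudo_inner_Basis[of b p] by auto
  assume c: "c \<in> Basis"
  have scale: "clifford_mult p d (r *\<^sub>R w) = r *\<^sub>R clifford_mult p d w" for d :: "'n Rn" and r w
    by (rule linear_cmul[OF bounded_linear.linear[OF bounded_linear_clifford_mult]])
  have "dirac_coeff p b (dirac_coeff p c v) + dirac_coeff p c (dirac_coeff p b v) =
      (pseudo_inner p b b * pseudo_inner p c c) *\<^sub>R
        (clifford_mult p b (clifford_mult p c v) + clifford_mult p c (clifford_mult p b v))"
    unfolding dirac_coeff_def scale scaleR_scaleR scaleR_add_right by (simp only: mult.commute)
  then show "dirac_coeff p b (dirac_coeff p c v) + dirac_coeff p c (dirac_coeff p b v) =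
      (if b = c then - 2 * pseudo_inner p b b else 0) *\<^sub>R v"
    unfolding clifford_mult_relation[OF b c]
    using pseudo_inner_Basis[OF b, of p] pseudo_inner_Basis[OF c, of p] by auto
qed

lemma sum_Basis_Rn: "(\<Sum>b\<in>Basis. f b) = (\<Sum>i\<in>UNIV. f (axis i 1 :: 'n::finite Rn))"
proof -
  have "(Basis :: 'n Rn set) = range (\<lambda>i. axis i 1)"
    using Basis_Rn by auto
  moreover have inj: "inj (\<lambda>i. axis i 1 :: 'n Rn)"
    by (simp add: inj_on_def axis_eq_axis)
  have "sum f (range (\<lambda>i. axis i 1)) = (\<Sum>i\<in>UNIV. f (axis i 1))"
    using sum.reindex[OF inj, of f] by (simp only: o_def)
  ultimately show ?thesis
    by (simp only:)
qed

lemma dirac_eq_dop: "dirac p \<psi> = clifford_system.dop (dirac_coeff p) \<psi>"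
  by (rule ext)
    (simp add: dirac_def clifford_system.dop_def[OF clifford_system_dirac_coeff] sum_Basis_Rn dirac_coeff_def)

text \<open>Moving Clifford multiplication by \<open>b\<close> to the other side gives minus the
  sign \<open>pseudo_inner p b b\<close>, which meets the same sign in the coefficient and leaves
  -1; integration by parts supplies the second -1.\<close>

lemma dirac_adjoint:
  fixes \<psi> \<phi> :: "'n::{finite,linorder} Rn \<Rightarrow> 'n spinor"
  assumes \<psi>: "\<psi> \<in> test_functions" and \<phi>: "\<phi> \<in> test_functions"
  shows "(\<integral>x. herm (dirac p \<psi> x) (\<phi> x) \<partial>lborel) =
    (\<integral>x. herm (\<psi> x) (clifford_system.dop (clifford_mult p) \<phi> x) \<partial>lborel)"
proof -
  note sq = test_functions_square_integrable and pd = test_functions_partial_deriv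
  note lin = test_functions_linear[OF bounded_linear_clifford_mult]
  interpret herm: bounded_bilinear "herm :: 'n spinor \<Rightarrow> 'n spinor \<Rightarrow> complex"
    by (rule bounded_bilinear_herm)
  have "herm (dirac_coeff p b u) v = - herm u (clifford_mult p b v)" if "b \<in> Basis" for b :: "'n Rn" and u v
    unfolding dirac_coeff_def herm.scaleR_left clifford_mult_adjoint[OF that] herm.scaleR_right herm.minus_right
    using pseudo_inner_Basis[OF that, of p] by (simp add: scaleR_scaleR)
  then have "herm (dirac p \<psi> x) (\<phi> x) = (\<Sum>b\<in>Basis. - herm (partial_deriv b \<psi> x) (clifford_mult p b (\<phi> x)))" for x
    unfolding dirac_eq_dop clifford_system.dop_def[OF clifford_system_dirac_coeff] herm_sum_left
    by (intro sum.cong refl) simp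
  then have "(\<integral>x. herm (dirac p \<psi> x) (\<phi> x) \<partial>lborel) =
      (\<Sum>b\<in>Basis. - (\<integral>x. herm (partial_deriv b \<psi> x) (clifford_mult p b (\<phi> x)) \<partial>lborel))"
    using \<psi> \<phi> by (simp add: integrable_herm sq pd lin)
  also have "\<dots> = (\<Sum>b\<in>Basis. \<integral>x. herm (\<psi> x) (clifford_mult p b (partial_deriv b \<phi> x)) \<partial>lborel)"
  proof (intro sum.cong refl)
    fix b :: "'n Rn"
    assume b: "b \<in> Basis"
    have "partial_deriv b (\<lambda>x. clifford_mult p b (\<phi> x)) = (\<lambda>x. clifford_mult p b (partial_deriv b \<phi> x))"
      by (rule partial_deriv_linear[OF bounded_linear_clifford_mult test_functions_differentiable[OF \<phi>]])
    then show "- (\<integral>x. herm (partial_deriv b \<psi> x) (clifford_mult p b (\<phi> x)) \<partial>lborel) =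
        (\<integral>x. herm (\<psi> x) (clifford_mult p b (partial_deriv b \<phi> x)) \<partial>lborel)"
      using integral_herm_by_parts[OF \<psi> lin[OF \<phi>, of p b] b] by simp
  qed
  also have "\<dots> = (\<integral>x. (\<Sum>b\<in>Basis. herm (\<psi> x) (clifford_mult p b (partial_deriv b \<phi> x))) \<partial>lborel)"
    using \<psi> \<phi> by (intro Bochner_Integration.integral_sum[symmetric] integrable_herm sq pd lin)
  finally show ?thesis
    by (simp add: clifford_system.dop_def[OF clifford_system_clifford_mult] herm.sum_right)
qed

section \<open>Kernel, range and inverse of the shifted operator\<close>

lemma shifted_L2_class:
  assumes "\<psi> \<in> test_functions"
  shows "l *\<^sub>C L2_class \<psi> - L2_class (dirac p \<psi>) = L2_class (\<lambda>x. l *s \<psi> x - dirac p \<psi> x)"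
proof -
  have "square_integrable \<psi>" "square_integrable (dirac p \<psi>)"
    by (intro test_functions_square_integrable dirac_test_functions assms)+
  then show ?thesis
    by (simp add: scaleC_L2_def L2_scaleC.abs_eq L2_rel_refl L2_class_diff square_integrable_scale)
qed

lemma shifted_dirac_operator:
  "shifted l (dirac_operator p) =
    {(L2_class \<psi>, L2_class (\<lambda>x. l *s \<psi> x - dirac p \<psi> x)) | \<psi>. \<psi> \<in> test_functions}"
proof (intro equalityI subrelI)
  fix x y
  assume "(x, y) \<in> shifted l (dirac_operator p)"
  then obtain \<psi> where \<psi>: "\<psi> \<in> test_functions"
    and xy: "x = L2_class \<psi>" "y = l *\<^sub>C L2_class \<psi> - L2_class (dirac p \<psi>)"
    unfolding shifted_def dirac_operator_def by auto
  show "(x, y) \<in> {(L2_class \<psi>, L2_class (\<lambda>x. l *s \<psi> x - dirac p \<psi> x)) | \<psi>. \<psi> \<in> test_functions}"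
    unfolding xy shifted_L2_class[OF \<psi>] using \<psi> by blast
next
  fix x y
  assume "(x, y) \<in> {(L2_class \<psi>, L2_class (\<lambda>x. l *s \<psi> x - dirac p \<psi> x)) | \<psi>. \<psi> \<in> test_functions}"
  then obtain \<psi> where \<psi>: "\<psi> \<in> test_functions"
    and xy: "x = L2_class \<psi>" "y = L2_class (\<lambda>x. l *s \<psi> x - dirac p \<psi> x)"
    by blast
  show "(x, y) \<in> shifted l (dirac_operator p)"
    unfolding xy shifted_L2_class[OF \<psi>, symmetric] shifted_def dirac_operator_def using \<psi> by blast
qed

lemma shifted_mono: "A \<subseteq> B \<Longrightarrow> shifted l A \<subseteq> shifted l B"
  unfolding shifted_def by blast

lemma op_ker_shifted_closure_dirac:
  fixes p :: nat
  defines "D \<equiv> dirac_operator p :: ('n::{finite,linorder} Rn, 'n spinor_index) L2 operator"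
  shows "op_ker (shifted l (closure D)) = {0}"
proof
  interpret adj: clifford_system "\<lambda>b. pseudo_inner p b b" "clifford_mult p :: 'n Rn \<Rightarrow> 'n spinor \<Rightarrow> 'n spinor"
    by (rule clifford_system_clifford_mult)
  note sq = test_functions_square_integrable
  have "(L2_class (\<lambda>x. 0), L2_class (dirac p (\<lambda>x. 0))) \<in> D"
    unfolding D_def dirac_operator_def using test_functions_zero by blast
  moreover have "dirac p (\<lambda>x. 0) = (\<lambda>x. 0 :: 'n spinor)"
    by (simp add: fun_eq_iff dirac_def partial_deriv_def clifford_mult_zero)
  ultimately have "(0, 0) \<in> closure D"
    using closure_subset[of D] by (auto simp: zero_L2.abs_eq)
  then have "(0, l *\<^sub>C 0 - 0) \<in> shifted l (closure D)"
    unfolding shifted_def by blast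
  moreover have "l *\<^sub>C 0 = (0 :: ('n Rn, 'n spinor_index) L2)"
    using scaleC_add_right[of l 0 "0 :: ('n Rn, 'n spinor_index) L2"] by simp
  ultimately show "{0} \<subseteq> op_ker (shifted l (closure D))"
    by (simp add: op_ker_def)
  show "op_ker (shifted l (closure D)) \<subseteq> {0}"
  proof
    fix u
    assume "u \<in> op_ker (shifted l (closure D))"
    then have u: "(u, l *\<^sub>C u) \<in> closure D"
      by (auto simp: op_ker_def shifted_def)
    obtain g where g: "u = L2_class g" "square_integrable g"
      by (rule L2_cases)
    have "AE x in lborel. g x = 0"
    proof (rule adj.weak_solution_eq_0[OF g(2)])
      fix \<phi> :: "'n Rn \<Rightarrow> 'n spinor"
      assume \<phi>: "\<phi> \<in> test_functions"
      \<comment> \<open>Pairing with a fixed test function is continuous, so the adjoint relation is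
        closed and passes from the graph of the operator to its closure. With second component
        \<open>l *\<^sub>C u\<close> it becomes the weak equation of the adjoint with parameter
        \<open>cnj l\<close>.\<close>
      define S where "S = {w. inner (snd w) (L2_class \<phi>) = inner (fst w) (L2_class (adj.dop \<phi>))}"
      have "closed S"
        unfolding S_def by (intro closed_Collect_eq continuous_intros)
      moreover have "D \<subseteq> S"
        unfolding D_def dirac_operator_def S_def
        using \<phi> by (auto simp: inner_L2_class sq dirac_test_functions adj.dop_test_functions dirac_adjoint)
      ultimately have "closure D \<subseteq> S"
        by (simp add: closure_minimal)
      then have "inner (l *\<^sub>C u) (L2_class \<phi>) = inner u (L2_class (adj.dop \<phi>))"
        using u unfolding S_def by auto
      then have "inner (cnj l *\<^sub>C L2_class \<phi> - L2_class (adj.dop \<phi>)) u = 0"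
        unfolding inner_diff_left inner_scaleC_cnj
        using inner_commute[of "l *\<^sub>C u" "L2_class \<phi>"] inner_commute[of u "L2_class (adj.dop \<phi>)"] by simp
      moreover have "cnj l *\<^sub>C L2_class \<phi> - L2_class (adj.dop \<phi>) = L2_class (\<lambda>x. cnj l *s \<phi> x - adj.dop \<phi> x)"
        using \<phi> by (simp add: scaleC_L2_def L2_scaleC.abs_eq L2_rel_refl L2_class_diff sq square_integrable_scale
            adj.dop_test_functions)
      moreover have "(\<lambda>x. cnj l *s \<phi> x - adj.dop \<phi> x) \<in> test_functions"
        by (intro test_functions_diff adj.dop_test_functions \<phi> test_functions_linear[OF bounded_linear_vector_smult])
      ultimately show "Re (\<integral>x. herm (cnj l *s \<phi> x - adj.dop \<phi> x) (g x) \<partial>lborel) = 0"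
        using g by (simp add: inner_L2_class sq)
    qed
    then show "u \<in> {0}"
      using g by (simp add: zero_L2.abs_eq L2_class_eq_iff square_integrable_zero)
  qed
qed

lemma closure_Range_shifted_dirac:
  fixes p :: nat
  defines "D \<equiv> dirac_operator p :: ('n::{finite,linorder} Rn, 'n spinor_index) L2 operator"
  assumes "D \<subseteq> A"
  shows "closure (Range (shifted l A)) = UNIV"
proof -
  have "Range (shifted l D) = {L2_class (\<lambda>x. l *s \<psi> x - dirac p \<psi> x) | \<psi>. \<psi> \<in> test_functions}"
    unfolding D_def shifted_dirac_operator by auto
  then have "closure (Range (shifted l D)) = UNIV"
    unfolding dirac_eq_dop using clifford_system.dense_range[OF clifford_system_dirac_coeff] by simp
  moreover have "Range (shifted l D) \<subseteq> Range (shifted l A)"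
    using shifted_mono[OF assms(2)] by blast
  ultimately show ?thesis
    using closure_mono by blast
qed

text \<open>A bound for the inverse of any extension would in particular bound test functions by
  their images, which \<open>not_bounded_below\<close> excludes.\<close>

lemma unbounded_inverse_shifted_dirac:
  fixes p :: nat
  defines "D \<equiv> dirac_operator p :: ('n::{finite,linorder} Rn, 'n spinor_index) L2 operator"
  assumes p: "0 < p" "p < CARD('n)" and A: "D \<subseteq> A"
  shows "\<not> op_bounded (converse (shifted l A))"
proof
  assume "op_bounded (converse (shifted l A))"
  then obtain C where C: "\<And>x y. (y, x) \<in> shifted l A \<Longrightarrow> norm y \<le> C * norm x"
    unfolding op_bounded_def by auto
  have "norm (L2_class \<psi>) \<le> C * norm (L2_class (\<lambda>x. l *s \<psi> x - dirac p \<psi> x))"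
    if "\<psi> \<in> test_functions" for \<psi> :: "'n Rn \<Rightarrow> 'n spinor"
  proof (rule C)
    show "(L2_class \<psi>, L2_class (\<lambda>x. l *s \<psi> x - dirac p \<psi> x)) \<in> shifted l A"
      using shifted_mono[OF A, of l] that unfolding D_def shifted_dirac_operator by blast
  qed
  \<comment> \<open>Since 0 < p < n, the first coordinate is time-like and the last one space-like;
    the sum of these two basis vectors is a null vector.\<close>
  moreover obtain i k :: 'n where "coord_no i = 1" "coord_no k = CARD('n)"
    using coord_no_surj[of 1, where 'n = 'n] coord_no_surj[of "CARD('n)", where 'n = 'n] p by (metis One_nat_def Suc_leI le_refl less_trans)
  then have "pseudo_inner p (axis i 1) (axis i 1) + pseudo_inner p (axis k 1) (axis k 1) = 0"
    using p by (simp add: pseudo_inner_axis)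
  moreover have "axis i (1::real) \<in> Basis" "axis k (1::real) \<in> Basis"
    by (simp_all add: axis_in_Basis_iff)
  ultimately show False
    using clifford_system.not_bounded_below[OF clifford_system_dirac_coeff[of p], of "axis i 1" "axis k 1" C l]
    unfolding dirac_eq_dop by blast
qed

theorem theorem5p3:
  fixes p q :: nat
    and D :: "('n::{finite,linorder} Rn, 'n spinor_index) L2 operator"
  assumes "CARD('n) = p + q" and "CARD('n) \<ge> 2" and "0 < p" and "p < CARD('n)"
    and "D = dirac_operator p"
  shows "spectrum D = UNIV \<and> spectrum (closure D) = UNIV \<and>
    continuous_spectrum (closure D) = UNIV \<and>
    point_spectrum (closure D) = {} \<and> residual_spectrum (closure D) = {}"
proof -
  \<comment> \<open>An unbounded inverse alone keeps \<open>l\<close> out of the resolvent set, so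
    this settles the spectrum of \<open>D\<close> and of its closure; kernel and range then place
    every \<open>l\<close> in the continuous part.\<close>
  have "\<not> op_bounded (converse (shifted l D))" "\<not> op_bounded (converse (shifted l (closure D)))" for l
    using unbounded_inverse_shifted_dirac[OF assms(3,4)] closure_subset[of D] assms(5) by auto
  moreover have "closure (Range (shifted l (closure D))) = UNIV" for l
    using closure_Range_shifted_dirac closure_subset[of D] assms(5) by blast
  moreover have "op_ker (shifted l (closure D)) = {0}" for l
    unfolding assms(5) by (rule op_ker_shifted_closure_dirac)
  ultimately show ?thesis
    by (simp add: spectrum_def resolvent_set_def continuous_spectrum_def point_spectrum_def residual_spectrum_def)
qed

end
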